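(* Given a directed or undirected graph with $n$ vertices and $m$ edges, its vertices can be output in a BFS order starting at a given vertex using $n\lg 3+O(n/f(n))$ bits of working space and $O(m f(n)\lg n)$ time, where $f(n)$ is any extremely slow-growing function of $n$.
   Context: Model: the input graph is stored in read-only memory as a standard adjacency list, output goes to write-only memory, and only the additional random-access workspace is counted, in bits; the workspace is a word RAM with words of $\Omega(\lg n)$ bits. As a standing assumption of the paper, the input graph is connected (so $m\ge n-1$). *)

theory Defs
  imports
    "HOL-Library.Landau_Symbols"
    "Graph_Theory.Graph_Theory"
    "Graph_Theory.Shortest_Path"
begin

section \<open>Graphs and BFS orders\<close>

text \<open>
  An undirected graph is a symmetric digraph, each edge standing for two opposite arcs.
  Loops are allowed, parallel edges are not.
\<close>

datatype kind = Directed | Undirected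

fun graph_of_kind :: "kind \<Rightarrow> nat pair_pre_digraph \<Rightarrow> bool" where
  "graph_of_kind Directed G = pair_fin_digraph G"
| "graph_of_kind Undirected G = pair_pseudo_graph G"

fun num_edges :: "kind \<Rightarrow> nat pair_pre_digraph \<Rightarrow> nat" where
  "num_edges Directed G = card (parcs G)"
| "num_edges Undirected G = card ((\<lambda>(u, v). {u, v}) ` parcs G)"

text \<open>For a digraph, \<^const>\<open>connected\<close> refers to the underlying undirected graph.\<close>

definition input_graph :: "kind \<Rightarrow> nat pair_pre_digraph \<Rightarrow> nat \<Rightarrow> nat \<Rightarrow> bool" where
  "input_graph kd G n m \<longleftrightarrow>
     graph_of_kind kd G \<and> pverts G = {..<n} \<and> num_edges kd G = m \<and> connected (with_proj G)"

definition hop_dist :: "nat pair_pre_digraph \<Rightarrow> nat \<Rightarrow> nat \<Rightarrow> ereal" where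
  "hop_dist G u v = wf_digraph.\<mu> (with_proj G) (\<lambda>_. 1) u v"

text \<open>
  The search from root \<open>r\<close> when the vertices in \<open>D\<close> have already been visited. In the uses
  below \<open>D\<close> is closed under taking out-neighbours, so that paths from \<open>r\<close> to unvisited
  vertices avoid \<open>D\<close>, and distances in the whole graph are the right ones.
\<close>

definition bfs_from :: "nat pair_pre_digraph \<Rightarrow> nat set \<Rightarrow> nat \<Rightarrow> nat list \<Rightarrow> bool" where
  "bfs_from G D r ys \<longleftrightarrow>
     r \<in> pverts G - D \<and> distinct ys \<and> set ys = {v. r \<rightarrow>\<^sup>*\<^bsub>with_proj G\<^esub> v} - D \<and>
     sorted_wrt (\<lambda>u v. hop_dist G r u \<le> hop_dist G r v) ys"

inductive bfs_restarts :: "nat pair_pre_digraph \<Rightarrow> nat set \<Rightarrow> nat list \<Rightarrow> bool"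
  for G :: "nat pair_pre_digraph" where
  finished: "D = pverts G \<Longrightarrow> bfs_restarts G D []"
| restart: "bfs_from G D r ys \<Longrightarrow> bfs_restarts G (D \<union> set ys) zs \<Longrightarrow> bfs_restarts G D (ys @ zs)"

text \<open>
  A BFS order lists all vertices. If every vertex is reachable from \<open>s\<close> (in particular, in a
  connected undirected graph), it lists them by nondecreasing distance from \<open>s\<close>; the order
  within one distance is free. Otherwise the search is restarted, as usual, from
  arbitrary unvisited vertices.
\<close>

definition bfs_order :: "nat pair_pre_digraph \<Rightarrow> nat \<Rightarrow> nat list \<Rightarrow> bool" where
  "bfs_order G s xs \<longleftrightarrow>
     (\<exists>ys zs. xs = ys @ zs \<and> bfs_from G {} s ys \<and> bfs_restarts G (set ys) zs)"

section \<open>The word RAM\<close>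

text \<open>
  Words are natural numbers below \<open>2 ^ w\<close>. There are no registers: all variables of a program
  live in workspace cells of \<open>w\<close> bits each, and so are counted. \<open>Ind a\<close> is the cell whose
  address is stored in cell \<open>a\<close>.
\<close>

datatype place = Cell nat | Ind nat

datatype operand = Const nat | Val place

datatype binop = Add | Sub | Mul | Div | Mod | And | Or | Xor | Shl | Shr

datatype test = Eq | Less

datatype prog =
    Move place operand
  | Op binop place operand operand
  | Read place operand
  | Write operand
  | Seq prog prog
  | If test operand operand prog prog
  | While test operand operand prog

fun place_addr :: "nat list \<Rightarrow> place \<Rightarrow> nat option" where
  "place_addr M (Cell a) = (if a < length M then Some a else None)"
| "place_addr M (Ind a) = (if a < length M \<and> M ! a < length M then Some (M ! a) else None)"

fun fetch :: "nat \<Rightarrow> nat list \<Rightarrow> operand \<Rightarrow> nat option" where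
  "fetch w M (Const c) = Some (take_bit w c)"
| "fetch w M (Val p) = map_option (nth M) (place_addr M p)"

text \<open>Arithmetic is modulo \<open>2 ^ w\<close>; for division by zero the HOL conventions apply.\<close>

fun binop_val :: "nat \<Rightarrow> binop \<Rightarrow> nat \<Rightarrow> nat \<Rightarrow> nat" where
  "binop_val w Add x y = take_bit w (x + y)"
| "binop_val w Sub x y = take_bit w (2 ^ w + x - y)"
| "binop_val w Mul x y = take_bit w (x * y)"
| "binop_val w Div x y = x div y"
| "binop_val w Mod x y = x mod y"
| "binop_val w And x y = semiring_bit_operations_class.and x y"
| "binop_val w Or x y = semiring_bit_operations_class.or x y"
| "binop_val w Xor x y = semiring_bit_operations_class.xor x y"
| "binop_val w Shl x y = take_bit w (push_bit y x)"
| "binop_val w Shr x y = drop_bit y x"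

fun test_val :: "test \<Rightarrow> nat \<Rightarrow> nat \<Rightarrow> bool" where
  "test_val Eq x y = (x = y)"
| "test_val Less x y = (x < y)"

text \<open>
  \<open>run w I c (M, out) t (M', out')\<close>: with word length \<open>w\<close> and read-only input \<open>I\<close>, program \<open>c\<close>
  started on workspace \<open>M\<close> with output \<open>out\<close> written so far terminates after \<open>t\<close> unit-cost
  instructions in \<open>(M', out')\<close>. Accesses outside of the workspace or of the input are stuck:
  they have no derivation, and the length of \<open>M\<close> bounds the space of a run.
\<close>

inductive run ::
  "nat \<Rightarrow> nat list \<Rightarrow> prog \<Rightarrow> nat list \<times> nat list \<Rightarrow> nat \<Rightarrow> nat list \<times> nat list \<Rightarrow> bool"
  for w :: nat and I :: "nat list" where
  Move: "place_addr M d = Some a \<Longrightarrow> fetch w M x = Some u \<Longrightarrow>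
    run w I (Move d x) (M, out) 1 (M[a := u], out)"
| Op: "place_addr M d = Some a \<Longrightarrow> fetch w M x = Some u \<Longrightarrow> fetch w M y = Some v \<Longrightarrow>
    run w I (Op b d x y) (M, out) 1 (M[a := binop_val w b u v], out)"
| Read: "place_addr M d = Some a \<Longrightarrow> fetch w M x = Some u \<Longrightarrow> u < length I \<Longrightarrow>
    run w I (Read d x) (M, out) 1 (M[a := I ! u], out)"
| Write: "fetch w M x = Some u \<Longrightarrow> run w I (Write x) (M, out) 1 (M, out @ [u])"
| Seq: "run w I c \<sigma> t \<sigma>' \<Longrightarrow> run w I d \<sigma>' t' \<sigma>'' \<Longrightarrow> run w I (Seq c d) \<sigma> (t + t') \<sigma>''"
| If: "fetch w M x = Some u \<Longrightarrow> fetch w M y = Some v \<Longrightarrow>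
    run w I (if test_val b u v then c else d) (M, out) t \<sigma>' \<Longrightarrow>
    run w I (If b x y c d) (M, out) (1 + t) \<sigma>'"
| While_False: "fetch w M x = Some u \<Longrightarrow> fetch w M y = Some v \<Longrightarrow> \<not> test_val b u v \<Longrightarrow>
    run w I (While b x y c) (M, out) 1 (M, out)"
| While_True: "fetch w M x = Some u \<Longrightarrow> fetch w M y = Some v \<Longrightarrow> test_val b u v \<Longrightarrow>
    run w I c (M, out) t \<sigma>' \<Longrightarrow> run w I (While b x y c) \<sigma>' t' \<sigma>'' \<Longrightarrow>
    run w I (While b x y c) (M, out) (1 + t + t') \<sigma>''"

definition words :: "nat \<Rightarrow> nat list \<Rightarrow> bool" where
  "words w xs \<longleftrightarrow> (\<forall>x\<in>set xs. x < 2 ^ w)"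

section \<open>The input: adjacency lists\<close>

text \<open>A list cell at address \<open>p\<close> consists of an item and the address of the next cell; 0 is nil.\<close>

inductive linked_list :: "nat list \<Rightarrow> nat \<Rightarrow> nat list \<Rightarrow> bool" for I :: "nat list" where
  nil: "linked_list I 0 []"
| cell: "p \<noteq> 0 \<Longrightarrow> p + 1 < length I \<Longrightarrow> linked_list I (I ! (p + 1)) xs \<Longrightarrow>
    linked_list I p (I ! p # xs)"

text \<open>
  Address 0 holds the number of vertices, address 1 the start vertex, address \<open>2 + v\<close> the head
  pointer of the list of out-neighbours of \<open>v\<close>. The lists are in no particular order and may be
  placed anywhere.
\<close>

definition adjacency_input :: "nat pair_pre_digraph \<Rightarrow> nat \<Rightarrow> nat \<Rightarrow> nat list \<Rightarrow> bool" where
  "adjacency_input G n s I \<longleftrightarrow>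
     n + 2 \<le> length I \<and> I ! 0 = n \<and> I ! 1 = s \<and>
     (\<forall>v<n. \<exists>xs. linked_list I (I ! (2 + v)) xs \<and> distinct xs \<and> set xs = {u. (v, u) \<in> parcs G})"

text \<open>
  Words are long enough to hold every item and every address of the input (hence have at least
  \<open>lg n\<close> bits).
\<close>

definition input_fits :: "nat \<Rightarrow> nat list \<Rightarrow> bool" where
  "input_fits w I \<longleftrightarrow> words w I \<and> length I \<le> 2 ^ w"

section \<open>Slowly growing functions\<close>

text \<open>
  Any reasonable meaning of ``extremely slow-growing'' implies this condition. Neither
  monotonicity nor computability of \<open>f\<close> is required.
\<close>

definition slow_growing :: "(nat \<Rightarrow> real) \<Rightarrow> bool" where
  "slow_growing f \<longleftrightarrow> filterlim f at_top sequentially \<and> f \<in> o(\<lambda>n. log 2 (real n))"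

end

theory Submission
  imports Defs "HOL-Real_Asymp.Real_Asymp"
begin

text \<open>
  Three colours per vertex suffice: white, and the parity of the level for visited vertices. To
  expand a level one scans vertices of its parity; scanning an old vertex of the same parity
  again does no harm, because all its neighbours have been visited. To find the vertices of the
  level without scanning all of them, the vertices are divided into blocks of \<open>q = \<Theta>(lg n)\<close>
  vertices, whose colours are packed into one field, and the blocks into superblocks of \<open>q\<close>
  blocks. For each of the two parities, a bitmap per superblock marks the blocks that contain a
  vertex of the level, and a stack holds the superblocks with a nonzero bitmap; all of this takes
  \<open>O(n / lg n)\<close> bits. A block is expanded only if it contains an unexpanded vertex, hence at
  most \<open>q\<close> times, and so every adjacency list is read \<open>O(lg n)\<close> times.

  This takes \<open>n lg 3 + O(n / lg n + w)\<close> bits and \<open>O(m lg n + w)\<close> steps, so that one program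
  serves all functions \<open>f\<close> at once.
\<close>

section \<open>A program logic with a step counter\<close>

text \<open>The leading constant of the space bound has to be exactly \<open>lg 3\<close>, although
  words may be much longer than \<open>lg n\<close>. So every rounding may cost only O(1) bits per
  \<Theta>(lg n) bits of data. The \<open>q\<close> colours of a block form one number below
  \<open>3 ^ q\<close>, in a field of at most \<open>(q + 1) lg 3\<close> bits; the powers of 3
  needed to get at a digit come from a table of O(lg^2 n) bits.

  A stack of blocks would be too large: n / q entries of \<Theta>(lg n) bits are \<Theta>(n) bits.
  With superblocks there are only about n / q^2 entries, and the bitmaps need one bit per block and
  parity.

  The time is amortised: every unexpanded vertex holds credit for one expansion of its whole block
  (\<open>weight\<close>, \<open>pot\<close>), and these credits sum up to q times the number of
  vertices and arcs. As \<open>f n\<close> is at most \<open>lg n\<close> for large n, the error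
  term n / lg n is within n / f(n). The numerical constants in the step counts are rounded up
  freely.\<close>

fun seqs :: "prog list \<Rightarrow> prog" where
  "seqs [] = Move (Cell 0) (Const 0)"
| "seqs [c] = c"
| "seqs (c # cs) = Seq c (seqs cs)"

abbreviation V :: "nat \<Rightarrow> operand" where "V a \<equiv> Val (Cell a)"

text \<open>The existential asserts termination and the absence of stuck accesses at once. The
  postcondition sees a clock instead of a duration, so that running times need no bookkeeping at
  \<open>Seq\<close>.\<close>

definition wp where
  "wp w I c Q M out \<tau> \<longleftrightarrow> (\<exists>t M' out'. run w I c (M, out) t (M', out') \<and> Q M' out' (\<tau> + t))"

text \<open>Used with base \<open>2 ^ b\<close> for a field in a word and with base 3 for a colour
  in a field. The third claim is there because \<open>2 ^ w\<close> need not be a power of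
  \<open>2 ^ b\<close>: the digits above k stay the same, so any bound that is a multiple of
  \<open>B ^ Suc k\<close> survives. The fourth claim makes the subtraction exact on natural
  numbers.\<close>

lemma digit_update:
  fixes X B v k :: nat
  assumes "B > 0" "v < B"
  defines "Y \<equiv> X - X div B ^ k mod B * B ^ k + v * B ^ k"
  shows "Y div B ^ j mod B = (if j = k then v else X div B ^ j mod B)"
    and "X < B ^ m \<Longrightarrow> k < m \<Longrightarrow> Y < B ^ m"
    and "B ^ Suc k dvd N \<Longrightarrow> X < N \<Longrightarrow> Y < N"
    and "X div B ^ k mod B * B ^ k \<le> X"
proof -
  define lo where "lo = X mod B ^ k"
  define hi where "hi = X div B ^ Suc k"
  define d where "d = X div B ^ k mod B"
  have hi: "hi = X div B ^ k div B"
    unfolding hi_def power_Suc2 div_mult2_eq ..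
  have X: "X = hi * B ^ Suc k + d * B ^ k + lo"
  proof -
    have "X div B ^ k = hi * B + d" unfolding hi d_def by simp
    then have "X = (hi * B + d) * B ^ k + lo" unfolding lo_def by (metis div_mult_mod_eq)
    then show ?thesis by (simp add: algebra_simps)
  qed
  have lo: "lo < B ^ k" unfolding lo_def using assms(1) by simp
  show "X div B ^ k mod B * B ^ k \<le> X" using X unfolding d_def by linarith
  have Y: "Y = hi * B ^ Suc k + v * B ^ k + lo"
    unfolding Y_def using X unfolding d_def[symmetric] by linarith
  have eqk: "(hi * B ^ Suc k + u * B ^ k + lo) div B ^ k mod B = u" if "u < B" for u
  proof -
    have "hi * B ^ Suc k + u * B ^ k + lo = lo + (hi * B + u) * B ^ k" by (simp add: algebra_simps)
    then have "(hi * B ^ Suc k + u * B ^ k + lo) div B ^ k = hi * B + u"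
      using lo assms(1) by simp
    then show ?thesis using that by simp
  qed
  have lt: "(hi * B ^ Suc k + u * B ^ k + lo) div B ^ j mod B = lo div B ^ j mod B" if jk: "j < k" for u
  proof -
    obtain e where e: "k = j + Suc e" using less_imp_Suc_add[OF jk] by auto
    have "hi * B ^ Suc k + u * B ^ k + lo = lo + ((hi * B + u) * B ^ e * B) * B ^ j"
      unfolding e by (simp add: algebra_simps power_add)
    then have "(hi * B ^ Suc k + u * B ^ k + lo) div B ^ j = lo div B ^ j + ((hi * B + u) * B ^ e * B)"
      using assms(1) by simp
    then show ?thesis by simp
  qed
  have gt: "(hi * B ^ Suc k + u * B ^ k + lo) div B ^ j mod B = hi div B ^ (j - Suc k) mod B" if jk: "j > k" and uB: "u < B" for u
  proof -
    obtain e where e: "j = Suc k + e" using less_imp_Suc_add[OF jk] by auto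
    have "u * B ^ k + lo < B ^ Suc k"
    proof -
      have "u * B ^ k + lo < (u + 1) * B ^ k" using lo by simp
      also have "\<dots> \<le> B * B ^ k" using uB by (intro mult_right_mono) auto
      finally show ?thesis by simp
    qed
    then have "(hi * B ^ Suc k + u * B ^ k + lo) div B ^ Suc k = hi"
      using assms(1) by (simp only: add.assoc) simp
    then show ?thesis unfolding e power_add div_mult2_eq by simp
  qed
  have dB: "d < B" unfolding d_def using assms(1) by simp
  show "Y div B ^ j mod B = (if j = k then v else X div B ^ j mod B)"
  proof (cases j k rule: linorder_cases)
    case less
    then show ?thesis using lt[OF less, of v] lt[OF less, of d] X Y by simp
  next
    case equal
    then show ?thesis using eqk[OF assms(2)] Y by simp
  next
    case greater
    then show ?thesis using gt[OF greater assms(2)] gt[OF greater dB] X Y by simp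
  qed
  have gen: "Y < N" if "B ^ Suc k dvd N" "X < N" for N
  proof -
    obtain e where e: "N = B ^ Suc k * e" using \<open>B ^ Suc k dvd N\<close> by (elim dvdE)
    have "hi < e" using \<open>X < N\<close> unfolding e hi_def by (simp add: less_mult_imp_div_less mult.commute)
    have "v * B ^ k + lo < B ^ Suc k"
    proof -
      have "v * B ^ k + lo < (v + 1) * B ^ k" using lo by simp
      also have "\<dots> \<le> B * B ^ k" using assms(2) by (intro mult_right_mono) auto
      finally show ?thesis by simp
    qed
    then have "Y < (hi + 1) * B ^ Suc k" unfolding Y by simp
    also have "\<dots> \<le> e * B ^ Suc k" using \<open>hi < e\<close> by (intro mult_right_mono) auto
    finally show ?thesis unfolding e by (simp add: mult.commute)
  qed
  show "Y < N" if "B ^ Suc k dvd N" "X < N" using gen that by blast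
  show "Y < B ^ m" if "X < B ^ m" "k < m" using gen[of "B ^ m"] that by (metis Suc_leI le_imp_power_dvd)
qed

section \<open>Sizes of words under bitwise operations\<close>

lemma take_bit_less: "(x::nat) < 2 ^ w \<Longrightarrow> take_bit w x = x"
  by (simp add: take_bit_nat_eq_self)

lemma less_power_iff_bits: "z < 2 ^ k \<longleftrightarrow> (\<forall>i\<ge>k. \<not> bit (z::nat) i)"
proof
  assume "z < 2 ^ k"
  then have "take_bit k z = z" by (rule take_bit_less)
  then show "\<forall>i\<ge>k. \<not> bit z i" by (metis bit_take_bit_iff not_less)
next
  assume "\<forall>i\<ge>k. \<not> bit z i"
  then show "z < 2 ^ k" by (metis bit_eqI bit_take_bit_iff take_bit_nat_eq_self_iff not_less)
qed

text \<open>Both directions matter: the length of \<open>or (n + 1) 524288\<close> serves as the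
  maximum of two lengths, and bounds are read off it either way.\<close>

lemma or_less_iff:
  "semiring_bit_operations_class.or x y < 2 ^ k \<longleftrightarrow> x < 2 ^ k \<and> y < (2::nat) ^ k"
  unfolding less_power_iff_bits bit_or_iff by blast

lemma bit_nonzero: "bit (x::nat) i \<Longrightarrow> x \<noteq> 0"
  by (rule notI) simp

lemma and_less:
  assumes "(x::nat) < 2 ^ w" "y < 2 ^ w"
  shows "semiring_bit_operations_class.and x y < 2 ^ w"
  using assms by (metis take_bit_less take_bit_nat_less_exp take_bit_and)

lemma xor_less:
  assumes "(x::nat) < 2 ^ w" "y < 2 ^ w"
  shows "semiring_bit_operations_class.xor x y < 2 ^ w"
  using assms by (metis take_bit_less take_bit_nat_less_exp take_bit_xor)

lemma binop_val_less: "x < 2 ^ w \<Longrightarrow> y < 2 ^ w \<Longrightarrow> binop_val w b x y < 2 ^ w"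
  by (cases b) (auto simp: and_less or_less_iff xor_less drop_bit_eq_div
      intro: le_less_trans[OF div_le_dividend] le_less_trans[OF mod_less_eq_dividend])

fun okop :: "operand \<Rightarrow> bool" where
  "okop (Const x) = (x < 1048576)"
| "okop (Val (Cell a)) = (4 \<le> a \<and> a < 32)"
| "okop (Val (Ind a)) = False"

fun opv :: "(nat \<Rightarrow> nat) \<Rightarrow> operand \<Rightarrow> nat" where
  "opv \<rho> (Const x) = x"
| "opv \<rho> (Val (Cell a)) = \<rho> a"
| "opv \<rho> (Val (Ind a)) = 0"

text \<open>The field geometry (\<open>c\<close> fields of \<open>b\<close> bits per word,
  \<open>NF\<close> fields) is fixed before any register contains it. In this way the
  initialisation, which computes it, can be verified in the same logic; \<open>geo\<close> says when
  the registers agree with it.\<close>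

locale ram =
  fixes w :: nat and I :: "nat list" and S c b NF :: nat
  assumes w20: "20 \<le> w" and wI: "words w I" and c1: "1 \<le> c" and b1: "1 \<le> b" and cb: "c * b \<le> w"
    and NF: "NF \<le> (S - 32) * c" and S32: "32 \<le> S" and Sw: "S \<le> 2 ^ w"
begin

definition fld :: "nat list \<Rightarrow> nat \<Rightarrow> nat" where
  "fld M i = M ! (32 + i div c) div (2 ^ b) ^ (i mod c) mod 2 ^ b"

text \<open>The abstract state is a map of registers and a map of fields, each constrained only on
  its range. Scratch cells are left open, so routines may overwrite them without changing the
  abstract state.\<close>

definition rep :: "(nat \<Rightarrow> nat) \<Rightarrow> (nat \<Rightarrow> nat) \<Rightarrow> nat list \<Rightarrow> bool" where
  "rep \<rho> F M \<longleftrightarrow> length M = S \<and> words w M \<and> (\<forall>i. 4 \<le> i \<and> i < 32 \<longrightarrow> M ! i = \<rho> i) \<and>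
     (\<forall>i<NF. fld M i = F i)"

text \<open>\<open>\<tau>\<close> counts the steps from the start of the whole program.\<close>

definition awp where
  "awp p Q \<rho> F out \<tau> \<longleftrightarrow>
     (\<forall>M. rep \<rho> F M \<longrightarrow> wp w I p (\<lambda>M' out' \<tau>'. \<exists>\<rho>' F'. rep \<rho>' F' M' \<and> Q \<rho>' F' out' \<tau>') M out \<tau>)"

lemma words_nth: "words w M \<Longrightarrow> i < length M \<Longrightarrow> M ! i < 2 ^ w"
  by (auto simp: words_def)

lemma words_update: "words w M \<Longrightarrow> u < 2 ^ w \<Longrightarrow> words w (M[i := u])"
  unfolding words_def using set_update_subset_insert[of M i u] by auto

lemma w_big: "1048576 \<le> (2::nat) ^ w"
proof -
  have "(2::nat) ^ 20 \<le> 2 ^ w" by (intro power_increasing w20) auto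
  then show ?thesis by simp
qed

lemma fetch_rep:
  assumes "rep \<rho> F M" "okop x"
  shows "fetch w M x = Some (opv \<rho> x)" "opv \<rho> x < 2 ^ w"
proof -
  have "fetch w M x = Some (opv \<rho> x) \<and> opv \<rho> x < 2 ^ w"
  proof (cases x rule: okop.cases)
    case (1 u)
    then have "u < 2 ^ w" using assms(2) w_big by simp
    then show ?thesis using 1 by (simp add: take_bit_less)
  next
    case (2 a)
    then have "4 \<le> a" "a < 32" using assms(2) by auto
    moreover from this have "M ! a < 2 ^ w" using assms(1) S32 by (intro words_nth) (auto simp: rep_def)
    ultimately show ?thesis using 2 assms(1) S32 by (auto simp: rep_def)
  next
    case (3 a)
    then show ?thesis using assms(2) by simp
  qed
  then show "fetch w M x = Some (opv \<rho> x)" "opv \<rho> x < 2 ^ w" by auto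
qed

lemma rep_assign:
  assumes "rep \<rho> F M" "4 \<le> d" "d < 32" "u < 2 ^ w"
  shows "rep (\<rho>(d := u)) F (M[d := u])"
  using assms S32 unfolding rep_def by (auto simp: words_update fld_def)

lemma rep_temp:
  assumes "rep \<rho> F M" "d < 4" "u < 2 ^ w"
  shows "rep \<rho> F (M[d := u])"
  using assms S32 unfolding rep_def by (auto simp: words_update fld_def)

section \<open>Proof rules on abstract states\<close>

lemma awp_conseq:
  assumes "awp p Q \<rho> F out \<tau>" "\<And>\<rho> F out \<tau>. Q \<rho> F out \<tau> \<Longrightarrow> Q' \<rho> F out \<tau>"
  shows "awp p Q' \<rho> F out \<tau>"
  using assms unfolding awp_def wp_def by meson

lemma awp_Seq:
  assumes "awp p (awp q Q) \<rho> F out \<tau>"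
  shows "awp (Seq p q) Q \<rho> F out \<tau>"
  unfolding awp_def wp_def
proof (intro allI impI)
  fix M assume "rep \<rho> F M"
  with assms obtain t M' out' \<rho>' F' where 1: "run w I p (M, out) t (M', out')" "rep \<rho>' F' M'"
    "awp q Q \<rho>' F' out' (\<tau> + t)" unfolding awp_def wp_def by blast
  then obtain t2 M2 out2 \<rho>2 F2 where 2: "run w I q (M', out') t2 (M2, out2)" "rep \<rho>2 F2 M2"
    "Q \<rho>2 F2 out2 (\<tau> + t + t2)" unfolding awp_def wp_def by blast
  show "\<exists>t M' out'. run w I (Seq p q) (M, out) t (M', out') \<and> (\<exists>\<rho>' F'. rep \<rho>' F' M' \<and> Q \<rho>' F' out' (\<tau> + t))"
    proof (intro exI conjI)
    show "run w I (Seq p q) (M, out) (t + t2) (M2, out2)" by (rule run.Seq[OF 1(1) 2(1)])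
    show "rep \<rho>2 F2 M2" by (rule 2(2))
    show "Q \<rho>2 F2 out2 (\<tau> + (t + t2))" using 2(3) by (simp only: add.assoc)
  qed
qed

lemma awp_seqs: "awp p (awp (seqs (q # qs)) Q) \<rho> F out \<tau> \<Longrightarrow> awp (seqs (p # q # qs)) Q \<rho> F out \<tau>"
  by (simp add: awp_Seq)

lemma awp_seqs1: "awp p Q \<rho> F out \<tau> \<Longrightarrow> awp (seqs [p]) Q \<rho> F out \<tau>"
  by simp

text \<open>\<open>seqs []\<close> stands for an empty statement: it overwrites scratch cell 0,
  which \<open>rep\<close> does not see, and costs one step.\<close>

lemma awp_Skip:
  assumes "Q \<rho> F out (\<tau> + 1)"
  shows "awp (seqs []) Q \<rho> F out \<tau>"
  unfolding awp_def wp_def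
proof (intro allI impI)
  fix M assume "rep \<rho> F M"
  then have "run w I (seqs []) (M, out) 1 (M[0 := 0], out)" "rep \<rho> F (M[0 := 0])"
    using rep_temp[of \<rho> F M 0 0] S32 by (auto simp: rep_def intro!: run.Move[unfolded One_nat_def])
  with assms show "\<exists>t M' out'. run w I (seqs []) (M, out) t (M', out') \<and> (\<exists>\<rho>' F'. rep \<rho>' F' M' \<and> Q \<rho>' F' out' (\<tau> + t))"
    by blast
qed

lemma awp_Move:
  assumes "4 \<le> d \<and> d < 32" "okop x" "opv \<rho> x = u" "Q (\<rho>(d := u)) F out (\<tau> + 1)"
  shows "awp (Move (Cell d) x) Q \<rho> F out \<tau>"
  unfolding awp_def wp_def
proof (intro allI impI)
  fix M assume r: "rep \<rho> F M"
  have "run w I (Move (Cell d) x) (M, out) 1 (M[d := u], out)"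
    using r assms(1-3) fetch_rep[OF r assms(2)] S32 by (auto simp: rep_def intro!: run.Move[unfolded One_nat_def])
  moreover have "rep (\<rho>(d := u)) F (M[d := u])"
    using rep_assign[OF r] fetch_rep[OF r assms(2)] assms(1,3) by blast
  ultimately show "\<exists>t M' out'. run w I (Move (Cell d) x) (M, out) t (M', out') \<and> (\<exists>\<rho>' F'. rep \<rho>' F' M' \<and> Q \<rho>' F' out' (\<tau> + t))"
    using assms(4) by blast
qed

lemma awp_Op:
  assumes "4 \<le> d \<and> d < 32" "okop x \<and> okop y"
    and Q: "opv \<rho> x < 2 ^ w \<Longrightarrow> opv \<rho> y < 2 ^ w \<Longrightarrow> Q (\<rho>(d := binop_val w bo (opv \<rho> x) (opv \<rho> y))) F out (\<tau> + 1)"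
  shows "awp (Op bo (Cell d) x y) Q \<rho> F out \<tau>"
  unfolding awp_def wp_def
proof (intro allI impI)
  let ?z = "binop_val w bo (opv \<rho> x) (opv \<rho> y)"
  fix M assume r: "rep \<rho> F M"
  have f: "fetch w M x = Some (opv \<rho> x)" "fetch w M y = Some (opv \<rho> y)" "opv \<rho> x < 2 ^ w" "opv \<rho> y < 2 ^ w"
    using fetch_rep[OF r] assms(2) by auto
  have "run w I (Op bo (Cell d) x y) (M, out) 1 (M[d := ?z], out)"
    using r assms(1-3) f S32 by (auto simp: rep_def intro!: run.Op[unfolded One_nat_def])
  moreover have "rep (\<rho>(d := ?z)) F (M[d := ?z])"
    using rep_assign[OF r] binop_val_less[OF f(3,4)] assms(1) by blast
  ultimately show "\<exists>t M' out'. run w I (Op bo (Cell d) x y) (M, out) t (M', out') \<and> (\<exists>\<rho>' F'. rep \<rho>' F' M' \<and> Q \<rho>' F' out' (\<tau> + t))"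
    using Q[OF f(3,4)] by blast
qed

lemma awp_Add:
  assumes "4 \<le> d \<and> d < 32" "okop x \<and> okop y" "opv \<rho> x = u" "opv \<rho> y = v" "u + v < 2 ^ w"
    "Q (\<rho>(d := u + v)) F out (\<tau> + 1)"
  shows "awp (Op Add (Cell d) x y) Q \<rho> F out \<tau>"
  using assms by (intro awp_Op) (auto simp: take_bit_less)

lemma awp_Sub:
  assumes "4 \<le> d \<and> d < 32" "okop x \<and> okop y" "opv \<rho> x = u" "opv \<rho> y = v" "v \<le> u"
    "Q (\<rho>(d := u - v)) F out (\<tau> + 1)"
  shows "awp (Op Sub (Cell d) x y) Q \<rho> F out \<tau>"
proof (rule awp_Op[OF assms(1,2)])
  assume l: "opv \<rho> x < 2 ^ w"
  have "2 ^ w + u - v = (u - v) + 2 ^ w" using assms(5) by simp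
  moreover have "u - v < 2 ^ w" using l assms(3) by simp
  ultimately have "take_bit w (2 ^ w + u - v) = u - v" by (metis mod_add_self2 mod_less take_bit_eq_mod)
  then show "Q (\<rho>(d := binop_val w Sub (opv \<rho> x) (opv \<rho> y))) F out (\<tau> + 1)"
    using assms by simp
qed

lemma awp_Mul:
  assumes "4 \<le> d \<and> d < 32" "okop x \<and> okop y" "opv \<rho> x = u" "opv \<rho> y = v" "u * v < 2 ^ w"
    "Q (\<rho>(d := u * v)) F out (\<tau> + 1)"
  shows "awp (Op Mul (Cell d) x y) Q \<rho> F out \<tau>"
  using assms by (intro awp_Op) (auto simp: take_bit_less)

lemma awp_Div:
  assumes "4 \<le> d \<and> d < 32" "okop x \<and> okop y" "opv \<rho> x = u" "opv \<rho> y = v"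
    "Q (\<rho>(d := u div v)) F out (\<tau> + 1)"
  shows "awp (Op Div (Cell d) x y) Q \<rho> F out \<tau>"
  using assms by (intro awp_Op) auto

lemma awp_Mod:
  assumes "4 \<le> d \<and> d < 32" "okop x \<and> okop y" "opv \<rho> x = u" "opv \<rho> y = v"
    "Q (\<rho>(d := u mod v)) F out (\<tau> + 1)"
  shows "awp (Op Mod (Cell d) x y) Q \<rho> F out \<tau>"
  using assms by (intro awp_Op) auto

lemma awp_Or:
  assumes "4 \<le> d \<and> d < 32" "okop x \<and> okop y" "opv \<rho> x = u" "opv \<rho> y = v"
    "Q (\<rho>(d := semiring_bit_operations_class.or u v)) F out (\<tau> + 1)"
  shows "awp (Op Or (Cell d) x y) Q \<rho> F out \<tau>"
  using assms by (intro awp_Op) auto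

lemma awp_Shl1:
  assumes "4 \<le> d \<and> d < 32" "okop y" "opv \<rho> y = v" "v < w"
    "Q (\<rho>(d := 2 ^ v)) F out (\<tau> + 1)"
  shows "awp (Op Shl (Cell d) (Const 1) y) Q \<rho> F out \<tau>"
  using assms by (intro awp_Op) (auto simp: push_bit_eq_mult take_bit_less)

lemma awp_Read:
  assumes "4 \<le> d \<and> d < 32" "okop x" "opv \<rho> x = u" "u < length I" "Q (\<rho>(d := I ! u)) F out (\<tau> + 1)"
  shows "awp (Read (Cell d) x) Q \<rho> F out \<tau>"
  unfolding awp_def wp_def
proof (intro allI impI)
  fix M assume r: "rep \<rho> F M"
  have "run w I (Read (Cell d) x) (M, out) 1 (M[d := I ! u], out)"
    using r assms(1-4) fetch_rep[OF r assms(2)] S32 by (auto simp: rep_def intro!: run.Read[unfolded One_nat_def])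
  moreover have "rep (\<rho>(d := I ! u)) F (M[d := I ! u])"
    using rep_assign[OF r] words_nth[OF wI assms(4)] assms(1) by blast
  ultimately show "\<exists>t M' out'. run w I (Read (Cell d) x) (M, out) t (M', out') \<and> (\<exists>\<rho>' F'. rep \<rho>' F' M' \<and> Q \<rho>' F' out' (\<tau> + t))"
    using assms(5) by blast
qed

lemma awp_Write:
  assumes "okop x" "opv \<rho> x = u" "Q \<rho> F (out @ [u]) (\<tau> + 1)"
  shows "awp (Write x) Q \<rho> F out \<tau>"
  unfolding awp_def wp_def
proof (intro allI impI)
  fix M assume r: "rep \<rho> F M"
  have "run w I (Write x) (M, out) 1 (M, out @ [u])"
    using fetch_rep[OF r assms(1)] assms(2) by (auto intro!: run.Write[unfolded One_nat_def])
  then show "\<exists>t M' out'. run w I (Write x) (M, out) t (M', out') \<and> (\<exists>\<rho>' F'. rep \<rho>' F' M' \<and> Q \<rho>' F' out' (\<tau> + t))"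
    using assms(3) r by blast
qed

lemma awp_If:
  assumes "okop x \<and> okop y"
    "test_val bo (opv \<rho> x) (opv \<rho> y) \<Longrightarrow> awp p Q \<rho> F out (\<tau> + 1)"
    "\<not> test_val bo (opv \<rho> x) (opv \<rho> y) \<Longrightarrow> awp q Q \<rho> F out (\<tau> + 1)"
  shows "awp (If bo x y p q) Q \<rho> F out \<tau>"
  unfolding awp_def wp_def
proof (intro allI impI)
  fix M assume r: "rep \<rho> F M"
  have f: "fetch w M x = Some (opv \<rho> x)" "fetch w M y = Some (opv \<rho> y)"
    using fetch_rep[OF r] assms(1) by auto
  let ?r = "if test_val bo (opv \<rho> x) (opv \<rho> y) then p else q"
  have "awp ?r Q \<rho> F out (\<tau> + 1)" using assms(2,3) by auto
  then obtain t M' out' where 1: "run w I ?r (M, out) t (M', out')" and 2: "\<exists>\<rho>' F'. rep \<rho>' F' M' \<and> Q \<rho>' F' out' (\<tau> + 1 + t)"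
    using r unfolding awp_def wp_def by blast
  show "\<exists>t M' out'. run w I (If bo x y p q) (M, out) t (M', out') \<and> (\<exists>\<rho>' F'. rep \<rho>' F' M' \<and> Q \<rho>' F' out' (\<tau> + t))"
    proof (rule exI[of _ "1 + t"], rule exI[of _ M'], rule exI[of _ out'], rule conjI)
    show "run w I (If bo x y p q) (M, out) (1 + t) (M', out')" by (rule run.If[OF f 1])
    show "\<exists>\<rho>' F'. rep \<rho>' F' M' \<and> Q \<rho>' F' out' (\<tau> + (1 + t))" using 2 by (simp only: add.assoc)
  qed
qed

text \<open>The counter \<open>\<tau>\<close> increases in every iteration, so the bound \<open>T\<close> makes the loop terminate.\<close>

lemma awp_While:
  assumes inv: "J \<rho> F out \<tau>"
    and ok: "okop x \<and> okop y"
    and bound: "\<And>\<rho> F out \<tau>. J \<rho> F out \<tau> \<Longrightarrow> \<tau> \<le> T"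
    and step: "\<And>\<rho> F out \<tau>. J \<rho> F out \<tau> \<Longrightarrow> test_val bo (opv \<rho> x) (opv \<rho> y) \<Longrightarrow> awp p J \<rho> F out (\<tau> + 1)"
    and exit: "\<And>\<rho> F out \<tau>. J \<rho> F out \<tau> \<Longrightarrow> \<not> test_val bo (opv \<rho> x) (opv \<rho> y) \<Longrightarrow> Q \<rho> F out (\<tau> + 1)"
  shows "awp (While bo x y p) Q \<rho> F out \<tau>"
  using inv
proof (induction "T - \<tau>" arbitrary: \<rho> F out \<tau> rule: less_induct)
  case less
  show ?case unfolding awp_def wp_def
  proof (intro allI impI)
    fix M assume r: "rep \<rho> F M"
    have f: "fetch w M x = Some (opv \<rho> x)" "fetch w M y = Some (opv \<rho> y)"
      using fetch_rep[OF r] ok by auto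
    show "\<exists>t M' out'. run w I (While bo x y p) (M, out) t (M', out') \<and> (\<exists>\<rho>' F'. rep \<rho>' F' M' \<and> Q \<rho>' F' out' (\<tau> + t))"
    proof (cases "test_val bo (opv \<rho> x) (opv \<rho> y)")
      case False
      then show ?thesis using run.While_False[OF f False] exit[OF less.prems False] r by blast
    next
      case True
      obtain t M1 out1 \<rho>1 F1 where 1: "run w I p (M, out) t (M1, out1)" "rep \<rho>1 F1 M1" "J \<rho>1 F1 out1 (\<tau> + 1 + t)"
        using step[OF less.prems True] r unfolding awp_def wp_def by blast
      have "T - (\<tau> + 1 + t) < T - \<tau>" using bound[OF 1(3)] by simp
      from less.hyps[OF this 1(3)] obtain t2 M2 out2 where
        2: "run w I (While bo x y p) (M1, out1) t2 (M2, out2)" "\<exists>\<rho>' F'. rep \<rho>' F' M2 \<and> Q \<rho>' F' out2 (\<tau> + 1 + t + t2)"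
        using 1(2) unfolding awp_def wp_def by blast
      show ?thesis proof (rule exI[of _ "1 + t + t2"], rule exI[of _ M2], rule exI[of _ out2], rule conjI)
        show "run w I (While bo x y p) (M, out) (1 + t + t2) (M2, out2)"
          by (rule run.While_True[OF f True 1(1) 2(1)])
        show "\<exists>\<rho>' F'. rep \<rho>' F' M2 \<and> Q \<rho>' F' out2 (\<tau> + (1 + t + t2))" using 2(2) by (simp only: add.assoc)
      qed
    qed
  qed
qed

end

section \<open>Fields of bits\<close>

text \<open>
  The cells 0 to 3 are scratch space, the cells 4 to 31 are registers, and the remaining ones are
  divided into fields of \<open>b\<close> bits, \<open>c\<close> in a word. The lengths are chosen as \<open>c = w div L\<close> and
  \<open>b = w div c\<close>, where \<open>L = \<Theta>(lg n)\<close>. Then \<open>L \<le> b \<le> 2 L\<close> for every word length \<open>w \<ge> L\<close>,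
  fewer than \<open>c\<close> bits of each word are wasted, and no field crosses a word boundary.
\<close>

lemma wp_seqs: "wp w I p (wp w I (seqs (q # qs)) Q) M out \<tau> \<Longrightarrow> wp w I (seqs (p # q # qs)) Q M out \<tau>"
  unfolding wp_def using run.Seq by (simp add: add.assoc) blast

lemma wp_seqs1: "wp w I p Q M out \<tau> \<Longrightarrow> wp w I (seqs [p]) Q M out \<tau>"
  by simp

lemma wp_Op:
  assumes "fetch w M x = Some u" "fetch w M y = Some v" "binop_val w bo u v = z"
    "place_addr M d = Some a" "Q (M[a := z]) out (Suc \<tau>)"
  shows "wp w I (Op bo d x y) Q M out \<tau>"
  unfolding wp_def using run.Op[OF assms(4,1,2), of I bo out] assms by (metis One_nat_def Suc_eq_plus1)

lemma wp_Move:
  assumes "fetch w M x = Some u" "place_addr M d = Some a" "Q (M[a := u]) out (Suc \<tau>)"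
  shows "wp w I (Move d x) Q M out \<tau>"
  unfolding wp_def using run.Move[OF assms(2,1), of I out] assms by (metis One_nat_def Suc_eq_plus1)

abbreviation (input) "rC \<equiv> 5::nat"
abbreviation (input) "rB \<equiv> 6::nat"
abbreviation (input) "rM \<equiv> 7::nat"

definition rdf :: "nat \<Rightarrow> nat \<Rightarrow> prog" where
  "rdf d x = seqs [
     Op Div (Cell 0) (V x) (V rC), Op Add (Cell 0) (V 0) (Const 32),
     Op Mod (Cell 1) (V x) (V rC), Op Mul (Cell 1) (V 1) (V rB),
     Move (Cell 0) (Val (Ind 0)), Op Shr (Cell 0) (V 0) (V 1), Op And (Cell d) (V 0) (V rM)]"

text \<open>The word is changed arithmetically, as in \<open>digit_update\<close>: the old field
  times a power of 2 is subtracted and the new one is added. All intermediate values stay in scratch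
  cells.\<close>

definition wrf :: "nat \<Rightarrow> nat \<Rightarrow> prog" where
  "wrf x y = seqs [
     Op Div (Cell 0) (V x) (V rC), Op Add (Cell 0) (V 0) (Const 32),
     Op Mod (Cell 1) (V x) (V rC), Op Mul (Cell 1) (V 1) (V rB), Op Shl (Cell 1) (Const 1) (V 1),
     Move (Cell 2) (Val (Ind 0)), Op Div (Cell 3) (V 2) (V 1), Op And (Cell 3) (V 3) (V rM),
     Op Mul (Cell 3) (V 3) (V 1), Op Sub (Cell 2) (V 2) (V 3), Op Mul (Cell 3) (V y) (V 1),
     Op Add (Cell 2) (V 2) (V 3), Move (Ind 0) (V 2)]"

definition clr :: "nat \<Rightarrow> prog" where
  "clr x = Move (Ind x) (Const 0)"

section \<open>Packed fields: reading, writing, and clearing a whole word\<close>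

context ram
begin

definition geo :: "(nat \<Rightarrow> nat) \<Rightarrow> bool" where
  "geo \<rho> \<longleftrightarrow> \<rho> rC = c \<and> \<rho> rB = b \<and> \<rho> rM = 2 ^ b - 1"

lemma NF_div: "i < NF \<Longrightarrow> 32 + i div c < S"
proof -
  assume "i < NF"
  then have "i < (S - 32) * c" using NF by simp
  then have "i div c < S - 32" by (rule less_mult_imp_div_less)
  then show ?thesis by simp
qed

lemma shift_bound: "i mod c * b + b \<le> w"
proof -
  have "i mod c + 1 \<le> c" using c1 by (simp add: Suc_leI)
  then have "(i mod c + 1) * b \<le> c * b" by (rule mult_right_mono) simp
  then show ?thesis using cb by simp
qed

lemma awp_rdf:
  assumes "geo \<rho>" "4 \<le> d \<and> d < 32" "4 \<le> x \<and> x < 32" "\<rho> x = i" "i < NF" "F i = u" "Q (\<rho>(d := u)) F out (\<tau> + 7)"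
  shows "awp (rdf d x) Q \<rho> F out \<tau>"
  unfolding awp_def
proof (intro allI impI)
  fix M assume r: "rep \<rho> F M"
  have L: "length M = S" and W: "words w M" and regs: "\<And>i. 4 \<le> i \<Longrightarrow> i < 32 \<Longrightarrow> M ! i = \<rho> i"
    using r by (auto simp: rep_def)
  have g: "M ! 5 = c" "M ! 6 = b" "M ! 7 = mask b" "M ! x = i"
    using assms(1,3,4) regs by (auto simp: geo_def mask_eq_exp_minus_1)
  define a where "a = 32 + i div c"
  define s where "s = i mod c * b"
  have a: "a < S" "a \<ge> 32" "a < 2 ^ w" using NF_div[OF assms(5)] Sw unfolding a_def by auto
  have s: "s < 2 ^ w" using shift_bound[of i] b1 unfolding s_def
    by (meson le_less_trans less_exp add_leD1 order_less_le_trans)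
  have t32: "take_bit w 32 = (32::nat)" using w_big by (intro take_bit_less) simp
  define z where "z = drop_bit s (M ! a)"
  have "z < 2 ^ w" unfolding z_def drop_bit_eq_div using words_nth[OF W, of a] a L
    by (auto intro: le_less_trans[OF div_le_dividend])
  have res: "semiring_bit_operations_class.and z (mask b) = F i"
    using r assms(5) by (auto simp: rep_def fld_def z_def a_def s_def drop_bit_eq_div take_bit_eq_mod
        power_mult[symmetric] mult.commute[of b] simp flip: take_bit_eq_mask)
  have fin: "rep (\<rho>(d := u)) F (M[0 := z, 1 := s, d := u])"
  proof -
    have "F i < 2 ^ w" unfolding res[symmetric] using \<open>z < 2 ^ w\<close> g words_nth[OF W, of 7] S32 L
      by (intro and_less) auto
    then show ?thesis using rep_assign[OF rep_temp[OF rep_temp[OF r, of 0 z], of 1 s]] assms(2,6) s \<open>z < 2 ^ w\<close> by auto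
  qed
  have [simp]: "x \<noteq> 0" "x \<noteq> Suc 0" "x < S" "d < S" "d \<noteq> 0" "d \<noteq> Suc 0" "a \<noteq> Suc 0" "a \<noteq> 0"
    using assms(2,3) S32 a by auto
  show "wp w I (rdf d x) (\<lambda>M' out' \<tau>'. \<exists>\<rho>' F'. rep \<rho>' F' M' \<and> Q \<rho>' F' out' \<tau>') M out \<tau>"
    unfolding rdf_def
    apply (rule wp_seqs)
    apply (rule wp_Op[where u = i and v = c and z = "i div c" and a = 0], (use S32 L g in \<open>simp; fail\<close>)+)
    apply (rule wp_seqs)
    apply (rule wp_Op[where u = "i div c" and v = 32 and z = a and a = 0],
        (use S32 L g a in \<open>simp add: t32 a_def take_bit_less; fail\<close>)+)
    apply (rule wp_seqs)
    apply (rule wp_Op[where u = i and v = c and z = "i mod c" and a = 1], (use S32 L g in \<open>simp; fail\<close>)+)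
    apply (rule wp_seqs)
    apply (rule wp_Op[where u = "i mod c" and v = b and z = s and a = 1],
        (use S32 L g s in \<open>simp add: s_def take_bit_less; fail\<close>)+)
    apply (rule wp_seqs)
    apply (rule wp_Move[where u = "M ! a" and a = 0], (use S32 L g a in \<open>simp; fail\<close>)+)
    apply (rule wp_seqs)
    apply (rule wp_Op[where u = "M ! a" and v = s and z = z and a = 0], (use S32 L g in \<open>simp add: z_def; fail\<close>)+)
    apply (rule wp_seqs1)
    apply (rule wp_Op[where u = z and v = "mask b" and z = u and a = d], (use S32 L g res assms(6) in \<open>simp; fail\<close>)+)
    using fin assms(7) by (auto simp: list_update_swap eval_nat_numeral)
qed

lemma awp_wrf:
  assumes "geo \<rho>" "4 \<le> x \<and> x < 32" "4 \<le> y \<and> y < 32" "\<rho> x = i" "i < NF" "\<rho> y = u" "u < 2 ^ b"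
    "Q \<rho> (F(i := u)) out (\<tau> + 13)"
  shows "awp (wrf x y) Q \<rho> F out \<tau>"
  unfolding awp_def
proof (intro allI impI)
  fix M assume r: "rep \<rho> F M"
  have L: "length M = S" and W: "words w M" and regs: "\<And>i. 4 \<le> i \<Longrightarrow> i < 32 \<Longrightarrow> M ! i = \<rho> i"
    using r by (auto simp: rep_def)
  have g: "M ! 5 = c" "M ! 6 = b" "M ! 7 = mask b" "M ! x = i" "M ! y = u"
    using assms(1-6) regs by (auto simp: geo_def mask_eq_exp_minus_1)
  define a where "a = 32 + i div c"
  define s where "s = i mod c * b"
  define P where "P = (2::nat) ^ s"
  define X where "X = M ! a"
  define e where "e = X div P mod 2 ^ b"
  have P: "P = (2 ^ b) ^ (i mod c)" unfolding P_def s_def by (simp add: power_mult[symmetric] mult.commute)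
  have a: "a < S" "a \<ge> 32" "a < 2 ^ w" using NF_div[OF assms(5)] Sw unfolding a_def by auto
  have sw: "s + b \<le> w" using shift_bound[of i] unfolding s_def .
  have s: "s < 2 ^ w" using sw b1 by (meson le_less_trans less_exp add_leD1 order_less_le_trans)
  have PB: "P * 2 ^ b \<le> 2 ^ w" unfolding P_def power_add[symmetric] using sw by (intro power_increasing) auto
  have PB2: "v * P < 2 ^ w" if "v < 2 ^ b" for v
  proof -
    have "v * P < 2 ^ b * P" using that by (simp add: P_def)
    then show ?thesis using PB by (simp only: mult.commute[of "2 ^ b"])
  qed
  \<comment> \<open>The field ends within the word and has at least one bit, so the shifted 1 is not
    lost.\<close>
  have Pw: "P < 2 ^ w" using PB2[of 1] b1 one_less_power[of "2::nat" b] by simp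
  have t32: "take_bit w 32 = (32::nat)" "take_bit w 1 = (1::nat)"
    using w_big w20 by (auto intro!: take_bit_less)
  have X: "X < 2 ^ w" unfolding X_def using words_nth[OF W] a L by auto
  have eb: "e < 2 ^ b" unfolding e_def by simp
  have eX: "e * P \<le> X" using digit_update(4)[of "2 ^ b" 0 X "i mod c"] unfolding e_def P by simp
  define Y where "Y = X - e * P + u * P"
  have Y: "Y < 2 ^ w"
  proof -
    have "(2 ^ b) ^ Suc (i mod c) dvd (2::nat) ^ w"
      using sw unfolding s_def by (simp add: power_mult[symmetric] power_add[symmetric] le_imp_power_dvd algebra_simps)
    from digit_update(3)[OF _ assms(7) this X] show ?thesis unfolding Y_def e_def P by simp
  qed
  have Yd: "Y div (2 ^ b) ^ j mod 2 ^ b = (if j = i mod c then u else X div (2 ^ b) ^ j mod 2 ^ b)" for j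
    using digit_update(1)[OF _ assms(7), of X "i mod c" j] unfolding Y_def e_def P by simp
  let ?M = "M[0 := a, 1 := P, 2 := Y, 3 := u * P, a := Y]"
  have fin: "rep \<rho> (F(i := u)) ?M"
  proof -
    have r1: "rep \<rho> F (M[0 := a, 1 := P, 2 := Y, 3 := u * P])" (is "rep _ _ ?M1")
      using r a Pw Y PB2[OF assms(7)] by (intro rep_temp) auto
    have "fld ?M j = (F(i := u)) j" if "j < NF" for j
    proof -
      have 1: "fld ?M1 j = F j" using r1 that by (simp add: rep_def)
      have 2: "?M1 ! a = X" using a by (simp add: X_def)
      show ?thesis
      proof (cases "j div c = i div c")
        case True
        then have aj: "32 + j div c = a" unfolding a_def by simp
        have "fld ?M j = Y div (2 ^ b) ^ (j mod c) mod 2 ^ b" unfolding fld_def aj using a L by simp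
        moreover have "F j = X div (2 ^ b) ^ (j mod c) mod 2 ^ b" using 1 2 unfolding fld_def aj by simp
        moreover have "j mod c = i mod c \<longleftrightarrow> j = i" using True by (metis div_mult_mod_eq)
        ultimately show ?thesis unfolding Yd by simp
      next
        case False
        then have "32 + j div c \<noteq> a" "j \<noteq> i" unfolding a_def by auto
        then show ?thesis using 1 by (simp add: fld_def)
      qed
    qed
    moreover have "?M ! j = \<rho> j" if "4 \<le> j" "j < 32" for j
      using r1 that a unfolding rep_def by auto
    moreover have "words w ?M" using words_update[of ?M1 Y a] r1 Y by (simp add: rep_def)
    ultimately show ?thesis using L unfolding rep_def by simp
  qed
  have [simp]: "x \<noteq> 0" "x \<noteq> Suc 0" "x < S" "y < S" "y \<noteq> 0" "y \<noteq> Suc 0" "y \<noteq> 2" "y \<noteq> 3" "0 \<noteq> y" "Suc 0 \<noteq> y" "2 \<noteq> y" "3 \<noteq> y"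
    "0 \<noteq> x" "Suc 0 \<noteq> x"
    "a \<noteq> Suc 0" "a \<noteq> 0" "a \<noteq> 2" "a \<noteq> 3" "a < S"
    using assms(2,3) S32 a by auto
  have S4 [simp]: "0 < S" "Suc 0 < S" "2 < S" "3 < S" "5 < S" "6 < S" "7 < S" using S32 by auto
  have e': "semiring_bit_operations_class.and (X div P) (mask b) = e"
    unfolding e_def by (simp add: take_bit_eq_mod flip: take_bit_eq_mask)
  have sub: "binop_val w Sub X (e * P) = X - e * P"
  proof -
    have "2 ^ w + X - e * P = (X - e * P) + 2 ^ w" using eX by simp
    moreover have "X - e * P < 2 ^ w" using X by simp
    ultimately show ?thesis by (simp only: binop_val.simps) (metis mod_add_self2 mod_less take_bit_eq_mod)
  qed
  show "wp w I (wrf x y) (\<lambda>M' out' \<tau>'. \<exists>\<rho>' F'. rep \<rho>' F' M' \<and> Q \<rho>' F' out' \<tau>') M out \<tau>"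
    unfolding wrf_def
    apply (rule wp_seqs)
    apply (rule wp_Op[where u = i and v = c and z = "i div c" and a = 0], (use L g in \<open>simp; fail\<close>)+)
    apply (rule wp_seqs)
    apply (rule wp_Op[where u = "i div c" and v = 32 and z = a and a = 0],
        (use L g a in \<open>simp add: t32 a_def take_bit_less; fail\<close>)+)
    apply (rule wp_seqs)
    apply (rule wp_Op[where u = i and v = c and z = "i mod c" and a = 1], (use L g in \<open>simp; fail\<close>)+)
    apply (rule wp_seqs)
    apply (rule wp_Op[where u = "i mod c" and v = b and z = s and a = 1],
        (use L g s in \<open>simp add: s_def take_bit_less; fail\<close>)+)
    apply (rule wp_seqs)
    apply (rule wp_Op[where u = 1 and v = s and z = P and a = 1],
        (use L g s t32 Pw in \<open>simp add: P_def push_bit_eq_mult take_bit_less; fail\<close>)+)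
    apply (rule wp_seqs)
    apply (rule wp_Move[where u = X and a = 2], (use L g a in \<open>simp add: X_def; fail\<close>)+)
    apply (rule wp_seqs)
    apply (rule wp_Op[where u = X and v = P and z = "X div P" and a = 3], (use L g in \<open>simp; fail\<close>)+)
    apply (rule wp_seqs)
    apply (rule wp_Op[where u = "X div P" and v = "mask b" and z = e and a = 3], (use L g e' in \<open>simp; fail\<close>)+)
    apply (rule wp_seqs)
    apply (rule wp_Op[where u = e and v = P and z = "e * P" and a = 3],
        (use L g PB2[OF eb] in \<open>simp add: take_bit_less; fail\<close>)+)
    apply (rule wp_seqs)
    apply (rule wp_Op[where u = X and v = "e * P" and z = "X - e * P" and a = 2, OF _ _ sub], (use L g in \<open>simp; fail\<close>)+)
    apply (rule wp_seqs)
    apply (rule wp_Op[where u = u and v = P and z = "u * P" and a = 3],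
        (use L g PB2[OF assms(7)] in \<open>simp add: take_bit_less; fail\<close>)+)
    apply (rule wp_seqs)
    apply (rule wp_Op[where u = "X - e * P" and v = "u * P" and z = Y and a = 2],
        (use L g Y in \<open>simp add: Y_def take_bit_less; fail\<close>)+)
    apply (rule wp_seqs1)
    apply (rule wp_Move[where u = Y and a = a], (use L g in \<open>simp; fail\<close>)+)
    using fin assms(8) by (auto simp: list_update_swap eval_nat_numeral)
qed

lemma awp_clr:
  assumes "4 \<le> x \<and> x < 32" "\<rho> x = a" "32 \<le> a" "a < S"
    "\<And>G. (\<And>i. i div c = a - 32 \<Longrightarrow> G i = 0) \<Longrightarrow> (\<And>i. i div c \<noteq> a - 32 \<Longrightarrow> G i = F i) \<Longrightarrow> Q \<rho> G out (\<tau> + 1)"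
  shows "awp (clr x) Q \<rho> F out \<tau>"
  unfolding awp_def
proof (intro allI impI)
  fix M assume r: "rep \<rho> F M"
  define G where "G i = (if i div c = a - 32 then 0 else F i)" for i
  have L: "length M = S" using r by (simp add: rep_def)
  have "fld (M[a := 0]) i = G i" if "i < NF" for i
  proof (cases "i div c = a - 32")
    case True
    then show ?thesis using assms(3,4) L unfolding fld_def G_def by simp
  next
    case False
    then have "32 + i div c \<noteq> a" by auto
    then show ?thesis using False r that unfolding fld_def G_def rep_def by simp
  qed
  then have "rep \<rho> G (M[a := 0])" using r assms(3) unfolding rep_def by (auto intro: words_update)
  moreover have "Q \<rho> G out (\<tau> + 1)" by (rule assms(5)) (auto simp: G_def)
  ultimately show "wp w I (clr x) (\<lambda>M' out' \<tau>'. \<exists>\<rho>' F'. rep \<rho>' F' M' \<and> Q \<rho>' F' out' \<tau>') M out \<tau>"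
    unfolding clr_def using r assms(1-4) S32
    by (intro wp_Move[where u = 0 and a = a]) (auto simp: rep_def)
qed

end

section \<open>Levels of a breadth-first search\<close>

text \<open>With unit costs the lengths of the walks from r to v are exactly the exponents i with
  \<open>(r, v) \<in> parcs G ^^ i\<close>. This trades walks for relation powers.\<close>

lemma hop_dist_eq_INF:
  assumes "pair_wf_digraph G" "r \<in> pverts G"
  shows "hop_dist G r v = (INF i\<in>{i. (r, v) \<in> parcs G ^^ i}. ereal (real i))"
proof -
  interpret pair_wf_digraph G by fact
  have cost: "awalk_cost (\<lambda>_. 1) p = real (length p)" for p :: "(nat \<times> nat) list"
    by (induction p) auto
  have 1: "(u, v) \<in> parcs G ^^ length p" if "awalk u p v" for u p
    using that
  proof (induction p arbitrary: u)
    case Nil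
    then show ?case by (simp add: awalk_Nil_iff)
  next
    case (Cons e p)
    then have "(u, snd e) \<in> parcs G" "awalk (snd e) p v" by (auto simp: awalk_Cons_iff)
    with Cons.IH show ?case unfolding length_Cons relpow.simps(2) by (metis relcompI relpow_commute)
  qed
  have 2: "\<exists>p. awalk u p v \<and> length p = i" if "(u, v) \<in> parcs G ^^ i" "u \<in> pverts G" for u i
    using that
  proof (induction i arbitrary: u)
    case 0
    then show ?case by (auto simp: awalk_Nil_iff)
  next
    case (Suc i)
    then obtain x where x: "(u, x) \<in> parcs G" "(x, v) \<in> parcs G ^^ i" by (meson relpow_Suc_D2)
    then have "x \<in> pverts G" using in_arcsD2 by blast
    from Suc.IH[OF x(2) this] obtain p where "awalk x p v" "length p = i" by blast
    then show ?case using x(1) Suc.prems(2) by (intro exI[of _ "(u, x) # p"]) (auto simp: awalk_Cons_iff)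
  qed
  have "length ` {p. awalk r p v} = {i. (r, v) \<in> parcs G ^^ i}"
    using 1 2[OF _ assms(2)] by force
  from this[symmetric] show ?thesis unfolding hop_dist_def \<mu>_def cost by (simp add: image_image)
qed

text \<open>Distances are extended reals, so integrality has to be recovered: a distance that is not
  at most j is at least j + 1, the infinite one included. The invariants below only compare
  distances with such thresholds.\<close>

lemma hop_dist_le_iff:
  assumes "pair_wf_digraph G" "r \<in> pverts G"
  shows "hop_dist G r v \<le> ereal (real j) \<longleftrightarrow> (\<exists>i\<le>j. (r, v) \<in> parcs G ^^ i)" (is "?L \<longleftrightarrow> ?R")
    and "\<not> hop_dist G r v \<le> ereal (real j) \<Longrightarrow> ereal (real (Suc j)) \<le> hop_dist G r v"
proof -
  have *: "ereal (real (Suc j)) \<le> hop_dist G r v" if "\<not> ?R"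
    unfolding hop_dist_eq_INF[OF assms]
  proof (rule INF_greatest)
    fix i assume "i \<in> {i. (r, v) \<in> parcs G ^^ i}"
    then have "Suc j \<le> i" using that by (force simp: not_less_eq_eq)
    then show "ereal (real (Suc j)) \<le> ereal (real i)" by (simp only: ereal_less_eq of_nat_le_iff)
  qed
  show **: "?L \<longleftrightarrow> ?R"
  proof
    assume ?L
    show ?R
    proof (rule ccontr)
      assume "\<not> ?R"
      from order_trans[OF * \<open>?L\<close>, OF this] show False by simp
    qed
  next
    assume ?R
    then obtain i where i: "i \<le> j" "(r, v) \<in> parcs G ^^ i" by blast
    then have "hop_dist G r v \<le> ereal (real i)"
      unfolding hop_dist_eq_INF[OF assms] by (intro INF_lower) auto
    also have "\<dots> \<le> ereal (real j)" using i by simp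
    finally show ?L .
  qed
  show "ereal (real (Suc j)) \<le> hop_dist G r v" if "\<not> ?L" using * ** that by blast
qed

lemma hop_dist_arc:
  assumes "pair_wf_digraph G" "r \<in> pverts G" "(u, v) \<in> parcs G" "hop_dist G r u \<le> ereal (real d)"
  shows "hop_dist G r v \<le> ereal (real (Suc d))"
proof -
  obtain i where "i \<le> d" "(r, u) \<in> parcs G ^^ i" using assms hop_dist_le_iff(1) by blast
  then have "Suc i \<le> Suc d" "(r, v) \<in> parcs G ^^ Suc i" using assms(3) by auto
  then show ?thesis using hop_dist_le_iff(1)[OF assms(1,2)] by blast
qed

lemma hop_dist_pred:
  assumes "pair_wf_digraph G" "r \<in> pverts G" "hop_dist G r v \<le> ereal (real (Suc d))"
  shows "hop_dist G r v \<le> ereal (real d) \<or> (\<exists>u. (u, v) \<in> parcs G \<and> hop_dist G r u \<le> ereal (real d))"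
proof -
  obtain i where i: "i \<le> Suc d" "(r, v) \<in> parcs G ^^ i" using assms hop_dist_le_iff(1) by blast
  show ?thesis
  proof (cases "i \<le> d")
    case True
    then show ?thesis using i hop_dist_le_iff(1)[OF assms(1,2)] by blast
  next
    case False
    then have "i = Suc d" using i by simp
    then show ?thesis using i hop_dist_le_iff(1)[OF assms(1,2)] by (meson order_refl relpow_Suc_E)
  qed
qed

lemma hop_dist_0:
  assumes "pair_wf_digraph G" "r \<in> pverts G"
  shows "hop_dist G r v \<le> ereal (real 0) \<longleftrightarrow> v = r"
  using hop_dist_le_iff(1)[OF assms, of v 0] by auto

lemma hop_dist_reachable:
  assumes "pair_wf_digraph G" "r \<in> pverts G" "hop_dist G r v \<le> ereal (real d)"
  shows "r \<rightarrow>\<^sup>*\<^bsub>with_proj G\<^esub> v"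
proof (rule ccontr)
  interpret pair_wf_digraph G by fact
  assume "\<not> r \<rightarrow>\<^sup>*\<^bsub>with_proj G\<^esub> v"
  then have "hop_dist G r v = \<infinity>" unfolding hop_dist_def by (rule shortest_path_inf)
  with assms(3) show False by simp
qed

text \<open>
  State of the search from \<open>r\<close> at level \<open>d\<close>: \<open>D\<close> holds the vertices of earlier searches,
  \<open>B\<close> the expanded vertices, \<open>C\<close> and \<open>N\<close> the unexpanded ones of levels \<open>d\<close> and \<open>d + 1\<close>.
\<close>

locale bfs_state = pair_wf_digraph G
  for G :: "nat pair_pre_digraph" and D :: "nat set" and r d :: nat and ys :: "nat list"
    and B C N :: "nat set" +
  assumes D_verts: "D \<subseteq> pverts G" and D_closed: "v \<in> D \<Longrightarrow> (v, u) \<in> parcs G \<Longrightarrow> u \<in> D"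
    and root: "r \<in> pverts G" "r \<notin> D" "r \<in> B \<union> C" and ys: "distinct ys" "set ys = B \<union> C \<union> N"
    and ys_verts: "set ys \<subseteq> pverts G" and disj: "D \<inter> set ys = {}" "B \<inter> C = {}" "B \<inter> N = {}" "C \<inter> N = {}"
    and sorted: "sorted_wrt (\<lambda>u v. hop_dist G r u \<le> hop_dist G r v) ys"
    and dist_BC: "v \<in> B \<union> C \<Longrightarrow> hop_dist G r v \<le> ereal (real d)"
    and dist_N: "v \<in> N \<Longrightarrow> hop_dist G r v \<le> ereal (real (Suc d))"
    and complete: "v \<notin> D \<Longrightarrow> hop_dist G r v \<le> ereal (real d) \<Longrightarrow> v \<in> B \<union> C"
    and B_out: "v \<in> B \<Longrightarrow> (v, u) \<in> parcs G \<Longrightarrow> u \<in> D \<union> set ys"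

lemma bfs_state_init:
  assumes "pair_wf_digraph G" "D \<subseteq> pverts G" "\<And>v u. v \<in> D \<Longrightarrow> (v, u) \<in> parcs G \<Longrightarrow> u \<in> D" "r \<in> pverts G - D"
  shows "bfs_state G D r 0 [r] {} {r} {}"
proof -
  interpret pair_wf_digraph G by fact
  have "hop_dist G r v \<le> ereal (real 0) \<longleftrightarrow> v = r" for v
    using hop_dist_0[OF assms(1)] assms(4) by blast
  then show ?thesis using assms(2-4) by unfold_locales auto
qed

context bfs_state
begin

lemma wf: "pair_wf_digraph G"
  by unfold_locales

text \<open>The distance of u is at most d + 1 because of v, and by \<open>complete\<close> it is
  not at most d; hence it is at least d + 1. All vertices listed so far have distance at most d + 1,
  so u may be appended.\<close>

lemma discover:
  assumes v: "v \<in> C" "(v, u) \<in> parcs G" "u \<notin> D \<union> set ys"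
  shows "bfs_state G D r d (ys @ [u]) B C (insert u N)"
proof -
  have V: "u \<in> pverts G" by (rule in_arcsD2[OF v(2)])
  have le: "hop_dist G r u \<le> ereal (real (Suc d))"
    using v by (intro hop_dist_arc[OF wf root(1) v(2)] dist_BC) auto
  have new: "u \<notin> set ys" "u \<notin> B" "u \<notin> C" "u \<notin> D" using v(3) ys(2) by auto
  then have "\<not> hop_dist G r u \<le> ereal (real d)" using complete by blast
  then have ge: "ereal (real (Suc d)) \<le> hop_dist G r u" by (rule hop_dist_le_iff(2)[OF wf root(1)])
  have "hop_dist G r x \<le> hop_dist G r u" if "x \<in> set ys" for x
  proof (cases "x \<in> N")
    case True
    then show ?thesis using dist_N ge order_trans by blast
  next
    case False
    then have "hop_dist G r x \<le> ereal (real d)" using that ys(2) dist_BC by blast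
    also have "\<dots> \<le> ereal (real (Suc d))" by simp
    finally show ?thesis using ge by (rule order_trans)
  qed
  then have "sorted_wrt (\<lambda>u v. hop_dist G r u \<le> hop_dist G r v) (ys @ [u])"
    using sorted by (simp add: sorted_wrt_append)
  moreover have "distinct (ys @ [u])" using ys(1) new by simp
  moreover have "set (ys @ [u]) = B \<union> C \<union> insert u N" using ys(2) by auto
  moreover have "set (ys @ [u]) \<subseteq> pverts G" using ys_verts V by simp
  moreover have "D \<inter> set (ys @ [u]) = {}" "B \<inter> insert u N = {}" "C \<inter> insert u N = {}"
    using disj new by auto
  moreover have "x \<in> D \<union> set (ys @ [u])" if "y \<in> B" "(y, x) \<in> parcs G" for x y
    using B_out[OF that] by auto
  moreover have "hop_dist G r x \<le> ereal (real (Suc d))" if "x \<in> insert u N" for x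
    using that dist_N le by auto
  ultimately show ?thesis
    using D_verts D_closed root disj(2) dist_BC complete by (intro bfs_state.intro wf bfs_state_axioms.intro)
qed

lemma expand:
  assumes "v \<in> C" "\<And>u. (v, u) \<in> parcs G \<Longrightarrow> u \<in> D \<union> set ys"
  shows "bfs_state G D r d ys (insert v B) (C - {v}) N"
proof -
  have BC: "insert v B \<union> (C - {v}) = B \<union> C" using assms(1) by auto
  show ?thesis
  proof (intro bfs_state.intro wf bfs_state_axioms.intro, unfold BC)
    show "insert v B \<inter> (C - {v}) = {}" "insert v B \<inter> N = {}" "(C - {v}) \<inter> N = {}"
      using disj assms(1) by auto
    show "x \<in> D \<union> set ys" if "y \<in> insert v B" "(y, x) \<in> parcs G" for x y
      using that B_out assms(2) by blast
  qed (fact D_verts D_closed root disj ys ys_verts sorted dist_BC dist_N complete)+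
qed

text \<open>The point is \<open>complete\<close> for d + 1. A predecessor at distance at most d lies
  outside D, since D is closed and v is not in it. With C empty it has been expanded, so v has been
  listed.\<close>

lemma level:
  assumes "C = {}"
  shows "bfs_state G D r (Suc d) ys B N {}"
proof -
  have le: "v \<in> B \<union> N" if v: "v \<notin> D" "hop_dist G r v \<le> ereal (real (Suc d))" for v
    using hop_dist_pred[OF wf root(1) v(2)]
  proof (elim disjE exE conjE)
    assume "hop_dist G r v \<le> ereal (real d)"
    then show ?thesis using complete[OF v(1)] assms by auto
  next
    fix u assume u: "(u, v) \<in> parcs G" "hop_dist G r u \<le> ereal (real d)"
    then have "u \<notin> D" using D_closed v(1) by blast
    then have "u \<in> B" using u complete assms by auto
    then show ?thesis using B_out u(1) v(1) ys(2) assms by blast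
  qed
  have dist: "hop_dist G r v \<le> ereal (real (Suc d))" if "v \<in> B \<union> N" for v
  proof (cases "v \<in> N")
    case False
    then have "hop_dist G r v \<le> ereal (real d)" using that dist_BC by blast
    also have "\<dots> \<le> ereal (real (Suc d))" by simp
    finally show ?thesis .
  qed (rule dist_N)
  show ?thesis
  proof (intro bfs_state.intro wf bfs_state_axioms.intro)
    show "set ys = B \<union> N \<union> {}" "r \<in> B \<union> N" using ys(2) root(3) assms by auto
    show "B \<inter> {} = {}" "N \<inter> {} = {}" by auto
    show "hop_dist G r v \<le> ereal (real (Suc (Suc d)))" if "v \<in> {}" for v using that by simp
  qed (fact D_verts D_closed root disj ys ys_verts sorted B_out le dist)+
qed

text \<open>Once nothing is left to expand, \<open>D \<union> set ys\<close> is closed under arcs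
  and contains r, hence everything reachable from r. The same closure is the precondition of the
  next restart.\<close>

lemma finish:
  assumes "C = {}" "N = {}"
  shows "bfs_from G D r ys" and "v \<in> D \<union> set ys \<Longrightarrow> (v, u) \<in> parcs G \<Longrightarrow> u \<in> D \<union> set ys"
proof -
  have B: "set ys = B" using assms ys(2) by simp
  show cl: "u \<in> D \<union> set ys" if "v \<in> D \<union> set ys" "(v, u) \<in> parcs G" for v u
    using that B_out D_closed B by blast
  have "v \<in> D \<union> set ys" if "r \<rightarrow>\<^sup>*\<^bsub>with_proj G\<^esub> v" for v
  proof -
    have "r \<in> D \<union> set ys" using root(3) assms B by auto
    with that show ?thesis
      by (induction rule: reachable_induct) (use cl in auto)
  qed
  moreover have "r \<rightarrow>\<^sup>*\<^bsub>with_proj G\<^esub> v" if "v \<in> set ys" for v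
    using that hop_dist_reachable[OF wf root(1)] dist_BC B by blast
  ultimately have "set ys = {v. r \<rightarrow>\<^sup>*\<^bsub>with_proj G\<^esub> v} - D"
    using disj(1) by blast
  then show "bfs_from G D r ys" using root ys(1) sorted unfolding bfs_from_def by simp
qed

end

section \<open>The number of arcs against n and m\<close>

lemma card_image_doubletons:
  fixes E :: "('a \<times> 'a) set"
  assumes "finite E"
  shows "card E \<le> 2 * card ((\<lambda>(u, v). {u, v}) ` E)"
proof -
  let ?f = "\<lambda>(u, v). {u, v}"
  have "card {x \<in> E. ?f x = e} \<le> 2" if e: "e \<in> ?f ` E" for e
  proof -
    obtain x where "e = ?f x" using e by (rule imageE)
    then obtain u v where "e = {u, v}" by (cases x) simp
    have "x \<in> {(u, v), (v, u)}" if "?f x = e" for x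
    proof (cases x)
      case (Pair a b)
      then have "{a, b} = {u, v}" using that \<open>e = {u, v}\<close> by simp
      then have "a = u \<and> b = v \<or> a = v \<and> b = u" by (simp only: doubleton_eq_iff)
      then show ?thesis using Pair by blast
    qed
    \<comment> \<open>A list covers loops as well: for \<open>u = v\<close> its set has one element,
      and \<open>card_length\<close> still gives the bound 2.\<close>
    then have "{x \<in> E. ?f x = e} \<subseteq> set [(u, v), (v, u)]" by (simp only: list.set) blast
    from card_mono[OF finite_set this] card_length[of "[(u, v), (v, u)]"]
    have "card {x \<in> E. ?f x = e} \<le> length [(u, v), (v, u)]" by (rule order_trans)
    then show ?thesis by simp
  qed
  then have "(\<Sum>e\<in>?f ` E. card ({x \<in> E. ?f x = e})) \<le> (\<Sum>e\<in>?f ` E. 2)" by (intro sum_mono) auto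
  moreover have "card E = (\<Sum>e\<in>?f ` E. card ({x \<in> E. ?f x = e}))"
    using assms using sum.image_gen[OF assms, of "\<lambda>_. 1::nat" ?f] by (simp only: card_eq_sum)
  ultimately show ?thesis by simp
qed

text \<open>The last claim is the only use of connectedness: no vertex is isolated, so each one is
  an end of some arc. A single vertex may have no arc, hence the restriction to
  \<open>2 \<le> n\<close>. It lets terms in n be absorbed by m.\<close>

lemma input_graph_arcs:
  assumes "input_graph kd G n m"
  shows "pair_fin_digraph G" "card (parcs G) \<le> 2 * m" "2 \<le> n \<Longrightarrow> n \<le> 2 * card (parcs G)"
proof -
  show fd: "pair_fin_digraph G"
    using assms by (cases kd) (auto simp: input_graph_def pair_pseudo_graph_def)
  interpret pair_fin_digraph G by fact
  show "card (parcs G) \<le> 2 * m"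
    using assms card_image_doubletons[OF pair_finite_arcs] by (cases kd) (auto simp: input_graph_def)
  assume n: "2 \<le> n"
  have V: "pverts G = {..<n}" using assms by (simp add: input_graph_def)
  interpret S: pair_wf_digraph "mk_symmetric (with_proj G)" ..
  have "v \<in> fst ` parcs G \<union> snd ` parcs G" if v: "v < n" for v
  proof -
    \<comment> \<open>Some vertex other than v, so that the path from v to it has a first
      arc.\<close>
    define u where "u = (if v = 0 then 1 else 0 :: nat)"
    have u: "u \<noteq> v" "u < n" using n by (auto simp: u_def)
    have "v \<rightarrow>\<^sup>*\<^bsub>with_proj (mk_symmetric (with_proj G))\<^esub> u"
      using assms u v V by (auto simp: input_graph_def connected_def strongly_connected_def)
    then have "(v, u) \<in> (parcs (mk_symmetric (with_proj G)))\<^sup>*"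
      using reachable_rtranclI by fastforce
    then obtain x where "(v, x) \<in> parcs (mk_symmetric (with_proj G))"
      using u(1) by (metis converse_rtranclE)
    then show ?thesis by (auto simp: parcs_mk_symmetric image_iff Bex_def)
  qed
  then have "card {..<n} \<le> card (fst ` parcs G \<union> snd ` parcs G)"
    using pair_finite_arcs by (intro card_mono) auto
  also have "\<dots> \<le> card (fst ` parcs G) + card (snd ` parcs G)" by (rule card_Un_le)
  also have "\<dots> \<le> card (parcs G) + card (parcs G)" using pair_finite_arcs by (intro add_mono card_image_le)
  finally show "n \<le> 2 * card (parcs G)" by simp
qed

section \<open>Colours, bitmaps and stacks\<close>

text \<open>
  With \<open>\<kappa> \<in> {1, 2}\<close> for the colours of the two parities, the fields are used as follows:
  \<open>j < b\<close> holds \<open>3 ^ j\<close> (for \<open>j < q\<close>), \<open>b + 4 * z + \<kappa>\<close> the bitmap of superblock \<open>z\<close>,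
  \<open>b + 4 * i + 2 + \<kappa>\<close> entry \<open>i\<close> of the stack, and \<open>H + k\<close> the \<open>q\<close> colours of block \<open>k\<close>,
  as digits to base 3. The registers \<open>rCC\<close>, \<open>rTC\<close> and \<open>rNC\<close>, \<open>rTN\<close> contain the colour and
  the height of the stack of the current and of the next level.
\<close>

abbreviation (input) "rN \<equiv> 4::nat"
abbreviation (input) "rQ \<equiv> 8::nat"
abbreviation (input) "rH \<equiv> 9::nat"
abbreviation (input) "rCC \<equiv> 10::nat"
abbreviation (input) "rNC \<equiv> 11::nat"
abbreviation (input) "rTC \<equiv> 12::nat"
abbreviation (input) "rTN \<equiv> 13::nat"
abbreviation (input) "rI \<equiv> 14::nat"
abbreviation (input) "rR \<equiv> 15::nat"
abbreviation (input) "rSB \<equiv> 16::nat"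
abbreviation (input) "rX \<equiv> 17::nat"
abbreviation (input) "rK \<equiv> 18::nat"
abbreviation (input) "rV \<equiv> 19::nat"
abbreviation (input) "rJ \<equiv> 20::nat"
abbreviation (input) "rP \<equiv> 21::nat"
abbreviation (input) "rU \<equiv> 22::nat"
abbreviation (input) "rA \<equiv> 27::nat"

text \<open>The power \<open>3 ^ (x mod q)\<close> is looked up in field \<open>x mod q\<close>,
  which keeps the extraction of a digit at constant cost.\<close>

definition getcol :: "nat \<Rightarrow> nat \<Rightarrow> prog" where
  "getcol d x = seqs [
     Op Div (Cell 23) (V x) (V rQ), Op Add (Cell 23) (V 23) (V rH), rdf 23 23,
     Op Mod (Cell 24) (V x) (V rQ), rdf 24 24, Op Div (Cell 23) (V 23) (V 24), Op Mod (Cell d) (V 23) (Const 3)]"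

definition setcol :: "nat \<Rightarrow> nat \<Rightarrow> prog" where
  "setcol x y = seqs [
     Op Div (Cell 23) (V x) (V rQ), Op Add (Cell 23) (V 23) (V rH),
     Op Mod (Cell 24) (V x) (V rQ), rdf 24 24, rdf 25 23,
     Op Div (Cell 26) (V 25) (V 24), Op Mod (Cell 26) (V 26) (Const 3), Op Mul (Cell 26) (V 26) (V 24),
     Op Sub (Cell 25) (V 25) (V 26), Op Mul (Cell 26) (V y) (V 24), Op Add (Cell 25) (V 25) (V 26),
     wrf 23 25]"

text \<open>The superblock is expected in register 25, where \<open>discover\<close> leaves
  it.\<close>

definition push :: prog where
  "push = seqs [
     Op Mul (Cell 29) (V rTN) (Const 4), Op Add (Cell 29) (V 29) (V rB), Op Add (Cell 29) (V 29) (V rNC),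
     Op Add (Cell 29) (V 29) (Const 2), wrf 29 25, Op Add (Cell rTN) (V rTN) (Const 1)]"

text \<open>A superblock is pushed exactly when its bitmap is still zero, hence at most once while
  it is on the stack.\<close>

definition discover :: prog where
  "discover = seqs [
     setcol rU rNC, Write (V rU),
     Op Div (Cell 23) (V rU) (V rQ), Op Mod (Cell 24) (V 23) (V rQ), Op Div (Cell 25) (V 23) (V rQ),
     Op Shl (Cell 24) (Const 1) (V 24),
     Op Mul (Cell 26) (V 25) (Const 4), Op Add (Cell 26) (V 26) (V rB), Op Add (Cell 26) (V 26) (V rNC),
     rdf 28 26, If Eq (V 28) (Const 0) push (seqs []),
     Op Or (Cell 28) (V 28) (V 24), wrf 26 28]"

text \<open>A superblock owns four fields, at offsets \<open>4 * z + 1\<close> to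
  \<open>4 * z + 4\<close> from b: two bitmaps and one entry of each stack. The residues modulo 4
  keep these arrays apart, and the largest offset \<open>4 * nsb\<close> explains the final
  \<open>+ 1\<close> in H. \<open>q3\<close> gives the colours of a block room in one field, and
  \<open>nb\<close> the number of a superblock.\<close>

locale layout = ram +
  fixes n q nsb H :: nat
  assumes n1: "1 \<le> n" and q1: "1 \<le> q" and q3: "3 ^ q < (2::nat) ^ b" and nb: "n < 2 ^ b"
    and nsb: "nsb = (n - 1) div q div q + 1" and H: "H = b + 4 * nsb + 1"
    and NF_eq: "NF = H + (n - 1) div q + 1" and NFw: "NF < 2 ^ w"
begin

lemma b_le_w: "b \<le> w"
  using shift_bound[of 0] c1 by simp

lemma pow_b_w: "x < 2 ^ b \<Longrightarrow> x < (2::nat) ^ w"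
  using power_increasing[OF b_le_w, of "2::nat"] by linarith

text \<open>Hence a bitmap of q bits fits into a field, and the table of powers fits into the first
  b fields.\<close>

lemma q_less_b: "q < b"
proof (rule ccontr)
  assume "\<not> q < b"
  then have "(2::nat) ^ b \<le> 2 ^ q" by (intro power_increasing) auto
  also have "\<dots> \<le> 3 ^ q" by (intro power_mono) auto
  finally show False using q3 by simp
qed

lemma block_less:
  assumes "v < n"
  shows "H + v div q < NF" "v div q div q < nsb"
proof -
  have "v \<le> n - 1" using assms by simp
  then have "v div q \<le> (n - 1) div q" by (rule div_le_mono)
  moreover from this have "v div q div q \<le> (n - 1) div q div q" by (rule div_le_mono)
  ultimately show "H + v div q < NF" "v div q div q < nsb" unfolding NF_eq nsb by linarith+
qed

lemma b_less_H: "b < H" "H < NF"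
  using H NF_eq by simp_all

definition stat :: "(nat \<Rightarrow> nat) \<Rightarrow> bool" where
  "stat \<rho> \<longleftrightarrow> geo \<rho> \<and> \<rho> rN = n \<and> \<rho> rQ = q \<and> \<rho> rH = H"

definition tab :: "(nat \<Rightarrow> nat) \<Rightarrow> bool" where
  "tab F \<longleftrightarrow> (\<forall>j<q. F j = 3 ^ j) \<and> (\<forall>k<NF. H \<le> k \<longrightarrow> F k < 3 ^ q)"

definition col :: "(nat \<Rightarrow> nat) \<Rightarrow> nat \<Rightarrow> nat" where
  "col F v = F (H + v div q) div 3 ^ (v mod q) mod 3"

lemmas awp_ops = awp_Add awp_Sub awp_Mul awp_Div awp_Mod awp_Or awp_Shl1 awp_Read awp_Write awp_Move awp_rdf awp_wrf

lemma geo_upd [simp]: "d \<noteq> 5 \<Longrightarrow> d \<noteq> 6 \<Longrightarrow> d \<noteq> 7 \<Longrightarrow> geo (\<rho>(d := x)) = geo \<rho>"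
  by (simp add: geo_def)

lemma stat_upd [simp]: "d \<notin> {4, 5, 6, 7, 8, 9} \<Longrightarrow> stat (\<rho>(d := x)) = stat \<rho>"
  by (simp add: stat_def)

lemma statD: "stat \<rho> \<Longrightarrow> geo \<rho>" "stat \<rho> \<Longrightarrow> \<rho> rN = n" "stat \<rho> \<Longrightarrow> \<rho> rQ = q" "stat \<rho> \<Longrightarrow> \<rho> rH = H"
    "stat \<rho> \<Longrightarrow> \<rho> rB = b"
  by (auto simp: stat_def geo_def)

text \<open>Two field reads of 7 steps and five single instructions make 19. Registers 23 and 24 are
  overwritten with values hidden from the caller.\<close>

lemma awp_getcol:
  assumes "stat \<rho>" "tab F" "4 \<le> d \<and> d < 32" "4 \<le> x \<and> x < 32 \<and> x \<noteq> 23 \<and> x \<noteq> 24" "\<rho> x = v" "v < n"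
    "\<And>a e. Q (\<rho>(24 := a, 23 := e, d := col F v)) F out (\<tau> + 19)"
  shows "awp (getcol d x) Q \<rho> F out \<tau>"
proof -
  have j: "v mod q < q" using q1 by simp
  have f: "v mod q < NF" using j q_less_b b_less_H by linarith
  have f2: "F (v mod q) = 3 ^ (v mod q)" using assms(2) j by (simp add: tab_def)
  have f3: "H + v div q < NF" "v div q + H < NF" using block_less(1)[OF assms(6)] by simp_all
  then have f4: "H + v div q < 2 ^ w" "v div q + H < 2 ^ w" using NFw by linarith+
  have f5: "F (v div q + H) div 3 ^ (v mod q) mod 3 = col F v"
     "F (H + v div q) div 3 ^ (v mod q) mod 3 = col F v" by (simp_all add: col_def add.commute)
  have f6: "23 \<noteq> x" "24 \<noteq> x" using assms(4) by auto
  note f = f f2 f3 f4 f5 f6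
  show ?thesis unfolding getcol_def
    apply (rule awp_seqs awp_seqs1 | (rule awp_ops, (simp add: assms f statD; fail)+))+
    using assms(7) by (simp add: f add.commute[of _ \<tau>])
qed


lemma div_mod_neq: "v' div q = v div q \<Longrightarrow> v' mod q = v mod q \<Longrightarrow> v' = (v::nat)"
  by (metis div_mult_mod_eq)

lemma awp_setcol:
  assumes "stat \<rho>" "tab F" "4 \<le> x \<and> x < 23" "4 \<le> y \<and> y < 23" "\<rho> x = v" "v < n" "\<rho> y = u" "u < 3"
    "\<And>a e g h G. (\<And>v'. col G v' = (if v' = v then u else col F v')) \<Longrightarrow> tab G \<Longrightarrow> (\<And>k. k < H \<Longrightarrow> G k = F k) \<Longrightarrow>
      Q (\<rho>(23 := a, 24 := e, 26 := g, 25 := h)) G out (\<tau> + 36)"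
  shows "awp (setcol x y) Q \<rho> F out \<tau>"
proof -
  define k where "k = H + v div q"
  define P where "P = (3::nat) ^ (v mod q)"
  define X where "X = F k"
  define e where "e = X div P mod 3"
  define Y where "Y = X - e * P + u * P"
  have j: "v mod q < q" using q1 by simp
  have f: "v mod q < NF" using j q_less_b b_less_H by linarith
  have f2: "F (v mod q) = P" using assms(2) j by (simp add: tab_def P_def)
  have f3: "k < NF" "H \<le> k" using block_less(1)[OF assms(6)] by (simp_all add: k_def)
  then have f4: "k < 2 ^ w" using NFw by linarith
  have X: "X < 3 ^ q" using assms(2) f3 unfolding X_def tab_def by blast
  have Y: "Y < 3 ^ q" unfolding Y_def e_def P_def by (rule digit_update(2)[OF _ assms(8) X j]) simp
  have eP: "e * P \<le> X" unfolding e_def P_def by (rule digit_update(4)[of _ u]) (use assms(8) in auto)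
  have w: "e * P < 2 ^ w" "u * P < 2 ^ w" "Y < 2 ^ w" "Y < 2 ^ b"
    using X Y eP q3 b_le_w power_increasing[OF b_le_w, of "2::nat"] unfolding Y_def by linarith+
  define G where "G = F(k := Y)"
  have cG: "col G v' = (if v' = v then u else col F v')" for v'
  proof (cases "v' div q = v div q")
    case True
    then have "col G v' = Y div 3 ^ (v' mod q) mod 3" by (simp add: col_def G_def k_def)
    also have "\<dots> = (if v' mod q = v mod q then u else X div 3 ^ (v' mod q) mod 3)"
      unfolding Y_def e_def P_def by (rule digit_update(1)) (use assms(8) in auto)
    also have "\<dots> = (if v' = v then u else col F v')"
      using True div_mod_neq[OF True] by (auto simp: col_def X_def k_def)
    finally show ?thesis .
  next
    case False
    then show ?thesis by (auto simp: col_def G_def k_def)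
  qed
  have tG: "tab G" using assms(2) f3 Y q_less_b b_less_H by (auto simp: tab_def G_def)
  have lG: "G i = F i" if "i < H" for i using that f3 by (simp add: G_def)
  have f5: "v div q + H = k" "F k = X" "X div P mod 3 = e" "X - e * P + u * P = Y" "F(k := Y) = G"
    by (simp_all add: k_def X_def e_def Y_def G_def)
  have f6: "23 \<noteq> x" "24 \<noteq> x" "23 \<noteq> y" "24 \<noteq> y" "25 \<noteq> y" "26 \<noteq> y" "x \<noteq> 23" "x \<noteq> 24" "y \<noteq> 23" "y \<noteq> 24" "y \<noteq> 25" "y \<noteq> 26" "x < 32" "y < 32" using assms(3,4) by auto
  note f = f f2 f3 f4 f5 f6 eP w
  show ?thesis unfolding setcol_def
    apply (rule awp_seqs awp_seqs1 | (rule awp_ops, (simp add: assms f statD; fail)+))+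
    using assms(9)[OF cG tG lG] by (simp add: f add.commute[of _ \<tau>])
qed

text \<open>A set A of blocks, held as bitmaps together with a stack that lists, without repetition,
  the superblocks whose bitmap is nonzero. Injectivity makes t their number, which is why the stack
  cannot overflow.\<close>

definition ds :: "(nat \<Rightarrow> nat) \<Rightarrow> nat \<Rightarrow> nat \<Rightarrow> nat set \<Rightarrow> bool" where
  "ds F \<kappa> t A \<longleftrightarrow>
     (\<forall>z<nsb. \<forall>j. bit (F (b + 4 * z + \<kappa>)) j \<longleftrightarrow> j < q \<and> z * q + j \<in> A) \<and>
     inj_on (\<lambda>i. F (b + 4 * i + 2 + \<kappa>)) {..<t} \<and>
     (\<lambda>i. F (b + 4 * i + 2 + \<kappa>)) ` {..<t} = (\<lambda>k. k div q) ` A \<and> (\<forall>k\<in>A. k div q < nsb)"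

lemma ds_cong:
  assumes "ds F \<kappa> t A" "\<And>z. z < nsb \<Longrightarrow> G (b + 4 * z + \<kappa>) = F (b + 4 * z + \<kappa>)"
    "\<And>i. i < t \<Longrightarrow> G (b + 4 * i + 2 + \<kappa>) = F (b + 4 * i + 2 + \<kappa>)"
  shows "ds G \<kappa> t A"
proof -
  have "(\<lambda>i. G (b + 4 * i + 2 + \<kappa>)) ` {..<t} = (\<lambda>i. F (b + 4 * i + 2 + \<kappa>)) ` {..<t}"
    using assms(3) by (intro image_cong) auto
  moreover have "inj_on (\<lambda>i. G (b + 4 * i + 2 + \<kappa>)) {..<t} = inj_on (\<lambda>i. F (b + 4 * i + 2 + \<kappa>)) {..<t}"
    using assms(3) by (intro inj_on_cong) auto
  ultimately show ?thesis using assms(1,2) unfolding ds_def by simp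
qed

lemma ds_size:
  assumes "ds F \<kappa> t A"
  shows "t \<le> nsb" "k div q < nsb \<Longrightarrow> k div q \<notin> (\<lambda>k. k div q) ` A \<Longrightarrow> t < nsb"
proof -
  let ?T = "(\<lambda>k. k div q) ` A"
  have sub: "?T \<subseteq> {..<nsb}" using assms unfolding ds_def by auto
  have card: "card ?T = t" using assms unfolding ds_def by (metis card_image card_lessThan)
  show "t \<le> nsb" using card_mono[OF _ sub] card by simp
  assume "k div q < nsb" "k div q \<notin> ?T"
  then have "?T \<subset> {..<nsb}" using sub by auto
  then show "t < nsb" using psubset_card_mono[of "{..<nsb}" ?T] card by simp
qed

text \<open>The program decides by this test whether a superblock is already on the stack.\<close>

lemma ds_zero_iff:
  assumes "ds F \<kappa> t A" "z < nsb"
  shows "F (b + 4 * z + \<kappa>) = 0 \<longleftrightarrow> z \<notin> (\<lambda>k. k div q) ` A"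
proof -
  have "F (b + 4 * z + \<kappa>) = 0 \<longleftrightarrow> (\<forall>j. \<not> bit (F (b + 4 * z + \<kappa>)) j)" by (simp add: bit_eq_iff)
  also have "\<dots> \<longleftrightarrow> (\<forall>j<q. z * q + j \<notin> A)" using assms unfolding ds_def by auto
  also have "\<dots> \<longleftrightarrow> z \<notin> (\<lambda>k. k div q) ` A"
  proof
    assume a: "\<forall>j<q. z * q + j \<notin> A"
    show "z \<notin> (\<lambda>k. k div q) ` A"
    proof
      assume "z \<in> (\<lambda>k. k div q) ` A"
      then obtain k where "k \<in> A" "z = k div q" by auto
      then show False using a q1 by (metis div_mult_mod_eq mod_less_divisor less_le_trans zero_less_one)
    qed
  next
    assume a: "z \<notin> (\<lambda>k. k div q) ` A"
    show "\<forall>j<q. z * q + j \<notin> A"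
    proof (intro allI impI notI)
      fix j assume "j < q" "z * q + j \<in> A"
      moreover from this have "(z * q + j) div q = z" by simp
      ultimately show False using a by (metis imageI)
    qed
  qed
  finally show ?thesis .
qed

text \<open>The two cases in \<open>F'\<close> and \<open>t'\<close> are the branches of
  \<open>discover\<close> with and without a push.\<close>

lemma ds_insert:
  assumes d: "ds F \<kappa> t A" and k: "k div q < nsb" and \<kappa>: "\<kappa> = 1 \<or> \<kappa> = 2"
  defines "z \<equiv> k div q"
  defines "y \<equiv> F (b + 4 * z + \<kappa>)"
  defines "F' \<equiv> if y = 0 then F(b + 4 * t + 2 + \<kappa> := z) else F"
  defines "t' \<equiv> if y = 0 then Suc t else t"
  shows "ds (F'(b + 4 * z + \<kappa> := semiring_bit_operations_class.or y (2 ^ (k mod q)))) \<kappa> t' (insert k A)"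
    (is "ds ?G _ _ _")
proof -
  have z: "z < nsb" using k unfolding z_def .
  have y0: "y = 0 \<longleftrightarrow> z \<notin> (\<lambda>k. k div q) ` A" unfolding y_def by (rule ds_zero_iff[OF d z])
  \<comment> \<open>The two indices differ by 2 modulo 4.\<close>
  have neq: "b + 4 * i + 2 + \<kappa> \<noteq> b + 4 * z' + \<kappa>" for i z' by arith
  have kz: "k = z * q + k mod q" "k mod q < q" using q1 unfolding z_def by auto
  have G1: "?G (b + 4 * z' + \<kappa>) = (if z' = z then semiring_bit_operations_class.or y (2 ^ (k mod q)) else F (b + 4 * z' + \<kappa>))" for z'
    unfolding F'_def using neq[of t z'] by auto
  have G2: "?G (b + 4 * i + 2 + \<kappa>) = (if y = 0 \<and> i = t then z else F (b + 4 * i + 2 + \<kappa>))" for i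
    unfolding F'_def using neq[of i z] by auto
  have bits: "bit (?G (b + 4 * z' + \<kappa>)) j \<longleftrightarrow> j < q \<and> z' * q + j \<in> insert k A" if "z' < nsb" for z' j
  proof -
    have o: "bit (F (b + 4 * z' + \<kappa>)) j \<longleftrightarrow> j < q \<and> z' * q + j \<in> A" using d that unfolding ds_def by blast
    have u: "z' * q + j = k \<longleftrightarrow> z' = z \<and> j = k mod q" if "j < q" using that kz(1) unfolding z_def by auto
    show ?thesis
    proof (cases "z' = z")
      case True
      then have "bit (?G (b + 4 * z' + \<kappa>)) j \<longleftrightarrow> bit (F (b + 4 * z' + \<kappa>)) j \<or> j = k mod q"
        unfolding G1 by (auto simp: bit_or_iff bit_exp_iff y_def)
      then show ?thesis using o u True kz(2) by auto
    next
      case False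
      then have "?G (b + 4 * z' + \<kappa>) = F (b + 4 * z' + \<kappa>)" by (simp only: G1 if_False)
      then show ?thesis using o u False by auto
    qed
  qed
  have img: "inj_on (\<lambda>i. ?G (b + 4 * i + 2 + \<kappa>)) {..<t'} \<and>
     (\<lambda>i. ?G (b + 4 * i + 2 + \<kappa>)) ` {..<t'} = (\<lambda>k. k div q) ` insert k A"
  proof (cases "y = 0")
    case True
    have "(\<lambda>i. ?G (b + 4 * i + 2 + \<kappa>)) ` {..<t} = (\<lambda>i. F (b + 4 * i + 2 + \<kappa>)) ` {..<t}"
      unfolding G2 by (intro image_cong) auto
    then have e: "(\<lambda>i. ?G (b + 4 * i + 2 + \<kappa>)) ` {..<t} = (\<lambda>k. k div q) ` A"
      using d unfolding ds_def by simp
    have "inj_on (\<lambda>i. ?G (b + 4 * i + 2 + \<kappa>)) {..<t} = inj_on (\<lambda>i. F (b + 4 * i + 2 + \<kappa>)) {..<t}"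
      unfolding G2 by (intro inj_on_cong) auto
    then have i: "inj_on (\<lambda>i. ?G (b + 4 * i + 2 + \<kappa>)) {..<t}" using d unfolding ds_def by simp
    have t: "?G (b + 4 * t + 2 + \<kappa>) = z" unfolding G2 using True by simp
    have "{..<t'} = insert t {..<t}" unfolding t'_def using True by auto
    then show ?thesis using i e t True y0 unfolding z_def by (simp only: inj_on_insert image_insert) auto
  next
    case False
    then have "(\<lambda>k. k div q) ` insert k A = (\<lambda>k. k div q) ` A" using y0 unfolding z_def by auto
    then show ?thesis using d False unfolding ds_def G2 t'_def by simp
  qed
  have "\<forall>k\<in>insert k A. k div q < nsb" using d k unfolding ds_def by simp
  then show ?thesis unfolding ds_def by (intro conjI allI impI bits conjunct1[OF img] conjunct2[OF img])
qed


lemma index_less: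
  assumes "z < nsb" "\<kappa> = 1 \<or> \<kappa> = 2"
  shows "b + 4 * z + \<kappa> < H" "b + 4 * z + 2 + \<kappa> < H" "b \<le> b + 4 * z + \<kappa>" "b \<le> b + 4 * z + 2 + \<kappa>"
  using assms H by auto

lemma index_neq:
  fixes z z' \<kappa> \<kappa>' :: nat
  assumes "\<kappa> = 1 \<and> \<kappa>' = 2 \<or> \<kappa> = 2 \<and> \<kappa>' = 1"
  shows "b + 4 * z + \<kappa> \<noteq> b + 4 * z' + \<kappa>'" "b + 4 * z + 2 + \<kappa> \<noteq> b + 4 * z' + 2 + \<kappa>'"
    "b + 4 * z + 2 + \<kappa> \<noteq> b + 4 * z' + \<kappa>'" "b + 4 * z + \<kappa> \<noteq> b + 4 * z' + 2 + \<kappa>'"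
  using assms by arith+

lemma tab_cong:
  assumes "tab F" "\<And>i. i < b \<or> H \<le> i \<Longrightarrow> G i = F i"
  shows "tab G" "col G v = col F v"
  using assms q_less_b by (auto simp: tab_def col_def)

text \<open>The bitmaps and the stack of the current level must survive while those of the next
  level grow; they do, because all the indices involved differ modulo 4 (\<open>index_neq\<close>).
  The longer branch takes 84 steps, rounded up to 100.\<close>

lemma awp_discover:
  assumes "stat \<rho>" "tab F" "\<rho> rU = u" "u < n" "\<rho> rNC = nc" "cc = 1 \<and> nc = 2 \<or> cc = 2 \<and> nc = 1"
    "\<rho> rTN = tn" "ds F nc tn An" "ds F cc tc Ac"
    and Q: "\<And>\<rho>' t' G \<tau>'. (\<forall>i. i \<notin> {13, 23, 24, 25, 26, 28, 29} \<longrightarrow> \<rho>' i = \<rho> i) \<Longrightarrow> \<rho>' rTN = t' \<Longrightarrow> tab G \<Longrightarrow>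
      (\<And>v. col G v = (if v = u then nc else col F v)) \<Longrightarrow> ds G nc t' (insert (u div q) An) \<Longrightarrow>
      ds G cc tc Ac \<Longrightarrow> \<tau>' \<le> \<tau> + 100 \<Longrightarrow> Q \<rho>' G (out @ [u]) \<tau>'"
  shows "awp discover Q \<rho> F out \<tau>"
  unfolding discover_def
proof (rule awp_seqs, rule awp_setcol[OF assms(1,2) _ _ assms(3,4,5)])
  fix a1 a2 a3 a4 G
  assume cG: "\<And>v'. col G v' = (if v' = u then nc else col F v')" and tG: "tab G" and lG: "\<And>k. k < H \<Longrightarrow> G k = F k"
  define k where "k = u div q"
  define z where "z = k div q"
  define i where "i = b + 4 * z + nc"
  define y where "y = G i"
  define y' where "y' = semiring_bit_operations_class.or y (2 ^ (k mod q))"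
  define si where "si = b + 4 * tn + 2 + nc"
  define G' where "G' = (if y = 0 then G(si := z) else G)"
  define t' where "t' = (if y = 0 then Suc tn else tn)"
  have nc: "nc = 1 \<or> nc = 2" and cc: "cc = 1 \<or> cc = 2" using assms(6) by auto
  have z: "z < nsb" unfolding z_def k_def by (rule block_less(2)[OF assms(4)])
  have zb: "z < 2 ^ b" unfolding z_def k_def
    using nb assms(4) by (meson div_le_dividend le_less_trans less_trans)
  have tn: "tn \<le> nsb" by (rule ds_size(1)[OF assms(8)])
  have dsG: "ds G \<kappa> t A" if "ds F \<kappa> t A" "\<kappa> = 1 \<or> \<kappa> = 2" for \<kappa> t A
    using index_less that ds_size(1)[OF that(1)] by (intro ds_cong[OF that(1)] lG) auto
  note dn = dsG[OF assms(8) nc] and dc = dsG[OF assms(9) cc]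
  \<comment> \<open>A zero bitmap means that this superblock is missing from the stack, so there is
    room for one more.\<close>
  have tn': "tn < nsb" if "y = 0"
    using that ds_zero_iff[OF dn z] ds_size(2)[OF dn] z unfolding y_def i_def z_def by simp
  have D: "ds (G'(i := y')) nc t' (insert k An)"
    using ds_insert[OF dn z[unfolded z_def] nc] unfolding G'_def t'_def y'_def y_def i_def si_def z_def by simp
  have iH: "i < H" "b \<le> i" unfolding i_def using index_less[OF z nc] by auto
  have siH: "si < H" "b \<le> si" if "y = 0" unfolding si_def using index_less[OF tn'[OF that] nc] by auto
  have far: "(G'(i := y')) j = G j" if "j < b \<or> H \<le> j" for j
    using that iH siH unfolding G'_def by auto
  have D2: "ds (G'(i := y')) cc tc Ac"
    using index_neq[OF assms(6)] by (intro ds_cong[OF dc]) (auto simp: G'_def i_def si_def)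
  have T: "tab (G'(i := y'))" by (rule tab_cong(1)[OF tG far])
  have C: "col (G'(i := y')) v = (if v = u then nc else col F v)" for v
    by (rule trans[OF tab_cong(2)[OF tG far] cG])
  have bit_y: "bit y' j \<Longrightarrow> j < q" for j
  proof -
    assume "bit y' j"
    then have "bit y j \<or> j = k mod q" unfolding y'_def by (auto simp: bit_or_iff bit_exp_iff)
    then show "j < q" using dn z q1 unfolding ds_def y_def i_def by auto
  qed
  have "y' < 2 ^ q" unfolding less_power_iff_bits using bit_y by (meson not_less)
  also have "2 ^ q < (2::nat) ^ b" using q_less_b by simp
  finally have yb: "y' < 2 ^ b" .
  have Hw: "H < 2 ^ w" using b_less_H NFw by simp
  have km: "k mod q < w" using q1 q_less_b b_le_w by (meson less_le_trans less_trans mod_less_divisor zero_less_one)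
  have i': "z * 4 + b + nc = i" unfolding i_def by simp
  have bd: "z * 4 < 2 ^ w" "z * 4 + b < 2 ^ w" "i < 2 ^ w" "i < NF"
    using iH Hw b_less_H unfolding i'[symmetric] by linarith+
  have si': "tn * 4 + b + nc + 2 = si" "Suc (Suc (tn * 4 + b + nc)) = si" unfolding si_def by simp_all
  have sbd: "tn * 4 < 2 ^ w" "tn * 4 + b < 2 ^ w" "tn * 4 + b + nc < 2 ^ w" "si < 2 ^ w" "si < NF" "Suc tn < 2 ^ w"
    if "y = 0" using siH[OF that] Hw b_less_H nc unfolding si'(1)[symmetric] by linarith+
  note f = k_def[symmetric] z_def[symmetric] y_def[symmetric] y'_def[symmetric] i' bd km iH yb zb nc
  let ?\<rho> = "\<rho>(23 := a1, 24 := a2, 26 := a3, 25 := a4)"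
  show "awp (seqs [
     Write (V rU),
     Op Div (Cell 23) (V rU) (V rQ), Op Mod (Cell 24) (V 23) (V rQ), Op Div (Cell 25) (V 23) (V rQ),
     Op Shl (Cell 24) (Const 1) (V 24),
     Op Mul (Cell 26) (V 25) (Const 4), Op Add (Cell 26) (V 26) (V rB), Op Add (Cell 26) (V 26) (V rNC),
     rdf 28 26, If Eq (V 28) (Const 0) push (seqs []),
     Op Or (Cell 28) (V 28) (V 24), wrf 26 28]) Q ?\<rho> G out (\<tau> + 36)"
    apply (rule awp_seqs awp_seqs1 | (rule awp_ops, (simp add: assms f statD; fail)+))+
    apply (rule awp_If)
      apply simp
    subgoal premises p
    proof -
      have y0: "y = 0" using p by simp
      have GE: "G(si := z) = G'" "tn + Suc 0 = t'" "tn + 1 = t'" using y0 by (simp_all add: G'_def t'_def)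
      show ?thesis
        unfolding push_def
        apply (rule awp_seqs awp_seqs1 | (rule awp_ops, (simp add: assms f statD sbd[OF y0] si'; fail)+))+
        apply (simp only: GE)
        apply (rule Q[OF _ _ T C D[unfolded k_def] D2])
          apply simp_all
        done
    qed
    subgoal premises p
    proof -
      have y0: "y \<noteq> 0" using p by simp
      have GE: "G = G'" "tn = t'" using y0 by (simp_all add: G'_def t'_def)
      show ?thesis
        apply (rule awp_Skip)
        apply (rule awp_seqs awp_seqs1 | (rule awp_ops, (simp add: assms f statD; fail)+))+
        apply (simp only: GE)
        apply (rule Q[OF _ _ T C D[unfolded k_def] D2])
          apply (simp_all add: assms GE)
        done
    qed
    done
qed (use assms(6) in auto)

end

section \<open>Expanding vertices and blocks\<close>

definition scan :: prog where
  "scan = seqs [Op Add (Cell rP) (V rV) (Const 2), Read (Cell rP) (V rP),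
     While Less (Const 0) (V rP) (seqs [
       Read (Cell rU) (V rP), Op Add (Cell rP) (V rP) (Const 1), Read (Cell rP) (V rP),
       getcol rA rU, If Eq (V rA) (Const 0) discover (seqs [])])]"

text \<open>The last block may have fewer than q vertices, hence the test against n in every
  round.\<close>

definition expand_block :: prog where
  "expand_block = seqs [Op Mul (Cell rV) (V rK) (V rQ), Move (Cell rJ) (Const 0),
     While Less (V rJ) (V rQ) (seqs [
       If Less (V rV) (V rN)
         (seqs [getcol rA rV, If Eq (V rA) (V rCC) scan (seqs []), Op Add (Cell rV) (V rV) (Const 1)])
         (seqs []),
       Op Add (Cell rJ) (V rJ) (Const 1)])]"

locale bfs_ram = layout +
  fixes G :: "nat pair_pre_digraph" and s :: nat
  assumes fin: "pair_fin_digraph G" and verts: "pverts G = {..<n}" and s: "s < n"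
    and adj: "adjacency_input G n s I" and lenI: "length I \<le> 2 ^ w"
begin

definition nbrs :: "nat \<Rightarrow> nat set" where
  "nbrs v = {u. (v, u) \<in> parcs G}"

lemma wf: "pair_wf_digraph G"
  using fin by (simp add: pair_fin_digraph_def)

lemma nbrs_less: "u \<in> nbrs v \<Longrightarrow> u < n"
  using pair_wf_digraph.in_arcsD2[OF wf] verts by (auto simp: nbrs_def)

lemma len_ge: "n + 2 \<le> length I" "n + 2 \<le> 2 ^ w"
  using adj lenI by (auto simp: adjacency_input_def)

text \<open>Vertices of D and B are only required to be nonwhite; their colour may coincide with
  either level's. The set A of recorded blocks is a separate argument, because popping a superblock
  erases its blocks before their vertices are expanded.\<close>

definition cfg where
  "cfg \<rho> F D B C N A \<longleftrightarrow> stat \<rho> \<and> tab F \<and> (\<rho> rCC = 1 \<and> \<rho> rNC = 2 \<or> \<rho> rCC = 2 \<and> \<rho> rNC = 1) \<and>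
     (\<forall>v<n. col F v = 0 \<longleftrightarrow> v \<notin> D \<union> B \<union> C \<union> N) \<and> (\<forall>v\<in>C. col F v = \<rho> rCC) \<and> (\<forall>v\<in>N. col F v = \<rho> rNC) \<and>
     ds F (\<rho> rCC) (\<rho> rTC) A \<and> ds F (\<rho> rNC) (\<rho> rTN) ((\<lambda>v. v div q) ` N)"

lemma cfg_upd [simp]: "13 < i \<Longrightarrow> cfg (\<rho>(i := x)) F D B C N A = cfg \<rho> F D B C N A"
  by (simp add: cfg_def)

lemma cfg_stat: "cfg \<rho> F D B C N A \<Longrightarrow> stat \<rho>" "cfg \<rho> F D B C N A \<Longrightarrow> tab F"
  by (auto simp: cfg_def)

lemma awp_discover_nbr:
  assumes c: "cfg \<rho> F D B C N A" and st: "bfs_state G D r d ys B C N" and v: "v \<in> C" "u \<in> nbrs v" "u \<notin> D \<union> set ys"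
    and u: "\<rho> rU = u"
    and Q: "\<And>\<rho>' F' \<tau>'. (\<forall>i. i \<notin> {13, 23, 24, 25, 26, 28, 29} \<longrightarrow> \<rho>' i = \<rho> i) \<Longrightarrow>
      cfg \<rho>' F' D B C (insert u N) A \<Longrightarrow> bfs_state G D r d (ys @ [u]) B C (insert u N) \<Longrightarrow> \<tau>' \<le> \<tau> + 100 \<Longrightarrow>
      Q \<rho>' F' (out @ [u]) \<tau>'"
  shows "awp discover Q \<rho> F out \<tau>"
proof -
  interpret st: bfs_state G D r d ys B C N by fact
  have "u \<notin> C" using v(3) st.ys(2) by blast
  show ?thesis
  proof (rule awp_discover[where An = "(\<lambda>v. v div q) ` N" and Ac = A and tc = "\<rho> rTC" and cc = "\<rho> rCC"])
    fix \<rho>' t' G' \<tau>'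
    assume a: "\<forall>i. i \<notin> {13, 23, 24, 25, 26, 28, 29} \<longrightarrow> \<rho>' i = \<rho> i" "\<rho>' rTN = t'" "tab G'"
      "\<And>v. col G' v = (if v = u then \<rho> rNC else col F v)" "ds G' (\<rho> rNC) t' (insert (u div q) ((\<lambda>v. v div q) ` N))"
      "ds G' (\<rho> rCC) (\<rho> rTC) A" "\<tau>' \<le> \<tau> + 100"
    have r: "\<rho>' i = \<rho> i" if "i \<in> {4, 5, 6, 7, 8, 9, 10, 11, 12}" for i
    proof -
      have "i \<notin> {13, 23, 24, 25, 26, 28, 29}" using that by auto
      then show ?thesis using a(1) by blast
    qed
    have "stat \<rho>' = stat \<rho>" by (simp add: stat_def geo_def r)
    then have "cfg \<rho>' G' D B C (insert u N) A"
      using c a \<open>u \<notin> C\<close> unfolding cfg_def by (auto simp: r)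
    then show "Q \<rho>' G' (out @ [u]) \<tau>'"
      using Q[OF a(1)] st.discover[OF v(1) _ v(3)] v(2) a(7) by (simp add: nbrs_def)
  qed (use c u nbrs_less[OF v(2)] in \<open>auto simp: cfg_def\<close>)
qed

definition deg :: "nat \<Rightarrow> nat" where
  "deg v = card (nbrs v)"

lemma linked_list_Cons:
  assumes "linked_list I p xs" "0 < p"
  obtains ys where "xs = I ! p # ys" "p + 1 < length I" "linked_list I (I ! (p + 1)) ys"
  using assms by (cases rule: linked_list.cases) auto

lemma linked_list_0: "linked_list I 0 xs \<Longrightarrow> xs = []"
  by (cases rule: linked_list.cases) auto

text \<open>The second alternative of \<open>vC\<close> is the old vertex that happens to have the
  colour of the level: it is scanned again and finds nothing new. A list cell costs 24 steps and at
  most 100 more for a discovery, rounded up to 130.\<close>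

lemma awp_scan:
  assumes c: "cfg \<rho> F D B C N A" and st: "bfs_state G D r d ys B C N" and v: "\<rho> rV = v" "v < n"
    and vC: "v \<in> C \<or> nbrs v \<subseteq> D \<union> set ys"
    and Q: "\<And>\<rho>' F' \<tau>' ys' N'. (\<forall>i. i \<notin> {13} \<union> {21..<30} \<longrightarrow> \<rho>' i = \<rho> i) \<Longrightarrow>
      cfg \<rho>' F' D B C N' A \<Longrightarrow> bfs_state G D r d ys' B C N' \<Longrightarrow> nbrs v \<subseteq> D \<union> set ys' \<Longrightarrow>
      \<tau>' \<le> \<tau> + 3 + 130 * deg v \<Longrightarrow> Q \<rho>' F' (o0 @ ys') \<tau>'"
  shows "awp scan Q \<rho> F (o0 @ ys) \<tau>"
proof -
  define p0 where "p0 = I ! (v + 2)"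
  obtain xs0 where xs0: "linked_list I p0 xs0" "distinct xs0" "set xs0 = nbrs v"
    using adj v(2) unfolding adjacency_input_def p0_def nbrs_def by (metis add.commute)
  have deg: "deg v = length xs0" unfolding deg_def xs0(3)[symmetric] by (rule distinct_card[OF xs0(2)])
  have b: "v + 2 < length I" "v + 2 < 2 ^ w" "Suc (Suc v) < length I" "Suc (Suc v) < 2 ^ w" "I ! Suc (Suc v) = p0"
    using v(2) len_ge unfolding p0_def by auto
  \<comment> \<open>\<open>xs\<close> is the unread rest of the list, and 130 steps are reserved for
    each of its cells.\<close>
  define J where "J \<rho>' F' out' \<tau>' \<longleftrightarrow> (\<exists>xs ys' N'. linked_list I (\<rho>' rP) xs \<and> set xs \<subseteq> nbrs v \<and>
      nbrs v \<subseteq> set xs \<union> (D \<union> set ys') \<and> cfg \<rho>' F' D B C N' A \<and> bfs_state G D r d ys' B C N' \<and>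
      (v \<in> C \<or> nbrs v \<subseteq> D \<union> set ys') \<and>
      out' = o0 @ ys' \<and> (\<forall>i. i \<notin> {13} \<union> {21..<30} \<longrightarrow> \<rho>' i = \<rho> i) \<and>
      \<tau>' + 130 * length xs \<le> \<tau> + 2 + 130 * deg v)" for \<rho>' F' out' \<tau>'
  show ?thesis unfolding scan_def
    apply (rule awp_seqs awp_seqs1 | (rule awp_ops, (simp add: v b; fail)+))+
    apply (rule awp_While[where J = J and T = "\<tau> + 2 + 130 * deg v"])
  proof -
    show "J (\<rho>(rP := v + 2, rP := I ! Suc (Suc v))) F (o0 @ ys) (\<tau> + 1 + 1)"
      unfolding J_def using xs0 c st vC deg by (intro exI[of _ xs0] exI[of _ ys] exI[of _ N]) (auto simp: p0_def)
  next
    fix \<rho>1 F1 out1 \<tau>1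
    assume J: "J \<rho>1 F1 out1 \<tau>1" and t: "test_val Less (opv \<rho>1 (Const 0)) (opv \<rho>1 (V rP))"
    from J obtain xs ys1 N1 where j: "linked_list I (\<rho>1 rP) xs" "set xs \<subseteq> nbrs v"
      "nbrs v \<subseteq> set xs \<union> (D \<union> set ys1)" "cfg \<rho>1 F1 D B C N1 A" "bfs_state G D r d ys1 B C N1"
      "v \<in> C \<or> nbrs v \<subseteq> D \<union> set ys1" "out1 = o0 @ ys1" "\<forall>i. i \<notin> {13} \<union> {21..<30} \<longrightarrow> \<rho>1 i = \<rho> i"
      "\<tau>1 + 130 * length xs \<le> \<tau> + 2 + 130 * deg v" unfolding J_def by blast
    interpret st: bfs_state G D r d ys1 B C N1 by (rule j(5))
    obtain p where p: "\<rho>1 rP = p" "0 < p" using t by simp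
    from linked_list_Cons[OF j(1)[unfolded p(1)] p(2)] obtain xs' where
      xs': "xs = I ! p # xs'" "p + 1 < length I" "linked_list I (I ! (p + 1)) xs'" .
    define u where "u = I ! p"
    have u: "u \<in> nbrs v" "u < n" using j(2) xs'(1) nbrs_less unfolding u_def by auto
    have col: "col F1 u = 0 \<longleftrightarrow> u \<notin> D \<union> set ys1"
      using j(4) u(2) st.ys(2) unfolding cfg_def by blast
    have b: "p < length I" "p + 1 < 2 ^ w" "Suc p < length I" "Suc p < 2 ^ w" using xs'(2) lenI by auto
    show "awp (seqs [Read (Cell rU) (V rP), Op Add (Cell rP) (V rP) (Const 1), Read (Cell rP) (V rP),
       getcol rA rU, If Eq (V rA) (Const 0) discover (seqs [])]) J \<rho>1 F1 out1 (\<tau>1 + 1)"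
      apply (rule awp_seqs awp_seqs1 | (rule awp_ops, (simp add: p b u_def[symmetric]; fail)+))+
      apply (rule awp_getcol[where v = u], (use cfg_stat[OF j(4)] u in \<open>simp add: u_def; fail\<close>)+)
      apply (rule awp_seqs1)
      apply (rule awp_If)
        apply simp
      subgoal premises pr for a e
      proof -
        have new: "u \<notin> D \<union> set ys1" using pr col by simp
        \<comment> \<open>A white neighbour excludes the second alternative, so v really belongs to
          the level and \<open>discover\<close> applies.\<close>
        then have vC: "v \<in> C" using j(6) u(1) by blast
        show ?thesis unfolding j(7)
          apply (rule awp_discover_nbr[where v = v and u = u and ys = ys1 and r = r and d = d and D = D and B = B
                and C = C and N = N1 and A = A])
          using j(4,5) vC u new apply (simp_all add: u_def)[6]
          subgoal premises pr2 for \<rho>' F' \<tau>'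
          proof -
            have "\<rho>' rP = I ! (p + 1)" using pr2(1) by simp
            moreover have "\<forall>i. i \<notin> {13} \<union> {21..<30} \<longrightarrow> \<rho>' i = \<rho> i"
              using pr2(1) j(8) by auto
            ultimately show ?thesis
              unfolding J_def using j(2,3,9) xs' vC pr2(2-4)
              by (intro exI[of _ xs'] exI[of _ "ys1 @ [u]"] exI[of _ "insert u N1"]) (auto simp: u_def)
          qed
          done
      qed
      subgoal premises pr for a e
      proof -
        have old: "u \<in> D \<union> set ys1" using pr col by simp
        show ?thesis unfolding j(7)
          apply (rule awp_Skip)
          unfolding J_def
          apply (rule exI[of _ xs'], rule exI[of _ ys1], rule exI[of _ N1])
          using j xs' old by (auto simp: u_def)
      qed
      done
  next
    fix \<rho>1 F1 out1 \<tau>1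
    assume J: "J \<rho>1 F1 out1 \<tau>1" and t: "\<not> test_val Less (opv \<rho>1 (Const 0)) (opv \<rho>1 (V rP))"
    then have p: "\<rho>1 rP = 0" by simp
    from J obtain xs ys1 N1 where j: "linked_list I 0 xs"
      "nbrs v \<subseteq> set xs \<union> (D \<union> set ys1)" "cfg \<rho>1 F1 D B C N1 A" "bfs_state G D r d ys1 B C N1"
      "out1 = o0 @ ys1" "\<forall>i. i \<notin> {13} \<union> {21..<30} \<longrightarrow> \<rho>1 i = \<rho> i"
      "\<tau>1 + 130 * length xs \<le> \<tau> + 2 + 130 * deg v" unfolding J_def p[symmetric] by blast
    have "xs = []" by (rule linked_list_0[OF j(1)])
    then show "Q \<rho>1 F1 out1 (\<tau>1 + 1)" unfolding j(5) using j by (intro Q[of _ _ N1]) auto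
  qed (auto simp: J_def)
qed


definition block_deg :: "nat \<Rightarrow> nat" where
  "block_deg k = (\<Sum>v | v < n \<and> v div q = k. deg v)"

text \<open>Vertices found on the way get the other colour. So the block loses exactly its vertices
  of the current level, even if it gains some of the next level. A round costs at most 27 steps
  apart from the list cells.\<close>

lemma awp_expand_block:
  assumes c: "cfg \<rho> F D B C N A" and st: "bfs_state G D r d ys B C N" and k: "\<rho> rK = k" "k * q < n"
    and Q: "\<And>\<rho>' F' \<tau>' ys' N'. (\<forall>i. i \<notin> {13} \<union> {19..<30} \<longrightarrow> \<rho>' i = \<rho> i) \<Longrightarrow>
      cfg \<rho>' F' D (B \<union> {v\<in>C. v div q = k}) {v\<in>C. v div q \<noteq> k} N' A \<Longrightarrow>
      bfs_state G D r d ys' (B \<union> {v\<in>C. v div q = k}) {v\<in>C. v div q \<noteq> k} N' \<Longrightarrow>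
      \<tau>' \<le> \<tau> + 40 * q + 130 * block_deg k + 3 \<Longrightarrow> Q \<rho>' F' (o0 @ ys') \<tau>'"
  shows "awp expand_block Q \<rho> F (o0 @ ys) \<tau>"
proof -
  define part where "part j = {k * q..<k * q + j}" for j
  define W where "W j = (\<Sum>v | v < n \<and> v \<in> part j. deg v)" for j
  have full: "v \<in> part q \<longleftrightarrow> v div q = k" for v
  proof -
    have "v \<in> part q \<longleftrightarrow> k \<le> v div q \<and> v div q < Suc k"
      using q1 unfolding part_def by (simp add: less_eq_div_iff_mult_less_eq div_less_iff_less_mult algebra_simps)
    then show ?thesis by auto
  qed
  have Wq: "W q = block_deg k" unfolding W_def block_deg_def full ..
  have Wmono: "W j \<le> W q" if "j \<le> q" for j
    unfolding W_def using that by (intro sum_mono2) (auto simp: part_def)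
  have Wge: "W (Suc j) = W j" if "n \<le> k * q + j" for j
    unfolding W_def using that by (intro sum.cong) (auto simp: part_def)
  have Wlt: "W (Suc j) = W j + deg (k * q + j)" if "k * q + j < n" for j
  proof -
    have "{v. v < n \<and> v \<in> part (Suc j)} = insert (k * q + j) {v. v < n \<and> v \<in> part j}"
      using that unfolding part_def by auto
    then show ?thesis unfolding W_def by (simp add: part_def)
  qed
  have kq: "k * q < 2 ^ w" using k len_ge by linarith
  \<comment> \<open>In an incomplete last block \<open>rV\<close> stops at n, while
    \<open>rJ\<close> runs on to q.\<close>
  define J where "J \<rho>' F' out' \<tau>' \<longleftrightarrow> (\<exists>j ys' N'. \<rho>' rJ = j \<and> j \<le> q \<and> \<rho>' rV = min (k * q + j) n \<and>
      (\<forall>i. i \<notin> {13} \<union> {19..<30} \<longrightarrow> \<rho>' i = \<rho> i) \<and>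
      cfg \<rho>' F' D (B \<union> (C \<inter> part j)) (C - part j) N' A \<and>
      bfs_state G D r d ys' (B \<union> (C \<inter> part j)) (C - part j) N' \<and> out' = o0 @ ys' \<and>
      \<tau>' \<le> \<tau> + 2 + 40 * j + 130 * W j)" for \<rho>' F' out' \<tau>'
  have Jbound: "\<tau>' \<le> \<tau> + 2 + 40 * q + 130 * W q" if "J \<rho>' F' out' \<tau>'" for \<rho>' F' out' \<tau>'
  proof -
    obtain j where "j \<le> q" "\<tau>' \<le> \<tau> + 2 + 40 * j + 130 * W j" using \<open>J \<rho>' F' out' \<tau>'\<close> unfolding J_def by blast
    moreover have "W j \<le> W q" by (rule Wmono) fact
    ultimately show ?thesis by linarith
  qed
  show ?thesis unfolding expand_block_def
    apply (rule awp_seqs awp_seqs1 | (rule awp_ops, (simp add: k statD[OF cfg_stat(1)[OF c]] kq; fail)+))+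
    apply (rule awp_While[where J = J and T = "\<tau> + 2 + 40 * q + 130 * W q"])
  proof -
    show "J (\<rho>(rV := k * q, rJ := 0)) F (o0 @ ys) (\<tau> + 1 + 1)"
      unfolding J_def using c st k by (intro exI[of _ 0] exI[of _ ys] exI[of _ N]) (auto simp: part_def W_def)
  next
    fix \<rho>1 F1 out1 \<tau>1
    assume J: "J \<rho>1 F1 out1 \<tau>1" and t: "test_val Less (opv \<rho>1 (V rJ)) (opv \<rho>1 (V rQ))"
    from J obtain j ys1 N1 where j: "\<rho>1 rJ = j" "j \<le> q" "\<rho>1 rV = min (k * q + j) n"
      "\<forall>i. i \<notin> {13} \<union> {19..<30} \<longrightarrow> \<rho>1 i = \<rho> i"
      "cfg \<rho>1 F1 D (B \<union> (C \<inter> part j)) (C - part j) N1 A"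
      "bfs_state G D r d ys1 (B \<union> (C \<inter> part j)) (C - part j) N1" "out1 = o0 @ ys1"
      "\<tau>1 \<le> \<tau> + 2 + 40 * j + 130 * W j" unfolding J_def by blast
    interpret st: bfs_state G D r d ys1 "B \<union> (C \<inter> part j)" "C - part j" N1 by (rule j(6))
    note sD = statD[OF cfg_stat(1)[OF j(5)]]
    have jq: "j < q" using t j(1) sD by simp
    have wj: "Suc j < 2 ^ w"
    proof -
      have "j < b" using jq q_less_b by simp
      then show ?thesis using b_le_w less_exp[of w] by linarith
    qed
    define v where "v = k * q + j"
    have part_Suc: "part (Suc j) = insert v (part j)" unfolding part_def v_def by auto
    show "awp (seqs [
       If Less (V rV) (V rN)
         (seqs [getcol rA rV, If Eq (V rA) (V rCC) scan (seqs []), Op Add (Cell rV) (V rV) (Const 1)])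
         (seqs []),
       Op Add (Cell rJ) (V rJ) (Const 1)]) J \<rho>1 F1 out1 (\<tau>1 + 1)"
      apply (rule awp_seqs)
      apply (rule awp_If)
        apply simp
      subgoal premises pr
      proof -
        have vn: "v < n" using pr j(3) sD unfolding v_def by simp
        have rv: "\<rho>1 rV = v" using j(3) vn unfolding v_def by simp
        have vw: "Suc v < 2 ^ w" using vn len_ge by linarith
        have cC: "v \<in> C - part j \<Longrightarrow> col F1 v = \<rho>1 rCC" using j(5) unfolding cfg_def by blast
        have vp: "v \<notin> part j" unfolding part_def v_def by simp
        show ?thesis
          apply (rule awp_seqs)
          apply (rule awp_getcol[where v = v], (use cfg_stat[OF j(5)] vn rv in \<open>simp; fail\<close>)+)
          apply (rule awp_seqs)
          apply (rule awp_If)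
            apply simp
          subgoal premises pr2 for a e
          proof -
            have colv: "col F1 v = \<rho>1 rCC" using pr2 by simp
            have "\<rho>1 rCC \<noteq> 0" "\<rho>1 rCC \<noteq> \<rho>1 rNC" using j(5) unfolding cfg_def by auto
            \<comment> \<open>The colour excludes white vertices and those of N. For v in D or among
              the expanded ones, all out-neighbours are known already.\<close>
            then have "v \<in> D \<union> (B \<union> (C \<inter> part j)) \<union> (C - part j)"
              using j(5) vn colv unfolding cfg_def by (metis Un_iff)
            then have "v \<in> C - part j \<or> nbrs v \<subseteq> D \<union> set ys1"
              using st.D_closed st.B_out unfolding nbrs_def by blast
            then show ?thesis unfolding j(7)
              apply (intro awp_scan[where v = v and ys = ys1 and r = r and d = d and D = D and B = "B \<union> (C \<inter> part j)"
                and C = "C - part j" and N = N1 and A = A])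
              using j(5,6) rv vn apply simp_all[5]
              subgoal premises pr3 for \<rho>' F' \<tau>' ys' N'
              proof -
                interpret st': bfs_state G D r d ys' "B \<union> (C \<inter> part j)" "C - part j" N' by (rule pr3(4))
                have eqs: "\<rho>' 19 = v" "\<rho>' 20 = j" "\<rho>' rN = n" using pr3(2) rv j(1) sD by simp_all
                have rho: "\<forall>i. i \<notin> {13} \<union> {19..<30} \<longrightarrow> \<rho>' i = \<rho> i" using pr3(2) j(4) by auto
                have cfg': "cfg \<rho>' F' D (B \<union> (C \<inter> part (Suc j))) (C - part (Suc j)) N' A"
                  using pr3(3) unfolding cfg_def part_Suc by auto
                have st'': "bfs_state G D r d ys' (B \<union> (C \<inter> part (Suc j))) (C - part (Suc j)) N'"
                proof (cases "v \<in> C")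
                  case True
                  then have "B \<union> (C \<inter> part (Suc j)) = insert v (B \<union> (C \<inter> part j))"
                    "C - part (Suc j) = (C - part j) - {v}" unfolding part_Suc by auto
                  then show ?thesis using st'.expand[of v] True vp pr3(5) unfolding nbrs_def by auto
                next
                  case False
                  then have "B \<union> (C \<inter> part (Suc j)) = B \<union> (C \<inter> part j)"
                    "C - part (Suc j) = C - part j" unfolding part_Suc by auto
                  then show ?thesis using pr3(4) by simp
                qed
                show ?thesis
                  apply (rule awp_seqs awp_seqs1 | (rule awp_ops, (simp add: eqs vw wj; fail)+))+
                  unfolding J_def
                  apply (rule exI[of _ "Suc j"], rule exI[of _ ys'], rule exI[of _ N'])
                  using jq vn rho cfg' st'' pr3(6) j(8) Wlt[of j] by (auto simp: v_def)
              qed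
              done
          qed
          subgoal premises pr2 for a e
          proof -
            have "v \<notin> C - part j" using pr2 cC by auto
            then have "v \<notin> C" using vp by auto
            then have same: "B \<union> (C \<inter> part (Suc j)) = B \<union> (C \<inter> part j)" "C - part (Suc j) = C - part j"
              unfolding part_Suc by auto
            show ?thesis
              apply (rule awp_Skip)
              apply (rule awp_seqs awp_seqs1 | (rule awp_ops, (simp add: rv j(1) vw wj; fail)+))+
              unfolding J_def
              apply (rule exI[of _ "Suc j"], rule exI[of _ ys1], rule exI[of _ N1])
              unfolding same using jq vn j(4-8) Wlt[of j] by (auto simp: v_def)
          qed
          done
      qed
      subgoal premises pr
      proof -
        have vn: "n \<le> v" using pr j(3) sD unfolding v_def by simp
        have Cn: "C - part j \<subseteq> {..<n}" using st.ys_verts st.ys(2) verts by auto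
        then have same: "B \<union> (C \<inter> part (Suc j)) = B \<union> (C \<inter> part j)" "C - part (Suc j) = C - part j"
          using vn unfolding part_Suc by auto
        show ?thesis
          apply (rule awp_Skip)
          apply (rule awp_seqs awp_seqs1 | (rule awp_ops, (simp add: j(1) wj; fail)+))+
          unfolding J_def
          apply (rule exI[of _ "Suc j"], rule exI[of _ ys1], rule exI[of _ N1])
          unfolding same using jq vn j(3-8) Wge[of j] by (auto simp: v_def)
      qed
      done
  next
    fix \<rho>1 F1 out1 \<tau>1
    assume J: "J \<rho>1 F1 out1 \<tau>1" and t: "\<not> test_val Less (opv \<rho>1 (V rJ)) (opv \<rho>1 (V rQ))"
    from J obtain j ys1 N1 where j: "\<rho>1 rJ = j" "j \<le> q"
      "\<forall>i. i \<notin> {13} \<union> {19..<30} \<longrightarrow> \<rho>1 i = \<rho> i"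
      "cfg \<rho>1 F1 D (B \<union> (C \<inter> part j)) (C - part j) N1 A"
      "bfs_state G D r d ys1 (B \<union> (C \<inter> part j)) (C - part j) N1" "out1 = o0 @ ys1" unfolding J_def by blast
    have "j = q" using t j(1,2) statD[OF cfg_stat(1)[OF j(4)]] by simp
    moreover have "C \<inter> part q = {v\<in>C. v div q = k}" "C - part q = {v\<in>C. v div q \<noteq> k}" using full by auto
    ultimately show "Q \<rho>1 F1 out1 (\<tau>1 + 1)"
      unfolding j(6) using j(3-5) Jbound[OF J] Wq by (intro Q) auto
  qed (rule Jbound | simp)+
qed

end

section \<open>The search\<close>

definition swap :: prog where
  "swap = seqs [Move (Cell 23) (V rCC), Move (Cell rCC) (V rNC), Move (Cell rNC) (V 23),
     Move (Cell rTC) (V rTN), Move (Cell rTN) (Const 0)]"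

definition pop :: prog where
  "pop = seqs [Op Sub (Cell rTC) (V rTC) (Const 1),
     Op Mul (Cell 23) (V rTC) (Const 4), Op Add (Cell 23) (V 23) (V rB), Op Add (Cell 23) (V 23) (Const 2),
     Op Add (Cell 23) (V 23) (V rCC), rdf rSB 23,
     Op Mul (Cell 23) (V rSB) (Const 4), Op Add (Cell 23) (V 23) (V rB), Op Add (Cell 23) (V 23) (V rCC),
     rdf rX 23, Move (Cell 24) (Const 0), wrf 23 24, Op Mul (Cell rK) (V rSB) (V rQ),
     While Less (Const 0) (V rX) (seqs [
       Op Mod (Cell rA) (V rX) (Const 2), If Eq (V rA) (Const 1) expand_block (seqs []),
       Op Div (Cell rX) (V rX) (Const 2), Op Add (Cell rK) (V rK) (Const 1)]),
     If Eq (V rTC) (Const 0) swap (seqs [])]"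

definition search :: prog where
  "search = While Less (Const 0) (V rTC) pop"

section \<open>Removing the top superblock from a stack\<close>

context layout
begin

text \<open>By injectivity the popped superblock does not occur further down, so clearing its bitmap
  restores the correspondence between stack and bitmaps.\<close>

lemma ds_pop:
  assumes d: "ds F \<kappa> (Suc t) A" and \<kappa>: "\<kappa> = 1 \<or> \<kappa> = 2"
  defines "z \<equiv> F (b + 4 * t + 2 + \<kappa>)"
  shows "z < nsb" "z \<in> (\<lambda>k. k div q) ` A" "ds (F(b + 4 * z + \<kappa> := 0)) \<kappa> t {k\<in>A. k div q \<noteq> z}"
proof -
  have img: "(\<lambda>i. F (b + 4 * i + 2 + \<kappa>)) ` {..<Suc t} = (\<lambda>k. k div q) ` A"
    and inj: "inj_on (\<lambda>i. F (b + 4 * i + 2 + \<kappa>)) {..<Suc t}" using d unfolding ds_def by auto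
  have St: "{..<Suc t} = insert t {..<t}" by auto
  show zA: "z \<in> (\<lambda>k. k div q) ` A" unfolding img[symmetric] z_def by simp
  then show zn: "z < nsb" using d unfolding ds_def by auto
  have zt: "z \<notin> (\<lambda>i. F (b + 4 * i + 2 + \<kappa>)) ` {..<t}"
    using inj unfolding St z_def by simp
  let ?G = "F(b + 4 * z + \<kappa> := 0)"
  have neq: "b + 4 * i + 2 + \<kappa> \<noteq> b + 4 * z + \<kappa>" for i by arith
  have G2: "?G (b + 4 * i + 2 + \<kappa>) = F (b + 4 * i + 2 + \<kappa>)" for i using neq[of i] by (simp only: fun_upd_apply if_False)
  have "(\<lambda>i. F (b + 4 * i + 2 + \<kappa>)) ` {..<t} = (\<lambda>k. k div q) ` A - {z}"
    using zt img unfolding St z_def[symmetric] image_insert by auto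
  also have "\<dots> = (\<lambda>k. k div q) ` {k\<in>A. k div q \<noteq> z}" by auto
  finally have 1: "(\<lambda>i. ?G (b + 4 * i + 2 + \<kappa>)) ` {..<t} = (\<lambda>k. k div q) ` {k\<in>A. k div q \<noteq> z}"
    unfolding G2 .
  have 2: "inj_on (\<lambda>i. ?G (b + 4 * i + 2 + \<kappa>)) {..<t}"
    unfolding G2 using inj by (rule inj_on_subset) auto
  have 3: "bit (?G (b + 4 * z' + \<kappa>)) j \<longleftrightarrow> j < q \<and> z' * q + j \<in> {k\<in>A. k div q \<noteq> z}" if "z' < nsb" for z' j
  proof (cases "z' = z")
    case True
    have "(z * q + j) div q = z" if "j < q" using that by simp
    then show ?thesis using True by auto
  next
    case False
    have "(z' * q + j) div q = z'" if "j < q" using that by simp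
    moreover have "?G (b + 4 * z' + \<kappa>) = F (b + 4 * z' + \<kappa>)" using False by simp
    ultimately show ?thesis using d that False unfolding ds_def by auto
  qed
  show "ds ?G \<kappa> t {k\<in>A. k div q \<noteq> z}"
    unfolding ds_def using d by (intro conjI allI impI 1 2 3) (auto simp: ds_def)
qed

lemma ds_0: "ds F \<kappa> 0 A \<Longrightarrow> A = {}"
  unfolding ds_def by auto

lemma ds_empty: "ds F \<kappa> t {} \<Longrightarrow> t = 0"
  unfolding ds_def by auto

end

section \<open>Amortised cost of a pop\<close>

context bfs_ram
begin

text \<open>The credit of an unexpanded vertex: it suffices for one expansion of its block, which
  takes at most \<open>40 * q + 130 * block_deg k + 3\<close> steps, and for one pop of its
  superblock. \<open>pot\<close> sums the credits that are left when the vertices of X have been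
  spent.\<close>

definition weight :: "nat \<Rightarrow> nat" where
  "weight v = 1000 * q + 130 * block_deg (v div q)"

definition pot :: "nat set \<Rightarrow> nat" where
  "pot X = (\<Sum>v | v < n \<and> v \<notin> X. weight v)"

lemma pot_less:
  assumes "X \<subseteq> Y" "v \<in> Y" "v \<notin> X" "v < n"
  shows "pot Y + weight v \<le> pot X"
proof -
  have "{u. u < n \<and> u \<notin> X} \<supseteq> insert v {u. u < n \<and> u \<notin> Y}" using assms by auto
  then have "(\<Sum>u\<in>insert v {u. u < n \<and> u \<notin> Y}. weight u) \<le> pot X"
    unfolding pot_def by (intro sum_mono2) auto
  then show ?thesis using assms(2) unfolding pot_def by simp
qed

text \<open>
  A popped superblock is paid for by the first block that is expanded in it; until then, \<open>e\<close> is
  the debt.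
\<close>

lemma awp_pop:
  assumes c: "cfg \<rho> F D B C N ((\<lambda>v. v div q) ` C)" and st: "bfs_state G D r d ys B C N" and t: "0 < \<rho> rTC"
    and T: "\<tau> + pot (D \<union> B) \<le> T + 1"
    and Q: "\<And>\<rho>' F' \<tau>' d' ys' B' C' N'. (\<forall>i. i \<notin> {10..<14} \<union> {16..<30} \<longrightarrow> \<rho>' i = \<rho> i) \<Longrightarrow>
      cfg \<rho>' F' D B' C' N' ((\<lambda>v. v div q) ` C') \<Longrightarrow>
      bfs_state G D r d' ys' B' C' N' \<Longrightarrow> (C' = {} \<Longrightarrow> N' = {}) \<Longrightarrow>
      \<tau>' + pot (D \<union> B') \<le> T \<Longrightarrow> Q \<rho>' F' (o0 @ ys') \<tau>'"
  shows "awp pop Q \<rho> F (o0 @ ys) \<tau>"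
proof -
  define A where "A = (\<lambda>v. v div q) ` C"
  obtain t where t: "\<rho> rTC = Suc t" using t by (metis Suc_pred)
  define \<kappa> where "\<kappa> = \<rho> rCC"
  define \<kappa>' where "\<kappa>' = \<rho> rNC"
  have \<kappa>: "\<kappa> = 1 \<or> \<kappa> = 2" "\<kappa> = 1 \<and> \<kappa>' = 2 \<or> \<kappa> = 2 \<and> \<kappa>' = 1" and dA: "ds F \<kappa> (Suc t) A"
    and dN: "ds F \<kappa>' (\<rho> rTN) ((\<lambda>v. v div q) ` N)"
    using c t unfolding cfg_def \<kappa>_def \<kappa>'_def A_def by auto
  define si where "si = b + 4 * t + 2 + \<kappa>"
  define z where "z = F si"
  define i where "i = b + 4 * z + \<kappa>"
  define X where "X = F i"
  define F1 where "F1 = F(i := 0)"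
  define A' where "A' = {k\<in>A. k div q \<noteq> z}"
  have tn: "t < nsb" using ds_size(1)[OF dA] by simp
  have z: "z < nsb" "z \<in> (\<lambda>k. k div q) ` A" "ds F1 \<kappa> t A'"
    using ds_pop[OF dA \<kappa>(1)] unfolding z_def i_def si_def F1_def A'_def by auto
  obtain v0 where v0: "v0 \<in> C" "v0 div q div q = z" using z(2) unfolding A_def by auto
  interpret st0: bfs_state G D r d ys B C N by fact
  have Cn: "C \<subseteq> {..<n}" using st0.ys_verts st0.ys(2) verts by auto
  then have "v0 < n" using v0(1) by auto
  have zq: "z * q \<le> n"
  proof -
    have "z * q \<le> v0 div q" unfolding v0(2)[symmetric] by (simp add: div_times_less_eq_dividend)
    also have "\<dots> \<le> v0" by simp
    finally show ?thesis using \<open>v0 < n\<close> by simp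
  qed
  have ibd: "i < H" "b \<le> i" "si < H" "b \<le> si"
    unfolding i_def si_def using index_less[OF z(1) \<kappa>(1)] index_less[OF tn \<kappa>(1)] by auto
  have Hw: "H < 2 ^ w" "H < NF" using b_less_H NFw by auto
  have i': "z * 4 + b + \<kappa> = i" "Suc (Suc (t * 4 + b)) + \<kappa> = si" "t * 4 + b + 2 + \<kappa> = si"
    "Suc (Suc (t * 4 + b + \<kappa>)) = si"
    unfolding i_def si_def by auto
  have wbd: "t < 2 ^ w" "t * 4 < 2 ^ w" "t * 4 + b < 2 ^ w" "Suc (Suc (t * 4 + b)) < 2 ^ w" "si < 2 ^ w" "si < NF"
    "z * 4 < 2 ^ w" "z * 4 + b < 2 ^ w" "i < 2 ^ w" "i < NF" "z * q < 2 ^ w"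
    using ibd(1,3) Hw zq len_ge i'(1,3) by linarith+
  have F1far: "F1 j = F j" if "j < b \<or> H \<le> j" for j using that ibd unfolding F1_def by auto
  have tabF: "tab F" using c by (simp add: cfg_def)
  have dN1: "ds F1 \<kappa>' (\<rho> rTN) ((\<lambda>v. v div q) ` N)"
  proof (rule ds_cong[OF dN])
    show "F1 (b + 4 * x + \<kappa>') = F (b + 4 * x + \<kappa>')" for x
      unfolding F1_def i_def using index_neq(1)[OF \<kappa>(2), of z x] by simp
    show "F1 (b + 4 * x + 2 + \<kappa>') = F (b + 4 * x + 2 + \<kappa>')" for x
      unfolding F1_def i_def using index_neq(4)[OF \<kappa>(2), of z x] by simp
  qed
  have bitX: "bit X j \<longleftrightarrow> j < q \<and> z * q + j \<in> A" for j
    using dA z(1) unfolding ds_def X_def i_def by blast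
  \<comment> \<open>The debt has to cover the 37 steps before the loop, 20 reserved for each of at
    most q rounds, and 20 for leaving the loop.\<close>
  define e where "e = 100 * q + 100"
  \<comment> \<open>After j rounds \<open>rX\<close> holds the bitmap of superblock z shifted by j.
    The debt may be open only while \<open>rX\<close> is nonzero, that is, while a later block can
    still pay it.\<close>
  define J where "J \<rho>' F' out' \<tau>' \<longleftrightarrow> (\<exists>j ys' B' C' N'.
      (\<forall>i. i \<notin> {12, 13} \<union> {16..<30} \<longrightarrow> \<rho>' i = \<rho> i) \<and> \<rho>' rTC = t \<and> \<rho>' rK = z * q + j \<and> j \<le> q \<and>
      cfg \<rho>' F' D B' C' N' A' \<and> bfs_state G D r d ys' B' C' N' \<and> out' = o0 @ ys' \<and>
      A' \<subseteq> (\<lambda>v. v div q) ` C' \<and> (\<forall>v\<in>C'. v div q \<in> A' \<or> v div q div q = z) \<and>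
      (\<forall>i. bit (\<rho>' rX) i \<longleftrightarrow> i + j < q \<and> z * q + (i + j) \<in> (\<lambda>v. v div q) ` C') \<and>
      (\<forall>i<j. z * q + i \<notin> (\<lambda>v. v div q) ` C') \<and>
      (\<exists>e'. (e' = 0 \<or> e' = e \<and> \<rho>' rX \<noteq> 0) \<and> \<tau>' + pot (D \<union> B') + 20 * (q - j) + 20 \<le> T + e'))" for \<rho>' F' out' \<tau>'
  have JI: "J \<rho>' F' out' \<tau>'" if "\<forall>i. i \<notin> {12, 13} \<union> {16..<30} \<longrightarrow> \<rho>' i = \<rho> i" "\<rho>' rTC = t"
      "\<rho>' rK = z * q + jj" "jj \<le> q" "cfg \<rho>' F' D BB CC NN A'" "bfs_state G D r d yy BB CC NN" "out' = o0 @ yy"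
      "A' \<subseteq> (\<lambda>v. v div q) ` CC" "\<forall>v\<in>CC. v div q \<in> A' \<or> v div q div q = z"
      "\<forall>i. bit (\<rho>' rX) i \<longleftrightarrow> i + jj < q \<and> z * q + (i + jj) \<in> (\<lambda>v. v div q) ` CC"
      "\<forall>i<jj. z * q + i \<notin> (\<lambda>v. v div q) ` CC" "ee = 0 \<or> ee = e \<and> \<rho>' rX \<noteq> 0"
      "\<tau>' + pot (D \<union> BB) + 20 * (q - jj) + 20 \<le> T + ee" for \<rho>' F' out' \<tau>' jj yy BB CC NN ee
    unfolding J_def
    by (rule exI[of _ jj], rule exI[of _ yy], rule exI[of _ BB], rule exI[of _ CC], rule exI[of _ NN],
        intro conjI, (rule that)+, rule exI[of _ ee], intro conjI, (rule that)+)
  have wit: "\<exists>v i'. v \<in> C' \<and> v div q = z * q + (i' + j) \<and> i' + j < q" if "\<rho>' rX \<noteq> 0"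
    "\<forall>i. bit (\<rho>' rX) i \<longleftrightarrow> i + j < q \<and> z * q + (i + j) \<in> (\<lambda>v. v div q) ` C'" for \<rho>' :: "nat \<Rightarrow> nat" and j C'
  proof -
    obtain i where "bit (\<rho>' rX) i" using \<open>\<rho>' rX \<noteq> 0\<close> by (auto simp: bit_eq_iff)
    then show ?thesis using that(2) by auto
  qed
  \<comment> \<open>The clock must be bounded even with the debt open. Then \<open>rX\<close> has a
    bit left, hence C' has a vertex, whose weight is part of the potential and is at least
    e.\<close>
  have Jbound: "\<tau>' + 20 \<le> T" if JJ: "J \<rho>' F' out' \<tau>'" for \<rho>' F' out' \<tau>'
  proof -
    obtain j ys' B' C' N' e' where j: "bfs_state G D r d ys' B' C' N'"
      "\<forall>i. bit (\<rho>' rX) i \<longleftrightarrow> i + j < q \<and> z * q + (i + j) \<in> (\<lambda>v. v div q) ` C'"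
      "e' = 0 \<or> e' = e \<and> \<rho>' rX \<noteq> 0" "\<tau>' + pot (D \<union> B') + 20 * (q - j) + 20 \<le> T + e'"
      using JJ[unfolded J_def] by (elim exE conjE) (rule that; assumption)
    interpret st': bfs_state G D r d ys' B' C' N' by (rule j(1))
    show ?thesis
    proof (cases "e' = 0")
      case False
      then have "\<rho>' rX \<noteq> 0" "e' = e" using j(3) by auto
      then obtain v where v: "v \<in> C'" using wit[of \<rho>' j C', OF _ j(2)] by blast
      then have "v < n" using st'.ys_verts st'.ys(2) verts by auto
      moreover have "v \<notin> D \<union> B'" using v st'.disj st'.ys(2) by auto
      ultimately have "weight v \<le> pot (D \<union> B')" using pot_less[of "D \<union> B'" UNIV v] by simp
      moreover have "e \<le> weight v" using q1 unfolding e_def weight_def by simp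
      ultimately show ?thesis using j(4) \<open>e' = e\<close> by linarith
    qed (use j(4) in simp)
  qed
  have tabF1: "tab F1" "\<And>v. col F1 v = col F v" using tab_cong[OF tabF F1far] by auto
  note sD = statD[OF cfg_stat(1)[OF c]]
  have cfg1: "cfg (\<rho>(12 := t)) F1 D B C N A'"
    using c z(3) dN1 tabF1 unfolding cfg_def \<kappa>_def \<kappa>'_def A_def by (auto simp: stat_def geo_def)
  have Xn: "X \<noteq> 0" using ds_zero_iff[OF dA z(1)] z(2) unfolding X_def i_def by simp
  have CA: "\<forall>v\<in>C. v div q \<in> A' \<or> v div q div q = z" unfolding A'_def A_def by auto
  show ?thesis unfolding pop_def
    apply (rule awp_seqs awp_seqs1 | (rule awp_ops, (simp add: t sD wbd \<kappa>_def[symmetric] i' z_def[symmetric] X_def[symmetric]; fail)+))+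
    apply (rule awp_While[where J = J and T = T])
    apply (fold F1_def)
      apply (rule JI[of _ 0 _ B C N ys _ e])
                  apply simp_all[4]
              apply (simp add: cfg1, rule st, rule refl)
           apply (simp add: A'_def A_def[symmetric])
          apply (rule CA)
         apply (simp add: bitX A_def[symmetric])
        apply simp
       apply (simp add: Xn)
      subgoal using T by (simp add: e_def)
  proof -
    show "okop (Const 0) \<and> okop (V rX)" by simp
    show "\<tau>' \<le> T" if "J \<rho>' F' out' \<tau>'" for \<rho>' F' out' \<tau>' using Jbound[OF that] by simp
  next
    fix \<rho>1 F1 out1 \<tau>1
    assume J: "J \<rho>1 F1 out1 \<tau>1" and t: "test_val Less (opv \<rho>1 (Const 0)) (opv \<rho>1 (V rX))"
    obtain j ys1 B1 C1 N1 e1 where j: "\<forall>i. i \<notin> {12, 13} \<union> {16..<30} \<longrightarrow> \<rho>1 i = \<rho> i" "\<rho>1 rTC = t"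
      "\<rho>1 rK = z * q + j" "j \<le> q" "cfg \<rho>1 F1 D B1 C1 N1 A'" "bfs_state G D r d ys1 B1 C1 N1" "out1 = o0 @ ys1"
      "A' \<subseteq> (\<lambda>v. v div q) ` C1" "\<forall>v\<in>C1. v div q \<in> A' \<or> v div q div q = z"
      "\<forall>i. bit (\<rho>1 rX) i \<longleftrightarrow> i + j < q \<and> z * q + (i + j) \<in> (\<lambda>v. v div q) ` C1"
      "\<forall>i<j. z * q + i \<notin> (\<lambda>v. v div q) ` C1"
      "e1 = 0 \<or> e1 = e \<and> \<rho>1 rX \<noteq> 0" "\<tau>1 + pot (D \<union> B1) + 20 * (q - j) + 20 \<le> T + e1"
      using J[unfolded J_def] by (elim exE conjE) (rule that; assumption)
    interpret st1: bfs_state G D r d ys1 B1 C1 N1 by (rule j(6))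
    define X1 where "X1 = \<rho>1 rX"
    have X1: "X1 \<noteq> 0" using t unfolding X1_def by simp
    obtain v1 i1 where v1: "v1 \<in> C1" "v1 div q = z * q + (i1 + j)" "i1 + j < q"
      using wit[of \<rho>1 j C1, OF _ j(10)] X1 unfolding X1_def by blast
    have jq: "j < q" using v1(3) by simp
    have v1n: "v1 < n" using v1(1) st1.ys_verts st1.ys(2) verts by auto
    have kn: "z * q + j < n"
    proof -
      have "z * q + j \<le> v1 div q" using v1(2) by simp
      also have "\<dots> \<le> v1" by simp
      finally show ?thesis using v1n by simp
    qed
    have wj: "Suc (z * q + j) < 2 ^ w" "z * q + j + 1 < 2 ^ w" using kn len_ge by auto
    define k where "k = z * q + j"
    have Xb: "bit X1 i \<longleftrightarrow> i + j < q \<and> z * q + (i + j) \<in> (\<lambda>v. v div q) ` C1" for i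
      using j(10) unfolding X1_def by blast
    have X2: "bit (X1 div 2) i \<longleftrightarrow> i + Suc j < q \<and> z * q + (i + Suc j) \<in> (\<lambda>v. v div q) ` C1" for i
      using Xb[of "Suc i"] by (simp add: bit_Suc)
    have X0: "X1 mod 2 = 1 \<longleftrightarrow> k \<in> (\<lambda>v. v div q) ` C1" using Xb[of 0] jq unfolding k_def by (simp add: bit_0 odd_iff_mod_2_eq_one)
    show "awp (seqs [
       Op Mod (Cell rA) (V rX) (Const 2), If Eq (V rA) (Const 1) expand_block (seqs []),
       Op Div (Cell rX) (V rX) (Const 2), Op Add (Cell rK) (V rK) (Const 1)]) J \<rho>1 F1 out1 (\<tau>1 + 1)"
      apply (rule awp_seqs awp_seqs1 | (rule awp_ops, (simp add: X1_def[symmetric]; fail)+))+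
      apply (rule awp_If)
        apply simp
      subgoal premises pr
      proof -
        have kC: "k \<in> (\<lambda>v. v div q) ` C1" using pr X0 by simp
        then obtain v where v: "v \<in> C1" "v div q = k" by auto
        have vn: "v < n" using v(1) st1.ys_verts st1.ys(2) verts by auto
        have kq: "k * q < n"
        proof -
          have "k * q \<le> v" unfolding v(2)[symmetric] by (simp add: div_times_less_eq_dividend)
          then show ?thesis using vn by simp
        qed
        show ?thesis unfolding j(7)
          apply (rule awp_expand_block[where k = k and ys = ys1 and r = r and d = d and D = D and B = B1
                and C = C1 and N = N1 and A = A'])
          using j(3,5,6) kq apply (simp_all add: k_def)[4]
          subgoal premises pr3 for \<rho>' F' \<tau>' ys' N'
          proof -
            let ?B = "B1 \<union> {v \<in> C1. v div q = k}" and ?C = "{v \<in> C1. v div q \<noteq> k}"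
            have eqs: "\<rho>' rX = X1" "\<rho>' rK = z * q + j" "\<rho>' rTC = t" using pr3(1) j(2,3) by (simp_all add: X1_def)
            have rho: "\<forall>i. i \<notin> {12, 13} \<union> {16..<30} \<longrightarrow> \<rho>' i = \<rho> i" using pr3(1) j(1) by auto
            have img: "(\<lambda>v. v div q) ` ?C = (\<lambda>v. v div q) ` C1 - {k}" by auto
            have kz: "k div q = z" using jq unfolding k_def by simp
            have "k \<notin> A'" unfolding A'_def using kz by simp
            then have A'': "A' \<subseteq> (\<lambda>v. v div q) ` ?C" using j(8) unfolding img by auto
            have bits: "bit (X1 div 2) i \<longleftrightarrow> i + Suc j < q \<and> z * q + (i + Suc j) \<in> (\<lambda>v. v div q) ` ?C" for i
              unfolding X2 img k_def by auto
            have low: "\<forall>i<Suc j. z * q + i \<notin> (\<lambda>v. v div q) ` ?C"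
              using j(11) unfolding img k_def by (auto simp: less_Suc_eq)
            have "v \<notin> D \<union> B1" using v(1) st1.disj st1.ys(2) by auto
            \<comment> \<open>One vertex of the block suffices: its weight pays for the expansion,
              for a debt that is still open, and for the rest of the round.\<close>
            then have "pot (D \<union> ?B) + weight v \<le> pot (D \<union> B1)"
              using v vn by (intro pot_less) auto
            moreover have "weight v = 1000 * q + 130 * block_deg k" unfolding weight_def v(2) ..
            moreover have "e1 \<le> 100 * q + 100" using j(12) unfolding e_def by auto
            moreover have "q - j = Suc (q - Suc j)" using jq by simp
            ultimately have time: "\<tau>' + 1 + 1 + pot (D \<union> ?B) + 20 * (q - Suc j) + 20 \<le> T"
              using pr3(4) j(13) q1 by simp
            show ?thesis
              apply (rule awp_seqs awp_seqs1 | (rule awp_ops, (simp add: eqs wj; fail)+))+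
              apply (rule JI[of _ "Suc j" _ ?B ?C N' ys' _ 0])
                          apply (use rho in simp)
                         apply (simp_all add: eqs)[2]
                       apply (use jq in simp)
                      apply (use pr3(2) in simp)
                     apply (rule pr3(3))
                    apply (rule refl)
                   apply (rule A'')
                  apply (use j(9) in blast)
                 apply (simp add: bits del: add_Suc_right)
                apply (rule low)
               apply simp
              using time apply simp
              done
          qed
          done
      qed
      subgoal premises pr
      proof -
        have kC: "k \<notin> (\<lambda>v. v div q) ` C1" using pr X0 by simp
        have low: "\<forall>i<Suc j. z * q + i \<notin> (\<lambda>v. v div q) ` C1"
          using j(11) kC unfolding k_def by (auto simp: less_Suc_eq)
        \<comment> \<open>Bit 0 is clear but the bitmap is not zero, so another bit remains and the
          debt may stay open.\<close>
        have "X1 div 2 \<noteq> 0"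
        proof -
          have "v1 div q \<in> (\<lambda>v. v div q) ` C1" using v1(1) by simp
          then have "i1 \<noteq> 0" using kC v1(2) unfolding k_def by (cases i1) auto
          then obtain i2 where "i1 = Suc i2" by (cases i1) auto
          then have "bit (X1 div 2) i2" using v1 X2[of i2] by force
          then show ?thesis by (rule bit_nonzero)
        qed
        moreover have "q - j = Suc (q - Suc j)" using jq by simp
        ultimately show ?thesis
          apply -
          apply (rule awp_Skip)
          apply (rule awp_seqs awp_seqs1 | (rule awp_ops, (simp add: X1_def[symmetric] j(3) wj; fail)+))+
          apply (rule JI[of _ "Suc j" _ B1 C1 N1 ys1 _ e1])
                      apply (use j(1) in simp)
                     apply (simp_all add: j(2,3))[2]
                   apply (use jq in simp)
                  apply (use j(5) in simp)
                 apply (rule j(6))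
                apply (rule j(7))
               apply (rule j(8))
              apply (rule j(9))
             apply (simp add: X2 del: add_Suc_right)
            apply (rule low)
           apply (use j(12) in auto)[1]
          using j(13) apply simp
          done
      qed
      done
  next
    fix \<rho>1 F1 out1 \<tau>1
    assume J: "J \<rho>1 F1 out1 \<tau>1" and t: "\<not> test_val Less (opv \<rho>1 (Const 0)) (opv \<rho>1 (V rX))"
    obtain j ys1 B1 C1 N1 e1 where j: "\<forall>i. i \<notin> {12, 13} \<union> {16..<30} \<longrightarrow> \<rho>1 i = \<rho> i" "\<rho>1 rTC = t"
      "\<rho>1 rK = z * q + j" "j \<le> q" "cfg \<rho>1 F1 D B1 C1 N1 A'" "bfs_state G D r d ys1 B1 C1 N1" "out1 = o0 @ ys1"
      "A' \<subseteq> (\<lambda>v. v div q) ` C1" "\<forall>v\<in>C1. v div q \<in> A' \<or> v div q div q = z"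
      "\<forall>i. bit (\<rho>1 rX) i \<longleftrightarrow> i + j < q \<and> z * q + (i + j) \<in> (\<lambda>v. v div q) ` C1"
      "\<forall>i<j. z * q + i \<notin> (\<lambda>v. v div q) ` C1"
      "e1 = 0 \<or> e1 = e \<and> \<rho>1 rX \<noteq> 0" "\<tau>1 + pot (D \<union> B1) + 20 * (q - j) + 20 \<le> T + e1"
      using J[unfolded J_def] by (elim exE conjE) (rule that; assumption)
    interpret st1: bfs_state G D r d ys1 B1 C1 N1 by (rule j(6))
    have X0: "\<rho>1 rX = 0" using t by simp
    \<comment> \<open>Superblock z is exhausted: any vertex of it left in C1 would leave a bit in
      \<open>rX\<close> or contradict the blocks already passed.\<close>
    have "v div q \<in> A'" if v: "v \<in> C1" for v
    proof (rule ccontr)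
      assume "v div q \<notin> A'"
      then have "v div q div q = z" using j(9) v by auto
      then have k: "v div q = z * q + v div q mod q" by (metis div_mult_mod_eq)
      define i where "i = v div q mod q"
      have iq: "i < q" unfolding i_def using q1 by simp
      have mem: "z * q + i \<in> (\<lambda>v. v div q) ` C1" using v k unfolding i_def by (metis imageI)
      then have "\<not> i < j" using j(11) by blast
      then have "bit (\<rho>1 rX) (i - j)" using j(10) mem iq by auto
      then show False using X0 by simp
    qed
    then have A1: "A' = (\<lambda>v. v div q) ` C1" using j(8) by auto
    have time: "\<tau>1 + 20 + pot (D \<union> B1) \<le> T" using j(12,13) X0 by auto
    have rho: "\<forall>i. i \<notin> {10..<14} \<union> {16..<30} \<longrightarrow> \<rho>1 i = \<rho> i" using j(1) by auto
    have c1: "cfg \<rho>1 F1 D B1 C1 N1 ((\<lambda>v. v div q) ` C1)" using j(5) A1 by simp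
    show "awp (seqs [If Eq (V rTC) (Const 0) swap (seqs [])]) Q \<rho>1 F1 out1 (\<tau>1 + 1)"
      unfolding j(7)
      apply (rule awp_seqs1)
      apply (rule awp_If)
        apply simp
      subgoal premises pr
      proof -
        have "\<rho>1 rTC = 0" using pr by simp
        then have d0: "ds F1 (\<rho>1 rCC) 0 ((\<lambda>v. v div q) ` C1)" using c1 unfolding cfg_def by simp
        have C0: "C1 = {}" using ds_0[OF d0] by simp
        have c2: "cfg (\<rho>1(23 := \<rho>1 rCC, rCC := \<rho>1 rNC, rNC := \<rho>1 rCC, rTC := \<rho>1 rTN, rTN := 0)) F1 D B1 N1 {}
            ((\<lambda>v. v div q) ` N1)"
          using c1 d0 unfolding C0 cfg_def by (auto simp: stat_def geo_def)
        show ?thesis unfolding swap_def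
          apply (rule awp_seqs awp_seqs1 | (rule awp_ops, (simp; fail)+))+
          apply (rule Q[where C' = N1 and N' = "{}" and B' = B1 and d' = "Suc d"])
          using rho c2 st1.level[OF C0] time by auto
      qed
      subgoal premises pr
      proof -
        \<comment> \<open>A nonempty stack means a nonempty level, so the condition relating C' and
          N' holds vacuously.\<close>
        have "C1 \<noteq> {}"
        proof
          assume "C1 = {}"
          then have "ds F1 (\<rho>1 rCC) (\<rho>1 rTC) {}" using c1 unfolding cfg_def by simp
          then show False using ds_empty pr by simp
        qed
        then show ?thesis
          apply -
          apply (rule awp_Skip)
          apply (rule Q[where C' = C1 and N' = N1 and B' = B1 and d' = d])
          using rho c1 j(6) time by auto
      qed
      done
  qed
qed

end

text \<open>The root is discovered as if it belonged to a next level, and \<open>swap\<close> turns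
  this level into level 0.\<close>

definition attempt :: prog where
  "attempt = seqs [getcol rA rR, If Eq (V rA) (Const 0)
     (seqs [Move (Cell rU) (V rR), discover, swap, search]) (seqs [])]"

definition main :: prog where
  "main = seqs [Move (Cell rCC) (Const 1), Move (Cell rNC) (Const 2), Move (Cell rTC) (Const 0), Move (Cell rTN) (Const 0),
     attempt, Move (Cell rI) (Const 0),
     While Less (V rI) (V rN) (seqs [Move (Cell rR) (V rI), attempt, Op Add (Cell rI) (V rI) (Const 1)])]"

section \<open>Whole searches and their restarts\<close>

context bfs_ram
begin

text \<open>An empty stack of the current level ends the search only because of \<open>CN\<close>:
  \<open>pop\<close> changes to the next level as soon as the current one runs out.\<close>

lemma awp_search:
  assumes c: "cfg \<rho> F D B C N ((\<lambda>v. v div q) ` C)" and st: "bfs_state G D r d ys B C N" and CN: "C = {} \<Longrightarrow> N = {}"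
    and T: "\<tau> + pot (D \<union> B) \<le> T"
    and Q: "\<And>\<rho>' F' \<tau>' d' ys' B'. (\<forall>i. i \<notin> {10..<14} \<union> {16..<30} \<longrightarrow> \<rho>' i = \<rho> i) \<Longrightarrow>
      cfg \<rho>' F' D B' {} {} {} \<Longrightarrow> bfs_state G D r d' ys' B' {} {} \<Longrightarrow>
      \<tau>' + pot (D \<union> B') \<le> T + 1 \<Longrightarrow> Q \<rho>' F' (o0 @ ys') \<tau>'"
  shows "awp search Q \<rho> F (o0 @ ys) \<tau>"
proof -
  define J where "J \<rho>' F' out' \<tau>' \<longleftrightarrow> (\<exists>d' ys' B' C' N'. (\<forall>i. i \<notin> {10..<14} \<union> {16..<30} \<longrightarrow> \<rho>' i = \<rho> i) \<and>
      cfg \<rho>' F' D B' C' N' ((\<lambda>v. v div q) ` C') \<and> bfs_state G D r d' ys' B' C' N' \<and> (C' = {} \<longrightarrow> N' = {}) \<and>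
      out' = o0 @ ys' \<and> \<tau>' + pot (D \<union> B') \<le> T)" for \<rho>' F' out' \<tau>'
  have JI: "J \<rho>' F' (o0 @ ys') \<tau>'" if "\<forall>i. i \<notin> {10..<14} \<union> {16..<30} \<longrightarrow> \<rho>' i = \<rho> i"
      "cfg \<rho>' F' D B' C' N' ((\<lambda>v. v div q) ` C')" "bfs_state G D r d' ys' B' C' N'" "C' = {} \<longrightarrow> N' = {}"
      "\<tau>' + pot (D \<union> B') \<le> T" for \<rho>' F' \<tau>' d' ys' B' C' N'
    unfolding J_def
    by (rule exI[of _ d'], rule exI[of _ ys'], rule exI[of _ B'], rule exI[of _ C'], rule exI[of _ N'],
        intro conjI, (rule that refl)+)
  show ?thesis unfolding search_def
  proof (rule awp_While[where J = J and T = T])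
    show "J \<rho> F (o0 @ ys) \<tau>" using c st CN T by (intro JI) auto
    show "okop (Const 0) \<and> okop (V rTC)" by simp
    show "\<tau>' \<le> T" if "J \<rho>' F' out' \<tau>'" for \<rho>' F' out' \<tau>' using that unfolding J_def by auto
  next
    fix \<rho>1 F1 out1 \<tau>1
    assume J: "J \<rho>1 F1 out1 \<tau>1"
    obtain d1 ys1 B1 C1 N1 where j: "\<forall>i. i \<notin> {10..<14} \<union> {16..<30} \<longrightarrow> \<rho>1 i = \<rho> i"
      "cfg \<rho>1 F1 D B1 C1 N1 ((\<lambda>v. v div q) ` C1)" "bfs_state G D r d1 ys1 B1 C1 N1" "C1 = {} \<longrightarrow> N1 = {}"
      "out1 = o0 @ ys1" "\<tau>1 + pot (D \<union> B1) \<le> T"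
      using J[unfolded J_def] by (elim exE conjE) (rule that; assumption)
    show "awp pop J \<rho>1 F1 out1 (\<tau>1 + 1)" if t: "test_val Less (opv \<rho>1 (Const 0)) (opv \<rho>1 (V rTC))"
      unfolding j(5)
    proof (rule awp_pop[OF j(2,3)])
      show "0 < \<rho>1 rTC" using t by simp
      \<comment> \<open>The additional step is the loop test; \<open>pop\<close> makes up for
        it.\<close>
      show "\<tau>1 + 1 + pot (D \<union> B1) \<le> T + 1" using j(6) by simp
      fix \<rho>' F' \<tau>' d' ys' B' C' N'
      assume "\<forall>i. i \<notin> {10..<14} \<union> {16..<30} \<longrightarrow> \<rho>' i = \<rho>1 i"
        "cfg \<rho>' F' D B' C' N' ((\<lambda>v. v div q) ` C')" "bfs_state G D r d' ys' B' C' N'" "C' = {} \<Longrightarrow> N' = {}"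
        "\<tau>' + pot (D \<union> B') \<le> T"
      then show "J \<rho>' F' (o0 @ ys') \<tau>'" using j(1) by (intro JI) auto
    qed
    show "Q \<rho>1 F1 out1 (\<tau>1 + 1)" if t: "\<not> test_val Less (opv \<rho>1 (Const 0)) (opv \<rho>1 (V rTC))"
    proof -
      have "\<rho>1 rTC = 0" using t by simp
      then have "ds F1 (\<rho>1 rCC) 0 ((\<lambda>v. v div q) ` C1)" using j(2) unfolding cfg_def by simp
      then have C0: "C1 = {}" using ds_0 by blast
      then have N0: "N1 = {}" using j(4) by simp
      show ?thesis unfolding j(5)
        using Q[OF j(1), of F1 B1 d1 ys1 "\<tau>1 + 1"] j(2,3,6) unfolding C0 N0 by simp
    qed
  qed
qed

text \<open>Finished vertices only have to be nonwhite, so no colour is reset between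
  searches.\<close>

lemma cfg_idle: "cfg \<rho> F D B {} {} {} \<Longrightarrow> cfg \<rho> F (D \<union> B) {} {} {} {}"
  unfolding cfg_def by simp

lemma awp_attempt:
  assumes c: "cfg \<rho> F D {} {} {} {}" and D: "D \<subseteq> pverts G" "\<And>v u. v \<in> D \<Longrightarrow> (v, u) \<in> parcs G \<Longrightarrow> u \<in> D"
    and r: "\<rho> rR = r" "r < n" and T: "\<tau> + 200 + pot D \<le> T"
    and Q: "\<And>\<rho>' F' out' \<tau>' D'. (\<forall>i. i \<notin> {10..<14} \<union> {16..<30} \<longrightarrow> \<rho>' i = \<rho> i) \<Longrightarrow>
      cfg \<rho>' F' D' {} {} {} {} \<Longrightarrow> D' \<subseteq> pverts G \<Longrightarrow> (\<And>v u. v \<in> D' \<Longrightarrow> (v, u) \<in> parcs G \<Longrightarrow> u \<in> D') \<Longrightarrow>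
      r \<in> D \<and> D' = D \<and> out' = out \<or> r \<in> D' \<and> (\<exists>ys. bfs_from G D r ys \<and> out' = out @ ys \<and> D' = D \<union> set ys) \<Longrightarrow>
      \<tau>' + pot D' \<le> T \<Longrightarrow> Q \<rho>' F' out' \<tau>'"
  shows "awp attempt Q \<rho> F out \<tau>"
  unfolding attempt_def
  apply (rule awp_seqs)
  apply (rule awp_getcol[where v = r], (use cfg_stat[OF c] r in \<open>simp; fail\<close>)+)
  apply (rule awp_seqs1)
  apply (rule awp_If)
    apply simp
  subgoal premises pr for a e
  proof -
    have rD: "r \<notin> D" using pr c r(2) unfolding cfg_def by simp
    have st: "bfs_state G D r 0 [r] {} {r} {}"
      using bfs_state_init[OF wf D] r(2) rD verts by simp
    have d1: "ds F (\<rho> rCC) (\<rho> rTC) {}" and d2: "ds F (\<rho> rNC) (\<rho> rTN) {}"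
      and cc: "\<rho> rCC = 1 \<and> \<rho> rNC = 2 \<or> \<rho> rCC = 2 \<and> \<rho> rNC = 1" using c unfolding cfg_def by auto
    have tc: "\<rho> rTC = 0" using ds_empty[OF d1] .
    show ?thesis
      apply (rule awp_seqs awp_seqs1 | (rule awp_ops, (simp add: r; fail)+))+
      apply (rule awp_discover[where u = r and An = "{}" and Ac = "{}" and tn = "\<rho> rTN" and tc = "\<rho> rTC"
            and nc = "\<rho> rNC" and cc = "\<rho> rCC"])
      using cfg_stat[OF c] r cc d1 d2 apply simp_all[9]
      subgoal premises p2 for \<rho>' t' G' \<tau>'
      proof -
        have eqs: "\<rho>' rCC = \<rho> rCC" "\<rho>' rNC = \<rho> rNC" "\<rho>' 4 = \<rho> 4" "\<rho>' 5 = \<rho> 5" "\<rho>' 6 = \<rho> 6" "\<rho>' 7 = \<rho> 7" "\<rho>' 8 = \<rho> 8"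
          "\<rho>' 9 = \<rho> 9" using p2(1) by simp_all
        let ?\<rho> = "\<rho>'(23 := \<rho> rCC, rCC := \<rho> rNC, rNC := \<rho> rCC, rTC := t', rTN := 0)"
        have "stat ?\<rho>" using c eqs unfolding cfg_def by (auto simp: stat_def geo_def)
        then have c2: "cfg ?\<rho> G' D {} {r} {} ((\<lambda>v. v div q) ` {r})"
          using c cc p2(3-6) tc rD unfolding cfg_def by auto
        have fr: "\<forall>i. i \<notin> {10..<14} \<union> {16..<30} \<longrightarrow> ?\<rho> i = \<rho> i" using p2(1) by auto
        show ?thesis unfolding swap_def
          apply (rule awp_seqs)
          apply (rule awp_seqs awp_seqs1 | (rule awp_ops, (simp add: eqs p2(2); fail)+))+
          \<comment> \<open>\<open>search\<close> may exceed its bound by one, for the last loop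
            test, so it is given less than T.\<close>
          apply (rule awp_search[OF c2 st, where T = "T - 5"])
            apply simp
          using T p2(7) apply simp
          subgoal premises p3 for \<rho>2 F2 \<tau>2 d2 ys2 B2
          proof -
            interpret st2: bfs_state G D r d2 ys2 B2 "{}" "{}" by (rule p3(3))
            have B2: "set ys2 = B2" using st2.ys(2) by simp
            have c3: "cfg \<rho>2 F2 (D \<union> set ys2) {} {} {} {}" using cfg_idle[OF p3(2)] B2 by simp
            have fr2: "\<forall>i. i \<notin> {10..<14} \<union> {16..<30} \<longrightarrow> \<rho>2 i = \<rho> i" using p3(1) fr by metis
            show ?thesis
              apply (rule Q[OF fr2 c3])
                 apply (use D(1) st2.ys_verts in simp)
                apply (rule st2.finish(2)[OF refl refl]; assumption)
               apply (rule disjI2)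
              using st2.root(3) B2 st2.finish(1) apply auto[1]
              using p3(4) T B2 by simp
          qed
          done
      qed
      done
  qed
  subgoal premises pr for a e
  proof -
    have rD: "r \<in> D" using pr c r(2) unfolding cfg_def by simp
    show ?thesis
      apply (rule awp_Skip)
      apply (rule Q[where D' = D])
      using c D rD T by auto
  qed
  done

lemma awp_main:
  assumes stat: "stat \<rho>" and F: "\<And>j. j < q \<Longrightarrow> F j = 3 ^ j" "\<And>k. b \<le> k \<Longrightarrow> k < NF \<Longrightarrow> F k = 0" and r: "\<rho> rR = s"
    and Q: "\<And>\<rho>' F' out' \<tau>'. bfs_order G s out' \<Longrightarrow> \<tau>' \<le> \<tau> + pot {} + 210 * n + 210 \<Longrightarrow> Q \<rho>' F' out' \<tau>'"
  shows "awp main Q \<rho> F [] \<tau>"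
proof -
  let ?\<rho> = "\<rho>(rCC := 1, rNC := 2, rTC := 0, rTN := 0)"
  define T where "T = \<tau> + pot {} + 210 * n + 208"
  have tab: "tab F" using F b_less_H unfolding tab_def by simp
  have col: "col F v = 0" if "v < n" for v
    using F(2)[of "H + v div q"] block_less(1)[OF that] b_less_H unfolding col_def by simp
  have d: "ds F \<kappa> 0 {}" if "\<kappa> = 1 \<or> \<kappa> = 2" for \<kappa>
  proof -
    have "F (b + 4 * z + \<kappa>) = 0" if "z < nsb" for z
      using index_less[OF that \<open>\<kappa> = 1 \<or> \<kappa> = 2\<close>] b_less_H by (intro F(2)) auto
    then show ?thesis unfolding ds_def by simp
  qed
  have "stat ?\<rho>" using stat by simp
  then have c: "cfg ?\<rho> F {} {} {} {} {}" unfolding cfg_def using tab col d[of 1] d[of 2] by auto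
  \<comment> \<open>\<open>bfs_restarts\<close> describes a suffix of the order. The output so far
    is therefore characterised by the suffixes that complete it to a BFS order.\<close>
  define J where "J \<rho>' F' out' \<tau>' \<longleftrightarrow> (\<exists>i D. \<rho>' rI = i \<and> i \<le> n \<and> cfg \<rho>' F' D {} {} {} {} \<and> D \<subseteq> pverts G \<and>
      (\<forall>v u. v \<in> D \<longrightarrow> (v, u) \<in> parcs G \<longrightarrow> u \<in> D) \<and> {..<i} \<subseteq> D \<and>
      (\<forall>zs. bfs_restarts G D zs \<longrightarrow> bfs_order G s (out' @ zs)) \<and> \<tau>' + pot D + 210 * (n - i) \<le> T)" for \<rho>' F' out' \<tau>'
  have JI: "J \<rho>' F' out' \<tau>'" if "\<rho>' rI = i" "i \<le> n" "cfg \<rho>' F' D {} {} {} {}" "D \<subseteq> pverts G"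
      "\<forall>v u. v \<in> D \<longrightarrow> (v, u) \<in> parcs G \<longrightarrow> u \<in> D" "{..<i} \<subseteq> D"
      "\<forall>zs. bfs_restarts G D zs \<longrightarrow> bfs_order G s (out' @ zs)" "\<tau>' + pot D + 210 * (n - i) \<le> T" for \<rho>' F' out' \<tau>' i D
    unfolding J_def by (rule exI[of _ i], rule exI[of _ D], intro conjI, (rule that)+)
  show ?thesis unfolding main_def
    apply (rule awp_seqs awp_seqs1 | (rule awp_ops, (simp; fail)+))+
    apply (rule awp_attempt[OF c[unfolded One_nat_def], where T = "\<tau> + 4 + 200 + pot {}" and r = s])
         apply (simp_all add: r s)[5]
    subgoal premises p for \<rho>1 F1 out1 \<tau>1 D1
    proof -
      obtain ys where ys: "bfs_from G {} s ys" "out1 = ys" "D1 = set ys" using p(5) by auto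
      have ord: "\<forall>zs. bfs_restarts G D1 zs \<longrightarrow> bfs_order G s (out1 @ zs)"
        unfolding bfs_order_def using ys by blast
      show ?thesis
        apply (rule awp_seqs awp_seqs1 | (rule awp_ops, (simp; fail)+))+
        apply (rule awp_While[where J = J and T = T])
            apply (rule JI[of _ 0 _ D1])
                   apply (simp, simp)
                 apply (use p(2) in simp)
                apply (rule p(3))
               apply (use p(4) in blast)
              apply simp
             apply (rule ord)
        using p(6) apply (simp add: T_def)
           apply simp
          apply (auto simp: J_def)[1]
        subgoal premises p2 for \<rho>2 F2 out2 \<tau>2
        proof -
          obtain i D where j: "\<rho>2 rI = i" "i \<le> n" "cfg \<rho>2 F2 D {} {} {} {}" "D \<subseteq> pverts G"
            "\<forall>v u. v \<in> D \<longrightarrow> (v, u) \<in> parcs G \<longrightarrow> u \<in> D" "{..<i} \<subseteq> D"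
            "\<forall>zs. bfs_restarts G D zs \<longrightarrow> bfs_order G s (out2 @ zs)" "\<tau>2 + pot D + 210 * (n - i) \<le> T"
            using p2(1)[unfolded J_def] by (elim exE conjE) (rule that; assumption)
          have i: "i < n" using p2(2) j(1) statD[OF cfg_stat(1)[OF j(3)]] by simp
          have iw: "Suc i < 2 ^ w" using i len_ge by simp
          show ?thesis
            apply (rule awp_seqs awp_seqs1 | (rule awp_ops, (simp add: j(1); fail)+))+
            apply (rule awp_attempt[where D = D and T = "\<tau>2 + 2 + 200 + pot D" and r = i])
                  apply (use j(3) in simp)
                 apply (rule j(4))
                apply (use j(5) in blast)
               apply (simp add: i)
              apply (simp add: i)
             apply simp
            subgoal premises p3 for \<rho>3 F3 out3 \<tau>3 D3
            proof -
              have e: "\<rho>3 rI = i" using p3(1) j(1) by simp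
              have iD: "i \<in> D3" "D \<subseteq> D3" using p3(5) by auto
              have "{..<Suc i} \<subseteq> D3" using j(6) iD by (auto simp: less_Suc_eq)
              moreover have "\<forall>zs. bfs_restarts G D3 zs \<longrightarrow> bfs_order G s (out3 @ zs)"
                using p3(5)
              proof (elim disjE conjE exE)
                assume "D3 = D" "out3 = out2" then show ?thesis using j(7) by simp
              next
                fix zs assume "bfs_from G D i zs" "out3 = out2 @ zs" "D3 = D \<union> set zs"
                then show ?thesis using j(7) bfs_restarts.restart by auto
              qed
              moreover have "n - i = Suc (n - Suc i)" using i by simp
              ultimately show ?thesis
                apply -
                apply (rule awp_seqs awp_seqs1 | (rule awp_ops, (simp add: e iw; fail)+))+
                apply (rule JI[of _ "Suc i" _ D3])
                       apply simp
                using i apply simp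
                using p3(2) apply simp
                using p3(3) apply simp
                using p3(4) apply blast
                  apply assumption
                 apply assumption
                using p3(6) j(8) apply simp
                done
            qed
            done
        qed
        subgoal premises p2 for \<rho>2 F2 out2 \<tau>2
        proof -
          obtain i D where j: "\<rho>2 rI = i" "i \<le> n" "cfg \<rho>2 F2 D {} {} {} {}" "D \<subseteq> pverts G"
            "\<forall>v u. v \<in> D \<longrightarrow> (v, u) \<in> parcs G \<longrightarrow> u \<in> D" "{..<i} \<subseteq> D"
            "\<forall>zs. bfs_restarts G D zs \<longrightarrow> bfs_order G s (out2 @ zs)" "\<tau>2 + pot D + 210 * (n - i) \<le> T"
            using p2(1)[unfolded J_def] by (elim exE conjE) (rule that; assumption)
          have "i = n" using p2(2) j(1,2) statD[OF cfg_stat(1)[OF j(3)]] by simp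
          then have "D = pverts G" using j(4,6) verts by auto
          then have "bfs_restarts G D []" by (rule bfs_restarts.finished)
          then have "bfs_order G s out2" using j(7) by fastforce
          then show ?thesis using j(8) by (intro Q) (auto simp: T_def)
        qed
        done
    qed
    done
qed

end

section \<open>Initialisation\<close>

text \<open>The word length is not part of the input; it is found by doubling 1 until it overflows
  to 0. L is the length of \<open>or (n + 1) 524288\<close>: as \<open>524288 = 2 ^ 19\<close>, this
  makes L at least 20, and it makes n smaller than \<open>2 ^ L\<close>.\<close>

definition init :: prog where
  "init = seqs [Read (Cell rN) (Const 0), Read (Cell rR) (Const 1),
     Op Add (Cell 23) (V rN) (Const 1), Op Or (Cell 23) (V 23) (Const 524288), Move (Cell 24) (Const 0),
     While Less (Const 0) (V 23) (seqs [Op Div (Cell 23) (V 23) (Const 2), Op Add (Cell 24) (V 24) (Const 1)]),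
     Move (Cell 23) (Const 1), Move (Cell 25) (Const 0),
     While Less (Const 0) (V 23) (seqs [Op Add (Cell 23) (V 23) (V 23), Op Add (Cell 25) (V 25) (Const 1)]),
     Op Div (Cell rC) (V 25) (V 24), Op Div (Cell rB) (V 25) (V rC),
     Op Shl (Cell rM) (Const 1) (V rB), Op Sub (Cell rM) (V rM) (Const 1),
     Move (Cell 23) (V rM), Move (Cell rQ) (Const 0),
     While Less (Const 2) (V 23) (seqs [Op Div (Cell 23) (V 23) (Const 3), Op Add (Cell rQ) (V rQ) (Const 1)]),
     Op Sub (Cell 23) (V rN) (Const 1), Op Div (Cell 24) (V 23) (V rQ), Op Div (Cell 25) (V 24) (V rQ),
     Op Add (Cell 25) (V 25) (Const 1), Op Mul (Cell 25) (V 25) (Const 4), Op Add (Cell rH) (V rB) (V 25),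
     Op Add (Cell rH) (V rH) (Const 1),
     Op Add (Cell 24) (V rH) (V 24), Op Add (Cell 24) (V 24) (Const 1), Op Div (Cell 24) (V 24) (V rC),
     Op Add (Cell 24) (V 24) (Const 33), Move (Cell 25) (Const 32),
     While Less (V 25) (V 24) (seqs [clr 25, Op Add (Cell 25) (V 25) (Const 1)]),
     Move (Cell 23) (Const 1), Move (Cell 24) (Const 0),
     While Less (V 24) (V rQ) (seqs [wrf 24 23, Op Mul (Cell 23) (V 23) (Const 3), Op Add (Cell 24) (V 24) (Const 1)])]"

text \<open>For loops whose registers after j rounds are a known function R j. The test holds before
  each of the first m rounds and fails afterwards, so the number of rounds is exactly m.\<close>

lemma (in ram) awp_For:
  assumes start: "\<rho> = R 0" "PF 0 F" and ok: "okop x \<and> okop y"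
    and stop: "\<not> test_val bo (opv (R m) x) (opv (R m) y)"
    and step: "\<And>j F \<tau>. j < m \<Longrightarrow> PF j F \<Longrightarrow> test_val bo (opv (R j) x) (opv (R j) y) \<and>
      awp p (\<lambda>\<rho>' F' out' \<tau>'. \<rho>' = R (Suc j) \<and> PF (Suc j) F' \<and> out' = out \<and> \<tau>' \<le> \<tau> + t) (R j) F out \<tau>"
    and Q: "\<And>F' \<tau>'. PF m F' \<Longrightarrow> \<tau>' \<le> \<tau> + m * (t + 1) + 1 \<Longrightarrow> Q (R m) F' out \<tau>'"
  shows "awp (While bo x y p) Q \<rho> F out \<tau>"
proof (rule awp_While[where T = "\<tau> + m * (t + 1)" and
    J = "\<lambda>\<rho>' F' out' \<tau>'. \<exists>j. j \<le> m \<and> \<rho>' = R j \<and> PF j F' \<and> out' = out \<and> \<tau>' \<le> \<tau> + j * (t + 1)"])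
  show "\<exists>j. j \<le> m \<and> \<rho> = R j \<and> PF j F \<and> out = out \<and> \<tau> \<le> \<tau> + j * (t + 1)"
    using start by (intro exI[of _ 0]) simp
  show "okop x \<and> okop y" by (rule ok)
next
  fix \<rho>1 F1 out1 \<tau>1
  assume "\<exists>j. j \<le> m \<and> \<rho>1 = R j \<and> PF j F1 \<and> out1 = out \<and> \<tau>1 \<le> \<tau> + j * (t + 1)"
  then obtain j where j: "j \<le> m" "\<rho>1 = R j" "PF j F1" "out1 = out" "\<tau>1 \<le> \<tau> + j * (t + 1)" by blast
  have "j * (t + 1) \<le> m * (t + 1)" using j(1) by (rule mult_right_mono) simp
  then show "\<tau>1 \<le> \<tau> + m * (t + 1)" using j(5) by linarith
  show "awp p (\<lambda>\<rho>' F' out' \<tau>'. \<exists>j. j \<le> m \<and> \<rho>' = R j \<and> PF j F' \<and> out' = out \<and> \<tau>' \<le> \<tau> + j * (t + 1)) \<rho>1 F1 out1 (\<tau>1 + 1)"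
    if "test_val bo (opv \<rho>1 x) (opv \<rho>1 y)"
  proof -
    have "j \<noteq> m" using that stop j(2) by auto
    then have jm: "j < m" using j(1) by simp
    have "awp p (\<lambda>\<rho>' F' out' \<tau>'. \<rho>' = R (Suc j) \<and> PF (Suc j) F' \<and> out' = out \<and> \<tau>' \<le> \<tau>1 + 1 + t) \<rho>1 F1 out1 (\<tau>1 + 1)"
      using step[OF jm j(3)] unfolding j(2,4) by blast
    then show ?thesis
    proof (rule awp_conseq)
      fix \<rho>' F' out' \<tau>'
      assume "\<rho>' = R (Suc j) \<and> PF (Suc j) F' \<and> out' = out \<and> \<tau>' \<le> \<tau>1 + 1 + t"
      then show "\<exists>j. j \<le> m \<and> \<rho>' = R j \<and> PF j F' \<and> out' = out \<and> \<tau>' \<le> \<tau> + j * (t + 1)"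
        using jm j(5) by (intro exI[of _ "Suc j"]) auto
    qed
  qed
  show "Q \<rho>1 F1 out1 (\<tau>1 + 1)" if "\<not> test_val bo (opv \<rho>1 x) (opv \<rho>1 y)"
  proof -
    have "j = m" using that step[of j F1] j by fastforce
    then show ?thesis using Q[of F1 "\<tau>1 + 1"] j by simp
  qed
qed

text \<open>Only the doubling loop relies on overflow; elsewhere \<open>awp_Add\<close> excludes
  it.\<close>

lemma (in ram) awp_Add_mod:
  assumes "4 \<le> d \<and> d < 32" "okop x \<and> okop y" "opv \<rho> x = u" "opv \<rho> y = v"
    "Q (\<rho>(d := take_bit w (u + v))) F out (\<tau> + 1)"
  shows "awp (Op Add (Cell d) x y) Q \<rho> F out \<tau>"
  using assms by (intro awp_Op) auto

text \<open>These are the values that \<open>init\<close> computes. \<open>q_max\<close> makes q the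
  largest number of colours that fit into a field. S counts 32 cells of scratch space and registers,
  and \<open>NF div c + 1\<close> words of fields.\<close>

locale bfs_machine = bfs_ram +
  fixes L :: nat
  assumes L: "0 < L" "semiring_bit_operations_class.or (n + 1) 524288 < (2::nat) ^ L"
      "2 ^ (L - 1) \<le> semiring_bit_operations_class.or (n + 1) (524288::nat)"
    and c_eq: "c = w div L" and b_eq: "b = w div c" and q_max: "2 ^ b - 1 < (3::nat) ^ (q + 1)"
    and S_eq: "S = NF div c + 33" and Sw': "S < 2 ^ w"
begin

lemma awp_init:
  assumes Q: "\<And>\<rho>' F' \<tau>'. stat \<rho>' \<Longrightarrow> (\<And>j. j < q \<Longrightarrow> F' j = 3 ^ j) \<Longrightarrow> (\<And>k. b \<le> k \<Longrightarrow> k < NF \<Longrightarrow> F' k = 0) \<Longrightarrow>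
      \<rho>' rR = s \<Longrightarrow> \<tau>' \<le> \<tau> + 3 * L + 3 * w + 20 * q + 3 * S + 100 \<Longrightarrow> Q \<rho>' F' out \<tau>'"
  shows "awp init Q \<rho> F out \<tau>"
proof -
  have I: "0 < length I" "1 < length I" "I ! 0 = n" "I ! 1 = s"
    using adj by (auto simp: adjacency_input_def)
  have I': "I \<noteq> []" "Suc 0 < length I" "I ! Suc 0 = s" using I by auto
  define x0 where "x0 = semiring_bit_operations_class.or (n + 1) (524288::nat)"
  have x0': "semiring_bit_operations_class.or (Suc n) (524288::nat) = x0" unfolding x0_def by simp
  have nw: "Suc n < 2 ^ w" using len_ge by simp
  have x0: "0 < x0 div 2 ^ j \<longleftrightarrow> j < L" for j
  proof
    assume "j < L"
    then have "(2::nat) ^ j \<le> 2 ^ (L - 1)" by (intro power_increasing) auto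
    also have "\<dots> \<le> x0" using L unfolding x0_def by simp
    finally show "0 < x0 div 2 ^ j" by (simp add: div_greater_zero_iff)
  next
    assume "0 < x0 div 2 ^ j"
    then have "2 ^ j \<le> x0" by (simp add: div_greater_zero_iff)
    also have "\<dots> < 2 ^ L" using L unfolding x0_def by simp
    finally show "j < L" by simp
  qed
  have Lw: "L \<le> w"
  proof (rule ccontr)
    assume "\<not> L \<le> w"
    then have "(2::nat) ^ w \<le> 2 ^ (L - 1)" by (intro power_increasing) auto
    moreover have "x0 < 2 ^ w" unfolding x0_def using nw w_big unfolding or_less_iff by simp
    ultimately show False using L(3) unfolding x0_def by linarith
  qed
  have ww: "w < 2 ^ w" by (rule less_exp)
  have jw: "Suc j < 2 ^ w" if "j < w" for j using that ww by linarith
  have d2: "x0 div 2 ^ j div 2 = x0 div 2 ^ Suc j" for j by (simp only: power_Suc2 div_mult2_eq)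
  have d3: "((2::nat) ^ b - Suc 0) div 3 ^ j div 3 = (2 ^ b - Suc 0) div 3 ^ Suc j" for j by (simp only: power_Suc2 div_mult2_eq)
  have x0_L: "x0 div 2 ^ L = 0" using x0[of L] by simp
  \<comment> \<open>For \<open>b = w\<close> the shifted 1 is lost, but then 0 - 1 wraps around to
    the desired mask.\<close>
  have mask: "take_bit w (2 ^ w + take_bit w (push_bit b 1) - 1) = 2 ^ b - (1::nat)"
  proof (cases "b = w")
    case True
    then show ?thesis by (simp add: push_bit_eq_mult take_bit_less)
  next
    case False
    then have "b < w" using b_le_w by simp
    then have bw: "(2::nat) ^ b < 2 ^ w" by simp
    then have "2 ^ w + take_bit w (push_bit b 1) - 1 = (2 ^ b - (1::nat)) + 2 ^ w"
      by (simp add: push_bit_eq_mult take_bit_less)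
    moreover have "2 ^ b - (1::nat) < 2 ^ w" using bw by linarith
    ultimately show ?thesis by (metis take_bit_eq_mod mod_add_self2 mod_less)
  qed
  have mask': "take_bit w (2 ^ w + 2 ^ b - Suc 0) = 2 ^ b - Suc 0" if "b < w"
    using mask that by (simp add: push_bit_eq_mult take_bit_less)
  have mask'': "take_bit w (2 ^ w - Suc 0) = 2 ^ b - Suc 0" if "\<not> b < w"
    using mask that b_le_w by (simp add: push_bit_eq_mult)
  \<comment> \<open>The loop test says that \<open>3 ^ Suc j\<close> is at most
    \<open>2 ^ b - 1\<close>, so the loop counts up to the exponent of the largest power of 3 below
    \<open>2 ^ b\<close>.\<close>
  have m3: "2 < ((2::nat) ^ b - 1) div 3 ^ j \<longleftrightarrow> j < q" for j
  proof
    assume "j < q"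
    then have "(3::nat) ^ Suc j \<le> 3 ^ q" by (intro power_increasing) auto
    then have "3 * 3 ^ j \<le> (2::nat) ^ b - 1" using q3 by simp
    then have "3 \<le> ((2::nat) ^ b - 1) div 3 ^ j" by (simp add: less_eq_div_iff_mult_less_eq)
    then show "2 < ((2::nat) ^ b - 1) div 3 ^ j" by simp
  next
    assume "2 < ((2::nat) ^ b - 1) div 3 ^ j"
    then have "3 \<le> ((2::nat) ^ b - 1) div 3 ^ j" by simp
    then have "3 * 3 ^ j \<le> (2::nat) ^ b - 1" by (simp add: less_eq_div_iff_mult_less_eq)
    then have "(3::nat) ^ Suc j < 3 ^ (q + 1)" using q_max by (simp only: power_Suc)
    then have "Suc j < q + 1" by (rule power_less_imp_less_exp[rotated]) simp
    then show "j < q" by simp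
  qed
  have qw: "Suc j < 2 ^ w" if "j < q" for j
    using that q_less_b b_le_w ww by linarith
  have qNF: "q < NF" using q_less_b b_less_H by simp
  have p3b: "(3::nat) ^ j < 2 ^ b" if "j \<le> q" for j
    by (rule le_less_trans[OF power_increasing[OF that] q3]) simp
  have p3w: "(3::nat) ^ j * 3 < 2 ^ w" if "j < q" for j
    using p3b[of "Suc j"] that pow_b_w[of "3 ^ Suc j"] by (simp add: mult.commute)
  have Hw: "H < 2 ^ w" "NF < 2 ^ w" using b_less_H NFw by auto
  have nsb4: "nsb * 4 < 2 ^ w" "nsb < 2 ^ w" "b + nsb * 4 < 2 ^ w" using H Hw by linarith+
  have lay: "Suc ((n - Suc 0) div q div q) = nsb" "nsb * 4 < 2 ^ w" "nsb < 2 ^ w" "b + nsb * 4 < 2 ^ w"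
    "Suc (b + nsb * 4) = H" "H < 2 ^ w" "H + (n - Suc 0) div q < 2 ^ w" "Suc (H + (n - Suc 0) div q) = NF" "NF < 2 ^ w"
    "NF div c + 33 = S" "S < 2 ^ w"
    using nsb4 nsb H Hw NF_eq S_eq Sw' by simp_all
  have zero: "\<forall>i<NF. F i = 0" if "\<forall>i<NF. i div c < S - 32 \<longrightarrow> F i = 0" for F :: "nat \<Rightarrow> nat"
  proof (intro allI impI)
    fix i assume "i < NF"
    then have "i div c \<le> NF div c" by (intro div_le_mono) simp
    then show "F i = 0" using that \<open>i < NF\<close> S_eq by simp
  qed
  show ?thesis unfolding init_def
    apply (rule awp_seqs awp_seqs1 | (rule awp_ops, (simp add: I I' nw x0'; fail)+))+
    apply (rule awp_For[where R = "\<lambda>j. \<rho>(rN := n, rR := s, 23 := x0 div 2 ^ j, 24 := j)" and m = L and t = 2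
          and PF = "\<lambda>_ _. True"])
         apply (simp add: fun_eq_iff x0' I I')
        apply simp
       apply simp
    using x0[of L] apply simp
    subgoal for j F \<tau>
      apply (rule conjI)
      using x0[of j] apply simp
      apply (rule awp_seqs awp_seqs1 | (rule awp_ops, (simp add: jw Lw less_le_trans[OF _ Lw]; fail)+))+
      by (simp add: fun_eq_iff d2 del: power_Suc)
    subgoal premises p1 for F1 \<tau>1
    apply (rule awp_seqs awp_seqs1 | (rule awp_ops, (simp; fail)+))+
    \<comment> \<open>\<open>2 ^ j\<close> modulo \<open>2 ^ w\<close> vanishes for the first time
      at \<open>j = w\<close>.\<close>
    apply (rule awp_For[where R = "\<lambda>j. \<rho>(rN := n, rR := s, 24 := L, 23 := take_bit w (2 ^ j), 25 := j)" and m = w and t = 2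
          and PF = "\<lambda>_ _. True"])
         using w20 apply (simp add: fun_eq_iff x0_L)
        apply simp
       apply simp
      apply simp
     subgoal for j F \<tau>
      apply (rule conjI)
       apply (simp add: take_bit_less)
      apply (rule awp_seqs awp_seqs1 | (rule awp_Add_mod awp_ops, (simp add: jw; fail)+))+
      by (simp add: fun_eq_iff take_bit_add mult_2 take_bit_less jw)
    subgoal premises p2 for F2 \<tau>2
    apply (rule awp_seqs | (rule awp_Div, (simp add: c_eq[symmetric] b_eq[symmetric]; fail)+))+
    apply (rule awp_Op, simp, simp)
    apply (rule awp_seqs)
    apply (rule awp_Op, simp, simp)
    apply (rule awp_seqs awp_seqs1 | (rule awp_ops, (simp add: mask; fail)+))+
    apply (rule awp_For[where R = "\<lambda>j. \<rho>(rN := n, rR := s, 24 := L, 25 := w, rC := c, rB := b, rM := 2 ^ b - 1, 23 := (2 ^ b - 1) div 3 ^ j, rQ := j)"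
         and m = q and t = 2 and PF = "\<lambda>_ _. True"])
         apply (simp add: fun_eq_iff mask' mask'' c_eq[symmetric] b_eq[symmetric])
        apply simp
       apply simp
      using m3[of q] apply simp
     subgoal for j F \<tau>
      apply (rule conjI)
       using m3[of j] apply simp
      apply (rule awp_seqs awp_seqs1 | (rule awp_ops, (simp add: qw; fail)+))+
      by (simp add: fun_eq_iff d3 del: power_Suc)
    subgoal premises p3 for F3 \<tau>3
    apply (rule awp_seqs awp_seqs1 | (rule awp_ops, (simp add: n1[unfolded One_nat_def] lay; fail)+))+
    apply (rule awp_For[where R = "\<lambda>j. \<rho>(rN := n, rR := s, rC := c, rB := b, rM := 2 ^ b - 1, 23 := n - 1, rQ := q,
          rH := H, 24 := S, 25 := 32 + j)"
         and m = "S - 32" and t = 2 and PF = "\<lambda>j F'. \<forall>i<NF. i div c < j \<longrightarrow> F' i = 0"])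
         apply (simp add: fun_eq_iff lay)
        apply simp
       apply simp
      using S32 apply simp
     subgoal for j F \<tau>
      apply (rule conjI)
       apply simp
      apply (rule awp_seqs)
      apply (rule awp_clr[where a = "32 + j"], simp, simp, simp, simp)
      apply (rule awp_seqs1)
      apply (rule awp_Add, simp, simp, simp, simp)
      using Sw' apply simp
      apply (simp add: fun_eq_iff)
      by (metis less_SucE)
    subgoal premises p4 for F4 \<tau>4
    apply (rule awp_seqs awp_seqs1 | (rule awp_ops, (simp; fail)+))+
    apply (rule awp_For[where R = "\<lambda>j. \<rho>(rN := n, rR := s, rC := c, rB := b, rM := 2 ^ b - 1, rQ := q,
          rH := H, 25 := S, 23 := 3 ^ j, 24 := j)"
         and m = q and t = 15 and PF = "\<lambda>j F'. (\<forall>i<j. F' i = 3 ^ i) \<and> (\<forall>i<NF. j \<le> i \<longrightarrow> F' i = 0)"])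
         using S32 apply (simp add: fun_eq_iff)
        using zero[OF p4(1)] apply simp
       apply simp
      apply simp
     subgoal premises pf for j F \<tau>
      apply (rule conjI)
       using pf(1) apply simp
      apply (rule awp_seqs)
      apply (rule awp_wrf[where i = j])
             apply (simp add: geo_def)
            apply simp
           apply simp
          apply simp
         apply (rule less_trans[OF pf(1) qNF])
        apply simp
       apply (rule p3b[OF less_imp_le[OF pf(1)]])
      using pf(1) apply -
      apply (rule awp_seqs awp_seqs1 | (rule awp_ops, (simp add: p3w qw; fail)+))+
      using pf(2) by (auto simp: fun_eq_iff less_Suc_eq)
    subgoal premises p5 for F5 \<tau>5
      apply (rule Q)
          apply (simp add: stat_def geo_def)
      using p5(1) q_less_b apply auto[3]
      using p1 p2 p3 p4(2) p5(2) S32 by (simp add: algebra_simps)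
    done
    done
    done
    done
    done
qed


end

section \<open>Resource bounds\<close>

text \<open>Double counting: the degree of u enters once for every vertex of its block, that is, at
  most q times.\<close>

lemma (in bfs_ram) pot_le: "pot {} \<le> 1000 * q * n + 130 * q * card (parcs G)"
proof -
  have block: "card {v. v < n \<and> v div q = k} \<le> q" for k
  proof -
    have "{v. v < n \<and> v div q = k} \<subseteq> {k * q..<k * q + q}"
    proof
      fix v assume "v \<in> {v. v < n \<and> v div q = k}"
      then have "v = k * q + v mod q" "v mod q < q" using q1 by auto
      then show "v \<in> {k * q..<k * q + q}" by (simp only: atLeastLessThan_iff) linarith
    qed
    from card_mono[OF _ this] show ?thesis by simp
  qed
  have "(\<Sum>v | v < n. block_deg (v div q)) = (\<Sum>v | v < n. \<Sum>u | u < n \<and> u div q = v div q. deg u)"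
    unfolding block_deg_def ..
  also have "\<dots> = (\<Sum>u | u < n. \<Sum>v | v < n \<and> u div q = v div q. deg u)"
    using sum.swap_restrict[of "{v. v < n}" "{v. v < n}" "\<lambda>v u. deg u" "\<lambda>v u. u div q = v div q"] by simp
  also have "\<dots> \<le> (\<Sum>u | u < n. q * deg u)"
  proof (rule sum_mono)
    fix u
    have "{v. v < n \<and> u div q = v div q} = {v. v < n \<and> v div q = u div q}" by auto
    then show "(\<Sum>v | v < n \<and> u div q = v div q. deg u) \<le> q * deg u" using block[of "u div q"] by simp
  qed
  also have "\<dots> = q * (\<Sum>u | u < n. deg u)" by (simp add: sum_distrib_left)
  also have "(\<Sum>u | u < n. deg u) = card (parcs G)"
  proof -
    have "parcs G = Sigma {u. u < n} nbrs"
      using pair_wf_digraph.in_arcsD1[OF wf] verts unfolding nbrs_def by auto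
    moreover have "finite (nbrs u)" for u
      by (rule finite_subset[of _ "{..<n}"]) (use nbrs_less in auto)
    ultimately show ?thesis unfolding deg_def by (simp add: card_SigmaI)
  qed
  finally have "(\<Sum>v | v < n. block_deg (v div q)) \<le> q * card (parcs G)" .
  then show ?thesis unfolding pot_def weight_def by (simp add: sum.distrib flip: sum_distrib_left)
qed

definition bfs_prog :: prog where
  "bfs_prog = Seq init main"

context bfs_machine
begin

lemma run_bfs:
  assumes "length M = S" "words w M"
  shows "\<exists>M' out t. run w I bfs_prog (M, []) t (M', out) \<and> bfs_order G s out \<and>
    t \<le> 3 * L + 3 * w + 20 * q + 3 * S + 310 + 1000 * q * n + 130 * q * card (parcs G) + 210 * n"
    (is "\<exists>M' out t. _ \<and> _ \<and> t \<le> ?T")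
proof -
  have "rep ((!) M) (fld M) M" using assms by (simp add: rep_def)
  moreover have "awp bfs_prog (\<lambda>\<rho>' F' out' \<tau>'. bfs_order G s out' \<and> \<tau>' \<le> ?T) ((!) M) (fld M) [] 0"
    unfolding bfs_prog_def
  proof (rule awp_Seq, rule awp_init, rule awp_main)
    fix \<rho> \<rho>' :: "nat \<Rightarrow> nat" and F F' :: "nat \<Rightarrow> nat" and out' \<tau> \<tau>'
    assume "bfs_order G s out'" "\<tau> \<le> 0 + 3 * L + 3 * w + 20 * q + 3 * S + 100" "\<tau>' \<le> \<tau> + pot {} + 210 * n + 210"
    then show "bfs_order G s out' \<and> \<tau>' \<le> ?T" using pot_le by simp
  qed
  ultimately show ?thesis unfolding awp_def wp_def by (metis add_0)
qed

section \<open>Estimates for the parameters\<close>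

lemma L_ge: "20 \<le> L" "n < 2 ^ L"
proof -
  have b: "n + 1 < 2 ^ L" "524288 < (2::nat) ^ L" using L(2) unfolding or_less_iff by auto
  show "n < 2 ^ L" using b(1) by simp
  show "20 \<le> L"
  proof (rule ccontr)
    assume "\<not> 20 \<le> L"
    then have "(2::nat) ^ L \<le> 2 ^ 19" by (intro power_increasing) auto
    then show False using b(2) by simp
  qed
qed

text \<open>For L above 20 the leading bit of the \<open>or\<close> cannot come from 524288, hence
  it comes from \<open>n + 1\<close>.\<close>

lemma L_le: "2 ^ (L - 1) \<le> n + 1 \<or> L = 20"
proof (rule disjCI)
  assume a: "L \<noteq> 20"
  show "2 ^ (L - 1) \<le> n + 1"
  proof (rule ccontr)
    assume "\<not> 2 ^ (L - 1) \<le> n + 1"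
    moreover have "(524288::nat) < 2 ^ (L - 1)"
    proof -
      have "(2::nat) ^ 20 \<le> 2 ^ (L - 1)" using L_ge a by (intro power_increasing) auto
      then show ?thesis by simp
    qed
    ultimately have "semiring_bit_operations_class.or (n + 1) (524288::nat) < 2 ^ (L - 1)"
      unfolding or_less_iff by simp
    then show False using L(3) by simp
  qed
qed

text \<open>Since \<open>c + 1\<close> is at most \<open>2 * c\<close>, rounding down the number of
  fields per word at most doubles their length.\<close>

lemma b_bounds: "L \<le> b" "b \<le> 2 * L"
proof -
  have cL: "c * L \<le> w" unfolding c_eq by (rule div_times_less_eq_dividend)
  then show "L \<le> b" unfolding b_eq using c1 by (simp add: less_eq_div_iff_mult_less_eq mult.commute)
  have "w < (c + 1) * L" using L(1) unfolding c_eq by (metis Suc_eq_plus1 dividend_less_div_times mult_Suc add.commute)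
  also have "\<dots> \<le> (2 * c) * L" using c1 by (intro mult_right_mono) auto
  finally have "w < 2 * L * c" by (simp add: algebra_simps)
  then have "b < 2 * L" unfolding b_eq by (rule less_mult_imp_div_less)
  then show "b \<le> 2 * L" by simp
qed

text \<open>Maximality of q: a field wastes no more than one ternary digit. This is the source of
  \<open>log 2 3\<close> bits per vertex.\<close>

lemma b_log: "real b \<le> (real q + 1) * log 2 3"
proof -
  have "(2::nat) ^ b \<le> 3 ^ (q + 1)" using q_max by linarith
  then have "real (2 ^ b) \<le> real (3 ^ (q + 1))" by (simp only: of_nat_le_iff)
  then have "log 2 (2 ^ b) \<le> log 2 (3 ^ (q + 1))" by (subst log_le_cancel_iff) auto
  then show ?thesis by (simp add: log_nat_power log_mult algebra_simps)
qed

lemma log23: "1 \<le> log 2 (3::real)" "log 2 (3::real) \<le> 2"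
proof -
  have "log 2 2 \<le> log 2 (3::real)" by (subst log_le_cancel_iff) auto
  then show "1 \<le> log 2 (3::real)" by simp
  have "log 2 3 \<le> log 2 (2 ^ 2 :: real)" by (subst log_le_cancel_iff) auto
  also have "\<dots> = 2" by (subst log_nat_power) auto
  finally show "log 2 (3::real) \<le> 2" .
qed

lemma q_ge: "real L \<le> 4 * real q"
proof -
  have "real b \<le> (real q + 1) * 2"
    using b_log log23 by (meson mult_left_mono of_nat_0_le_iff order_trans add_nonneg_nonneg zero_le_one)
  then show ?thesis using b_bounds(1) L_ge(1) by simp
qed

lemma NF_real: "real NF \<le> real n / real q + 4 * (real n / (real q * real q)) + real b + 6"
proof -
  have q0: "0 < real q" using q1 by simp
  have a: "real ((n - 1) div q) \<le> real n / real q"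
  proof -
    have "real ((n - 1) div q) \<le> real (n - 1) / real q" by (rule of_nat_div_le_of_nat)
    also have "\<dots> \<le> real n / real q" using q0 by (intro divide_right_mono) auto
    finally show ?thesis .
  qed
  have "real ((n - 1) div q div q) \<le> real ((n - 1) div q) / real q" by (rule of_nat_div_le_of_nat)
  also have "\<dots> \<le> (real n / real q) / real q" using a q0 by (intro divide_right_mono) auto
  finally have c: "real ((n - 1) div q div q) \<le> real n / (real q * real q)" by simp
  show ?thesis unfolding NF_eq H nsb using a c by simp
qed

text \<open>As \<open>w < c * (b + 1)\<close>, each field may be charged \<open>b + 1\<close> bits.
  About n / q colour fields of at most \<open>q lg 3 + 3\<close> bits give n lg 3 + 3 n / q, and 4 n
  / q^2 fields of at most 5 q bits give 20 n / q. The sum 23 n / q is at most 92 n / L. The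
  remaining terms are the table of powers with small constants, and 33 whole words.\<close>

lemma space_bound: "real (S * w) \<le> real n * log 2 3 + 92 * (real n / real L) + (2 * real L + 6) * (2 * real L + 1) + 33 * real w"
proof -
  have q0: "0 < real q" using q1 by simp
  have L0: "0 < real L" using L(1) by simp
  have "w < c * (b + 1)"
    unfolding b_eq using c1 by (metis Suc_eq_plus1 dividend_less_div_times less_le_trans mult.commute mult_Suc_right zero_less_one add.commute)
  then have "NF div c * w \<le> NF div c * (c * (b + 1))" by (intro mult_left_mono) auto
  also have "\<dots> = (NF div c * c) * (b + 1)" by (simp only: mult.assoc)
  also have "\<dots> \<le> NF * (b + 1)" by (intro mult_right_mono div_times_less_eq_dividend) auto
  finally have "S * w \<le> NF * (b + 1) + 33 * w" unfolding S_eq by (simp add: add_mult_distrib)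
  then have 1: "real (S * w) \<le> real NF * (real b + 1) + 33 * real w"
    by (metis (mono_tags, lifting) of_nat_1 of_nat_add of_nat_le_iff of_nat_mult of_nat_numeral)
  have b1: "real b + 1 \<le> real q * log 2 3 + 3" using b_log log23 by (simp add: algebra_simps)
  have b2: "real b + 1 \<le> 5 * real q"
  proof -
    have "real q * log 2 3 \<le> real q * 2" using log23 by (intro mult_left_mono) auto
    moreover have "1 \<le> real q" using q1 by simp
    ultimately show ?thesis using b1 by linarith
  qed
  have "real NF * (real b + 1) \<le> (real n / real q + 4 * (real n / (real q * real q)) + real b + 6) * (real b + 1)"
    using NF_real by (intro mult_right_mono) auto
  also have "\<dots> = (real n / real q) * (real b + 1) + 4 * (real n / (real q * real q)) * (real b + 1) + (real b + 6) * (real b + 1)"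
    by (simp add: algebra_simps)
  also have "\<dots> \<le> (real n / real q) * (real q * log 2 3 + 3) + 4 * (real n / (real q * real q)) * (5 * real q) + (2 * real L + 6) * (2 * real L + 1)"
  proof (rule add_mono[OF add_mono])
    show "(real n / real q) * (real b + 1) \<le> (real n / real q) * (real q * log 2 3 + 3)"
      using b1 by (rule mult_left_mono) simp
    show "4 * (real n / (real q * real q)) * (real b + 1) \<le> 4 * (real n / (real q * real q)) * (5 * real q)"
      using b2 by (rule mult_left_mono) simp
    have "real b \<le> 2 * real L" using b_bounds(2) by simp
    then show "(real b + 6) * (real b + 1) \<le> (2 * real L + 6) * (2 * real L + 1)"
      by (intro mult_mono) auto
  qed
  also have "(real n / real q) * (real q * log 2 3 + 3) = real n * log 2 3 + 3 * (real n / real q)"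
    using q0 by (simp add: field_simps)
  also have "4 * (real n / (real q * real q)) * (5 * real q) = 20 * (real n / real q)"
    using q0 by (simp add: field_simps)
  finally have 2: "real NF * (real b + 1) \<le> real n * log 2 3 + 23 * (real n / real q) + (2 * real L + 6) * (2 * real L + 1)"
    by simp
  have "real n / real q \<le> 4 * (real n / real L)"
  proof -
    have "real n * real L \<le> real n * (4 * real q)" using q_ge by (intro mult_left_mono) auto
    then show ?thesis using q0 L0 by (simp add: field_simps)
  qed
  with 1 2 show ?thesis by simp
qed

lemma q_le: "q \<le> 2 * L"
  using q_less_b b_bounds by simp

lemma S_le: "S \<le> 5 * n + 2 * L + 39"
proof -
  define x where "x = (n - 1) div q"
  define y where "y = x div q"
  have "x \<le> n - 1" "y \<le> x" unfolding x_def y_def by (rule div_le_dividend)+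
  then have "NF \<le> 5 * n + b + 6" unfolding NF_eq H nsb x_def[symmetric] y_def[symmetric] by simp
  moreover have "NF div c \<le> NF" by simp
  ultimately show ?thesis unfolding S_eq using b_bounds by linarith
qed

end

section \<open>Existence of the parameters\<close>

lemma power2_large: "20 \<le> w \<Longrightarrow> 4 * w + 200 \<le> (2::nat) ^ w"
proof (induction w rule: dec_induct)
  case (step k)
  then show ?case by simp
qed simp

text \<open>The delicate obligation is that field numbers and addresses fit into a word, which may
  hold hardly more than n itself. It is met because q is at least 12, so that there are only about n
  / 12 colour fields and fewer bitmaps and stack entries.\<close>

lemma bfs_machine_exists:
  assumes G: "input_graph kd G n m" and s: "s < n" and adj: "adjacency_input G n s I" and w: "20 \<le> w"
    and fits: "input_fits w I"
  shows "\<exists>S c b NF q nsb H L. bfs_machine w I S c b NF n q nsb H G s L"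
proof -
  define x where "x = semiring_bit_operations_class.or (n + 1) (524288::nat)"
  have nw: "n + 2 \<le> 2 ^ w" using adj fits by (auto simp: adjacency_input_def input_fits_def)
  have big: "4 * w + 200 \<le> 2 ^ w" by (rule power2_large[OF w])
  have "x \<noteq> 0" using or_less_iff[of "n + 1" 524288 0] unfolding x_def by simp
  then have "1 \<le> x" by simp
  from ex_power_ivl1[OF _ this, of 2] obtain k where k: "2 ^ k \<le> x" "x < 2 ^ (k + 1)" by auto
  define L where "L = k + 1"
  define c where "c = w div L"
  define b where "b = w div c"
  have w19: "(2::nat) ^ 19 < 2 ^ w" using w by (intro power_strict_increasing) auto
  have xw: "x < 2 ^ w" unfolding x_def or_less_iff using nw w19 by simp
  have "(2::nat) ^ k < 2 ^ w" using k(1) xw by (rule le_less_trans)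
  then have Lw: "L \<le> w" unfolding L_def by simp
  have c1: "1 \<le> c"
  proof -
    have "L div L \<le> w div L" using Lw by (rule div_le_mono)
    then show ?thesis unfolding c_def L_def by simp
  qed
  have cL: "c * L \<le> w" unfolding c_def by (rule div_times_less_eq_dividend)
  then have Lb: "L \<le> b" unfolding b_def using c1 by (simp add: less_eq_div_iff_mult_less_eq mult.commute)
  have cb: "c * b \<le> w" unfolding b_def by (rule times_div_less_eq_dividend)
  have bw: "b \<le> w" unfolding b_def by (rule div_le_dividend)
  have nL: "n < 2 ^ L" and L19: "524288 < (2::nat) ^ L"
    using k(2) unfolding L_def x_def or_less_iff by auto
  have L20: "20 \<le> L"
  proof (rule ccontr)
    assume "\<not> 20 \<le> L"
    then have "(2::nat) ^ L \<le> 2 ^ 19" by (intro power_increasing) auto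
    then show False using L19 by simp
  qed
  have b20: "(1048576::nat) \<le> 2 ^ b"
  proof -
    have "(2::nat) ^ 20 \<le> 2 ^ b" using L20 Lb by (intro power_increasing) auto
    then show ?thesis by simp
  qed
  then have "1 \<le> (2::nat) ^ b - 1" by linarith
  from ex_power_ivl1[OF _ this, of 3] obtain q where q: "3 ^ q \<le> (2::nat) ^ b - 1" "2 ^ b - 1 < (3::nat) ^ (q + 1)" by auto
  \<comment> \<open>\<open>3 ^ 12 = 531441\<close>, which is less than \<open>2 ^ 20\<close> and
    hence than \<open>2 ^ b\<close>.\<close>
  have q12: "12 \<le> q"
  proof (rule ccontr)
    assume "\<not> 12 \<le> q"
    then have "(3::nat) ^ (q + 1) \<le> 3 ^ 12" by (intro power_increasing) auto
    then show False using q(2) b20 by simp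
  qed
  define v where "v = (n - 1) div q"
  define nsb where "nsb = v div q + 1"
  define H where "H = b + 4 * nsb + 1"
  define NF where "NF = H + v + 1"
  define S where "S = NF div c + 33"
  have v12: "12 * v \<le> 2 ^ w"
  proof -
    have "12 * v \<le> q * v" using q12 by (rule mult_right_mono) simp
    also have "\<dots> \<le> n - 1" unfolding v_def by (rule times_div_less_eq_dividend)
    finally show ?thesis using nw by linarith
  qed
  have v144: "12 * (v div q) \<le> v"
  proof -
    have "12 * (v div q) \<le> q * (v div q)" using q12 by (rule mult_right_mono) simp
    also have "\<dots> \<le> v" by (rule times_div_less_eq_dividend)
    finally show ?thesis .
  qed
  have NFw: "NF + 33 < 2 ^ w"
  proof -
    define u where "u = v div q"
    have "NF = b + 4 * u + v + 6" unfolding NF_def H_def nsb_def u_def by simp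
    moreover have "12 * u \<le> v" using v144 unfolding u_def .
    ultimately show ?thesis using bw v12 big by linarith
  qed
  have "NF div c \<le> NF" by (rule div_le_dividend)
  then have Sw: "S < 2 ^ w" unfolding S_def using NFw by linarith
  have NFS: "NF \<le> (S - 32) * c"
  proof -
    have "NF < (NF div c + 1) * c"
      using c1 by (metis Suc_eq_plus1 dividend_less_div_times less_le_trans mult.commute mult_Suc_right zero_less_one add.commute)
    then show ?thesis unfolding S_def by simp
  qed
  interpret pair_fin_digraph G by (rule input_graph_arcs(1)[OF G])
  have "bfs_machine w I S c b NF n q nsb H G s L"
  proof (unfold_locales)
    show "20 \<le> w" by fact
    show "words w I" "length I \<le> 2 ^ w" using fits by (auto simp: input_fits_def)
    show "1 \<le> c" "c * b \<le> w" "NF \<le> (S - 32) * c" "S < 2 ^ w" "2 ^ b - 1 < (3::nat) ^ (q + 1)" by fact+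
    show "1 \<le> b" "1 \<le> n" "1 \<le> q" using L20 Lb s q12 by linarith+
    show "32 \<le> S" "S \<le> 2 ^ w" using Sw unfolding S_def by linarith+
    show "3 ^ q < (2::nat) ^ b" using q(1) b20 by linarith
    have "n < 2 ^ L" by (rule nL)
    also have "\<dots> \<le> (2::nat) ^ b" using Lb by (intro power_increasing) auto
    finally show "n < 2 ^ b" .
    show "nsb = (n - 1) div q div q + 1" "H = b + 4 * nsb + 1" "NF = H + (n - 1) div q + 1" "S = NF div c + 33"
      unfolding nsb_def H_def NF_def S_def v_def by simp_all
    show "NF < 2 ^ w" using NFw by linarith
    show "pverts G = {..<n}" using G by (simp add: input_graph_def)
    show "s < n" "adjacency_input G n s I" by fact+
    show "0 < L" unfolding L_def by simp
    show "semiring_bit_operations_class.or (n + 1) 524288 < (2::nat) ^ L"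
      "2 ^ (L - 1) \<le> semiring_bit_operations_class.or (n + 1) (524288::nat)"
      using k unfolding L_def x_def by simp_all
    show "c = w div L" "b = w div c" unfolding c_def b_def by simp_all
  qed
  then show ?thesis by blast
qed

context bfs_machine
begin

lemma L_log: "524288 \<le> n \<Longrightarrow> real L \<le> log 2 (real n) + 2" "log 2 (real n) \<le> real L"
proof -
  have n0: "0 < real n" using n1 by simp
  have "real n \<le> real (2 ^ L)" using L_ge(2) by (simp only: of_nat_le_iff less_imp_le)
  then have "log 2 (real n) \<le> log 2 (2 ^ L)" using n0 by (subst log_le_cancel_iff) auto
  then show "log 2 (real n) \<le> real L" by (simp add: log_nat_power)
  assume n: "524288 \<le> n"
  have "2 ^ (L - 1) \<le> 2 * n"
    using L_le
  proof
    assume "2 ^ (L - 1) \<le> n + 1"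
    then show ?thesis using n by linarith
  next
    assume "L = 20"
    then show ?thesis using n by simp
  qed
  then have "real (2 ^ (L - 1)) \<le> real (2 * n)" by (simp only: of_nat_le_iff)
  then have "log 2 (2 ^ (L - 1)) \<le> log 2 (2 * real n)" using n0 by (subst log_le_cancel_iff) auto
  also have "\<dots> = 1 + log 2 (real n)" using n0 by (simp add: log_mult)
  finally have "real (L - 1) \<le> 1 + log 2 (real n)" by (simp add: log_nat_power)
  then show "real L \<le> log 2 (real n) + 2" using L(1) by simp
qed

end

text \<open>\<open>f n \<le> log 2 (real n)\<close> turns n / lg n into n / f(n). The last
  inequality absorbs the space of the table of powers into the same term.\<close>

lemma eventually_parameters:
  assumes "slow_growing f"
  shows "\<exists>N. \<forall>n\<ge>N. 524288 \<le> n \<and> 1 \<le> f n \<and> f n \<le> log 2 (real n) \<and>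
    (2 * (log 2 (real n) + 2) + 6) * (2 * (log 2 (real n) + 2) + 1) \<le> real n / log 2 (real n)"
proof -
  have "eventually (\<lambda>n. f n \<ge> 1) sequentially"
    using assms unfolding slow_growing_def by (simp add: filterlim_at_top)
  moreover have "eventually (\<lambda>n. norm (f n) \<le> 1 * norm (log 2 (real n))) sequentially"
  proof -
    have "f \<in> o(\<lambda>n. log 2 (real n))" using assms by (simp add: slow_growing_def)
    then show ?thesis by (rule landau_o.smallD) simp
  qed
  moreover have "eventually (\<lambda>n. (2 * (log 2 (real n) + 2) + 6) * (2 * (log 2 (real n) + 2) + 1) \<le> real n / log 2 (real n)) sequentially"
    by real_asymp
  moreover have "eventually (\<lambda>n. 524288 \<le> n) sequentially" by (rule eventually_ge_at_top)
  ultimately have "eventually (\<lambda>n. 524288 \<le> n \<and> 1 \<le> f n \<and> f n \<le> log 2 (real n) \<and>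
    (2 * (log 2 (real n) + 2) + 6) * (2 * (log 2 (real n) + 2) + 1) \<le> real n / log 2 (real n)) sequentially"
    by eventually_elim auto
  then show ?thesis unfolding eventually_sequentially .
qed

(* w0 is the least word length on which P works (its constants must fit into a word).
   Correctness is required for all n, the resource bounds for n \<ge> N. The condition on K says
   that a single word is within the error term O(n / f n); whenever w is O(lg n), it holds for
   all large n. *)
theorem theorem9:
  fixes f :: "nat \<Rightarrow> real"
  assumes "slow_growing f"
  shows "\<exists>P w0. \<forall>K::real. \<exists>(C::real) N. \<forall>kd G n m s w I.
    input_graph kd G n m \<and> s < n \<and> adjacency_input G n s I \<and> w0 \<le> w \<and> input_fits w I \<longrightarrow>
    (\<exists>S.
      (n \<ge> N \<and> real w * f n \<le> K * real n \<longrightarrow>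
         real (S * w) \<le> real n * log 2 3 + C * (real n / f n)) \<and>
      (\<forall>M. length M = S \<and> words w M \<longrightarrow>
        (\<exists>M' out t. run w I P (M, []) t (M', out) \<and> bfs_order G s out \<and>
          (n \<ge> N \<and> real w * f n \<le> K * real n \<longrightarrow>
             real t \<le> C * real m * f n * log 2 (real n)))))"
proof -
  obtain N where N: "\<And>n. n \<ge> N \<Longrightarrow> 524288 \<le> n \<and> 1 \<le> f n \<and> f n \<le> log 2 (real n) \<and>
    (2 * (log 2 (real n) + 2) + 6) * (2 * (log 2 (real n) + 2) + 1) \<le> real n / log 2 (real n)"
    using eventually_parameters[OF assms] by blast
  show ?thesis
  proof (rule exI[of _ bfs_prog], rule exI[of _ 20], rule allI)
    fix K :: real
    \<comment> \<open>The 33 words outside the packed data contribute the multiple of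
      \<open>\<bar>K\<bar>\<close> in space, and 40000 exceeds the constant 30000 of the time
      bound.\<close>
    define C where "C = 40000 + 33 * \<bar>K\<bar>"
    show "\<exists>(C::real) N. \<forall>kd G n m s w I.
      input_graph kd G n m \<and> s < n \<and> adjacency_input G n s I \<and> 20 \<le> w \<and> input_fits w I \<longrightarrow>
      (\<exists>S.
        (n \<ge> N \<and> real w * f n \<le> K * real n \<longrightarrow>
           real (S * w) \<le> real n * log 2 3 + C * (real n / f n)) \<and>
        (\<forall>M. length M = S \<and> words w M \<longrightarrow>
          (\<exists>M' out t. run w I bfs_prog (M, []) t (M', out) \<and> bfs_order G s out \<and>
            (n \<ge> N \<and> real w * f n \<le> K * real n \<longrightarrow>
               real t \<le> C * real m * f n * log 2 (real n)))))"
    proof (rule exI[of _ C], rule exI[of _ N], intro allI impI, elim conjE)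
      fix kd G n m s w I
      assume G: "input_graph kd G n m" and s: "s < n" and adj: "adjacency_input G n s I" and w: "20 \<le> w"
        and fits: "input_fits w I"
      obtain S c b NF q nsb H L where "bfs_machine w I S c b NF n q nsb H G s L"
        using bfs_machine_exists[OF G s adj w fits] by blast
      then interpret bfs_machine w I S c b NF n q nsb H G s L .
      define x where "x = log 2 (real n)"
      have wK: "real w \<le> \<bar>K\<bar> * (real n / f n)" if "n \<ge> N" "real w * f n \<le> K * real n"
      proof -
        have f0: "0 < f n" using N[OF that(1)] by linarith
        have "real w * f n \<le> \<bar>K\<bar> * real n"
          using that(2) mult_right_mono[OF abs_ge_self[of K], of "real n"] by linarith
        then show ?thesis using f0 by (simp add: field_simps)
      qed
      have space: "real (S * w) \<le> real n * log 2 3 + C * (real n / f n)" if "n \<ge> N" "real w * f n \<le> K * real n"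
      proof -
        note n = N[OF that(1), folded x_def]
        have f0: "0 < f n" using n by linarith
        have x1: "0 < x" using n by linarith
        have Lx: "real L \<le> x + 2" "x \<le> real L" using L_log n unfolding x_def by auto
        have nx: "real n / x \<le> real n / f n" using n f0 by (intro divide_left_mono) auto
        have "real n / real L \<le> real n / x" using Lx x1 by (intro divide_left_mono) auto
        moreover have "(2 * real L + 6) * (2 * real L + 1) \<le> (2 * (x + 2) + 6) * (2 * (x + 2) + 1)"
          using Lx x1 by (intro mult_mono) auto
        moreover have "0 \<le> real n / f n" using f0 by simp
        ultimately have "real (S * w) \<le> real n * log 2 3 + 92 * (real n / f n) + real n / f n + 33 * (\<bar>K\<bar> * (real n / f n))"
          using space_bound wK[OF that] nx n by linarith
        also have "\<dots> = real n * log 2 3 + (93 + 33 * \<bar>K\<bar>) * (real n / f n)" by (simp add: algebra_simps)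
        also have "\<dots> \<le> real n * log 2 3 + C * (real n / f n)"
          unfolding C_def using \<open>0 \<le> real n / f n\<close> by (intro add_left_mono mult_right_mono) auto
        finally show ?thesis .
      qed
      have time: "real t \<le> C * real m * f n * log 2 (real n)" if "n \<ge> N" "real w * f n \<le> K * real n"
        and t: "t \<le> 3 * L + 3 * w + 20 * q + 3 * S + 310 + 1000 * q * n + 130 * q * card (parcs G) + 210 * n" for t
      proof -
        note n = N[OF that(1), folded x_def]
        have arcs: "card (parcs G) \<le> 2 * m" "n \<le> 4 * m"
          using input_graph_arcs(2,3)[OF G] n by auto
        have m1: "1 \<le> real m" using arcs n1 by simp
        have x1: "1 \<le> x" using n by linarith
        have Lx: "real L \<le> 3 * x" using L_log(1) n x1 unfolding x_def by linarith
        have qx: "real q \<le> 6 * x" using q_le Lx by linarith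
        have X: "x \<le> real m * x" "real m \<le> real m * x" using m1 x1 by (auto simp: mult_le_cancel_right1 mult_le_cancel_left1)
        have n4: "real n \<le> 4 * real m" using arcs by simp
        have "real w \<le> \<bar>K\<bar> * real n"
        proof -
          have "real n / f n \<le> real n / 1" using n by (intro divide_left_mono) auto
          then have "\<bar>K\<bar> * (real n / f n) \<le> \<bar>K\<bar> * real n" by (intro mult_left_mono) auto
          then show ?thesis using wK[OF that(1,2)] by linarith
        qed
        also have "\<bar>K\<bar> * real n \<le> \<bar>K\<bar> * (4 * (real m * x))" using n4 X by (intro mult_left_mono) auto
        finally have wm: "real w \<le> 4 * (\<bar>K\<bar> * (real m * x))" by simp
        have qn: "real q * real n \<le> 24 * (real m * x)"
          using mult_mono[OF qx n4] x1 by (simp add: mult.commute)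
        have qa: "real q * real (card (parcs G)) \<le> 12 * (real m * x)"
          using mult_mono[of "real q" "6 * x" "real (card (parcs G))" "2 * real m"] qx arcs(1) x1 by (simp add: mult.commute)
        have Sm: "real S \<le> 5 * real n + 2 * real L + 39" using S_le by linarith
        have "real t \<le> 3 * real L + 3 * real w + 20 * real q + 3 * real S + 310 + 1000 * (real q * real n)
            + 130 * (real q * real (card (parcs G))) + 210 * real n"
          using of_nat_mono[OF t, where 'a = real] by (simp add: algebra_simps)
        also have "\<dots> \<le> 30000 * (real m * x) + 12 * (\<bar>K\<bar> * (real m * x))"
          using Lx wm qx Sm qn qa n4 X m1 by linarith
        also have "\<dots> = (30000 + 12 * \<bar>K\<bar>) * (real m * x)" by (simp add: distrib_right)
        also have "\<dots> \<le> C * (real m * x)"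
          unfolding C_def using m1 x1 by (intro mult_right_mono) auto
        \<comment> \<open>The factor \<open>f n\<close> is slack: the steps are already bounded by a
          multiple of \<open>m lg n\<close>.\<close>
        also have "\<dots> \<le> C * (real m * x) * f n"
          using mult_left_mono[of 1 "f n" "C * (real m * x)"] n m1 x1 unfolding C_def by simp
        finally show ?thesis by (simp add: x_def mult_ac)
      qed
      show "\<exists>S.
        (n \<ge> N \<and> real w * f n \<le> K * real n \<longrightarrow>
           real (S * w) \<le> real n * log 2 3 + C * (real n / f n)) \<and>
        (\<forall>M. length M = S \<and> words w M \<longrightarrow>
          (\<exists>M' out t. run w I bfs_prog (M, []) t (M', out) \<and> bfs_order G s out \<and>
            (n \<ge> N \<and> real w * f n \<le> K * real n \<longrightarrow>
               real t \<le> C * real m * f n * log 2 (real n))))"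
      proof (rule exI[of _ S], intro conjI allI impI, elim conjE)
        show "real (S * w) \<le> real n * log 2 3 + C * (real n / f n)" if "n \<ge> N" "real w * f n \<le> K * real n"
          by (rule space[OF that])
        fix M assume "length M = S \<and> words w M"
        then obtain M' out t where "run w I bfs_prog (M, []) t (M', out)" "bfs_order G s out"
          "t \<le> 3 * L + 3 * w + 20 * q + 3 * S + 310 + 1000 * q * n + 130 * q * card (parcs G) + 210 * n"
          using run_bfs by blast
        then show "\<exists>M' out t. run w I bfs_prog (M, []) t (M', out) \<and> bfs_order G s out \<and>
            (n \<ge> N \<and> real w * f n \<le> K * real n \<longrightarrow> real t \<le> C * real m * f n * log 2 (real n))"
          using time by blast
      qed
    qed
  qed
qed

end
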